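(* Fix a solution $y$ of P-I and, for $k\in\mathbb Z_5$ and $i=1,2$, let $\Phi_k^{(i)}(\lambda,z)$ be the $i$-th component of the normalized solution $\overrightarrow{\Phi}_k(\lambda,z)$ attached to $y$, with Stokes multipliers $\sigma_k$ (see context). Then: (i) $\overrightarrow{\Phi}_k(\lambda,z)$ is a meromorphic function of $z$. All the singularities are double poles. Moreover, $a\in\mathbb C$ is a pole of $\overrightarrow{\Phi}_k(\lambda,z)$ if and only if it is a pole of $y$. (ii) If $a\in\mathbb C$ is a pole of $y$, then $$\Psi_k(\lambda)=\lim_{z\to a}(z-a)\,\Phi_k^{(2)}(\lambda,z)$$ is an entire function of $\lambda$. It satisfies the following Schrödinger equation with cubic potential: $$\frac{d^2\Psi_k(\lambda)}{d\lambda^2}=\left(4\lambda^3-2a\lambda-28b\right)\Psi_k(\lambda),$$ where $b\in\mathbb C$ is the coefficient of $(z-a)^4$ in the Laurent expansion of $y$ around $a$. (iii) If $\lambda^{1/2}$ and $\lambda^{1/4}$ are chosen as in the asymptotics defining $\overrightarrow{\Phi}_k$ (see context), then for every $\varepsilon>0$ $$\lim_{\substack{\lambda\to\infty\\ |\arg\lambda-\frac{2\pi k}{5}|<\frac{3\pi}{5}-\varepsilon}}\lambda^{\frac34}\,e^{\frac45\lambda^{5/2}-a\lambda^{1/2}}\,\Psi_k(\lambda)=i.$$ (iv) The Schrödinger equation in (ii) possesses the same monodromy data as the linear equation in $\lambda$ satisfied by $\overrightarrow{\Phi}_k$, i.e. $$\Psi_{k-1}(\lambda)=\Psi_{k+1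}(\lambda)+\sigma_k\Psi_k(\lambda).$$
   Context: P-I is the Painlevé first equation $y''=6y^2-z$, $z\in\mathbb C$; any local solution extends to a global meromorphic function $y$ on $\mathbb C$. In a neighborhood of a pole $a$, $y$ has the convergent Laurent expansion $$y(z)=\frac{1}{(z-a)^2}+\frac{a(z-a)^2}{10}+\frac{(z-a)^3}{6}+b(z-a)^4+\sum_{j\ge5}c_j(a,b)(z-a)^j,$$ where $b$ is some complex number and the $c_j(a,b)$ are real polynomials in $a$ and $b$ not depending on the particular solution $y$. $\mathbb Z_5=\{-2,\dots,2\}$, with indices taken modulo $5$. P-I is the compatibility condition of the linear system $$\partial_\lambda\overrightarrow{\Phi}(\lambda,z)=\begin{pmatrix} y'(z) & 2\lambda^2+2\lambda y(z)-z+2y^2(z)\\ 2(\lambda-y(z)) & -y'(z)\end{pmatrix}\overrightarrow{\Phi}(\lambda,z),\qquad \partial_z\overrightarrow{\Phi}(\lambda,z)=-\begin{pmatrix}0&2y(z)+\lambda\\1&0\end{pmatrix}\overrightarrow{\Phi}(\lambda,z).$$ For $k\in\mathbb Z_5$ the branch of $\lambda^{1/2}$ is fixed so that $\mathrm{Re}\,\lambda^{5/2}\to+\infty$ as $|\lambda|\to\infty$, $\arg\lambda=\frac{2\pi k}{5}$. The function $\lambda^{1/4}$ is defined globally on the complex plane minus the negative real axis and is positive on the positive real axis; depending on $k$, $(\lambda^{1/4})^2$ may not be equal to $\lambda^{1/2}$. On a simply connected region $U$ on which $y$ is holomorphic, $\overrightarrow{\Phi}_k(\lambda,z)$ denotes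 the unique solution of both linear equations such that, for $\varepsilon>0$ arbitrarily small, $$\lim_{\substack{\lambda\to\infty\\ |\arg\lambda-\frac{2\pi k}{5}|<\frac{3\pi}{5}-\varepsilon}}e^{\frac45\lambda^{5/2}-z\lambda^{1/2}}\begin{pmatrix}\lambda^{-1/4}&0\\0&\lambda^{1/4}\end{pmatrix}\overrightarrow{\Phi}_k(\lambda,z)=\begin{pmatrix}1\\1\end{pmatrix}\qquad\text{for all }z\in U.$$ The Stokes multipliers $\sigma_k$, $k\in\mathbb Z_5$, are defined by $\overrightarrow{\Phi}_{k-1}=\overrightarrow{\Phi}_{k+1}+\sigma_k\overrightarrow{\Phi}_k$; they do not depend on $z$. The set of all five Stokes multipliers is called the monodromy data of the linear equation in $\lambda$.
   Formalization: Branches are mended: λ^{1/4} is any continuous branch on the k-th sector (existence of Φ_k forces (λ^{1/4})²=−λ^{1/2}); in (iii) λ^{3/4} means (−iλ^{1/4})³, since (λ^{1/4})³ gives limit 1, not i; k is an integer, not mod 5, as the five Stokes relations clash. *)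

theory Defs
  imports "HOL-Complex_Analysis.Complex_Analysis"
begin

(* The values of a meromorphic function of the library at its poles are arbitrary; away from its
   poles a solution is required to be a genuine holomorphic function (no removable defects). *)
definition PI_solution :: "(complex \<Rightarrow> complex) \<Rightarrow> bool" where
  "PI_solution y \<longleftrightarrow> y meromorphic_on UNIV \<and>
     (\<forall>z. \<not> is_pole y z \<longrightarrow> y analytic_on {z} \<and> deriv (deriv y) z = 6 * (y z)\<^sup>2 - z)"

definition regular_region :: "(complex \<Rightarrow> complex) \<Rightarrow> complex set \<Rightarrow> bool" where
  "regular_region y U \<longleftrightarrow> open U \<and> simply_connected U \<and> y holomorphic_on U"

definition lax_matrix_spectral :: "(complex \<Rightarrow> complex) \<Rightarrow> complex \<Rightarrow> complex \<Rightarrow> complex^2^2" where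
  "lax_matrix_spectral y \<zeta> z =
     vector [vector [deriv y z, 2 * \<zeta>\<^sup>2 + 2 * \<zeta> * y z - z + 2 * (y z)\<^sup>2],
             vector [2 * (\<zeta> - y z), - deriv y z]]"

definition lax_matrix_deform :: "(complex \<Rightarrow> complex) \<Rightarrow> complex \<Rightarrow> complex \<Rightarrow> complex^2^2" where
  "lax_matrix_deform y \<zeta> z = - vector [vector [0, 2 * y z + \<zeta>], vector [1, 0]]"

definition lax_solution ::
    "(complex \<Rightarrow> complex) \<Rightarrow> complex set \<Rightarrow> (complex \<Rightarrow> complex \<Rightarrow> complex^2) \<Rightarrow> bool" where
  "lax_solution y U \<Phi> \<longleftrightarrow> (\<forall>\<zeta>. \<forall>z\<in>U. \<forall>i.
     ((\<lambda>s. \<Phi> s z $ i) has_field_derivative (lax_matrix_spectral y \<zeta> z *v \<Phi> \<zeta> z) $ i) (at \<zeta>) \<and>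
     ((\<lambda>t. \<Phi> \<zeta> t $ i) has_field_derivative (lax_matrix_deform y \<zeta> z *v \<Phi> \<zeta> z) $ i) (at z))"

(* The open sector |arg zeta - 2 pi k / 5| < 3 pi / 5 - \<epsilon>. As a subset of the plane it depends only
   on k mod 5, so integers k serve as lifts of the elements of Z_5. *)
definition sector :: "int \<Rightarrow> real \<Rightarrow> complex set" where
  "sector k \<epsilon> = {of_real r * cis \<theta> | r \<theta>.
     0 < r \<and> \<bar>\<theta> - 2 * pi * of_int k / 5\<bar> < 3 * pi / 5 - \<epsilon>}"

(* The unique continuous branch h of zeta^(1/2) on the k-th sector for which
   Re (zeta^(5/2)) = Re (h^5) tends to plus infinity on the central ray. *)
definition sqrt_branch :: "int \<Rightarrow> (complex \<Rightarrow> complex) \<Rightarrow> bool" where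
  "sqrt_branch k h \<longleftrightarrow> continuous_on (sector k 0) h \<and> (\<forall>\<zeta>\<in>sector k 0. (h \<zeta>)\<^sup>2 = \<zeta>) \<and>
     filterlim (\<lambda>r::real. Re ((h (of_real r * cis (2 * pi * of_int k / 5))) ^ 5)) at_top at_top"

(* Any continuous branch of zeta^(1/4) on the k-th sector. Its square need not be the branch of
   zeta^(1/2) above; the principal branch is admissible whenever the sector avoids the negative
   axis, but the sectors around arg zeta = 4 pi / 5 and - 4 pi / 5 cross that axis. *)
definition fourth_root_branch :: "int \<Rightarrow> (complex \<Rightarrow> complex) \<Rightarrow> bool" where
  "fourth_root_branch k q \<longleftrightarrow> continuous_on (sector k 0) q \<and> (\<forall>\<zeta>\<in>sector k 0. q \<zeta> ^ 4 = \<zeta>)"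

definition normalized_solution ::
    "(complex \<Rightarrow> complex) \<Rightarrow> int \<Rightarrow> (complex \<Rightarrow> complex) \<Rightarrow> (complex \<Rightarrow> complex) \<Rightarrow> complex set
      \<Rightarrow> (complex \<Rightarrow> complex \<Rightarrow> complex^2) \<Rightarrow> bool" where
  "normalized_solution y k h q U \<Phi> \<longleftrightarrow> lax_solution y U \<Phi> \<and>
     (\<forall>z\<in>U. \<forall>\<epsilon>>0.
       ((\<lambda>\<zeta>. exp (4 / 5 * h \<zeta> ^ 5 - z * h \<zeta>) *s
              ((vector [vector [inverse (q \<zeta>), 0], vector [0, q \<zeta>]] :: complex^2^2) *v \<Phi> \<zeta> z))
         \<longlongrightarrow> vector [1, 1]) (inf at_infinity (principal (sector k \<epsilon>))))"

(* For a normalized solution to exist one needs q^2 = - h on the sector: the z-equation forces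
   the ratio of the two components to be asymptotic to - zeta^(1/2). Hence - \<i> * q is a fourth root
   of zeta whose square is the chosen branch h of zeta^(1/2). The power zeta^(3/4) is its cube,
   i.e. the 3/2-th power of h; it equals \<i> * q^3. *)
definition three_quarter_power :: "(complex \<Rightarrow> complex) \<Rightarrow> complex \<Rightarrow> complex" where
  "three_quarter_power q \<zeta> = (- \<i> * q \<zeta>) ^ 3"

(* The Stokes multiplier of index k. A family that is periodic in k with period 5 cannot satisfy
   this relation for all k: taking determinants,
   det (\<Phi>_{k-1}, \<Phi>_k) = - det (\<Phi>_k, \<Phi>_{k+1}), and five steps would give a change of sign.
   With k an integer and the branches of zeta^(1/4) for k - 1 and k + 1 matched on the overlap of
   their sectors, the relation holds for every k, and \<Phi>_{k+5} is \<Phi>_k or - \<Phi>_k. *)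
definition stokes_multiplier ::
    "(complex \<Rightarrow> complex) \<Rightarrow> (int \<Rightarrow> complex set \<Rightarrow> complex \<Rightarrow> complex \<Rightarrow> complex^2)
      \<Rightarrow> int \<Rightarrow> complex \<Rightarrow> bool" where
  "stokes_multiplier y \<Phi> k \<sigma> \<longleftrightarrow> (\<forall>U. regular_region y U \<longrightarrow> (\<forall>\<zeta>. \<forall>z\<in>U.
     \<Phi> (k - 1) U \<zeta> z = \<Phi> (k + 1) U \<zeta> z + \<sigma> *s \<Phi> k U \<zeta> z))"

definition jointly_holomorphic :: "(complex \<Rightarrow> complex \<Rightarrow> complex^2) \<Rightarrow> complex set \<Rightarrow> bool" where
  "jointly_holomorphic G V \<longleftrightarrow> continuous_on (UNIV \<times> V) (\<lambda>(\<zeta>, z). G \<zeta> z) \<and>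
     (\<forall>i. \<forall>z\<in>V. (\<lambda>\<zeta>. G \<zeta> z $ i) holomorphic_on UNIV) \<and>
     (\<forall>i \<zeta>. (\<lambda>z. G \<zeta> z $ i) holomorphic_on V)"

(* Pole at a of the map sending z to the entire vector function F( . , z). The leading coefficient
   is an entire function of zeta that is not identically zero; it may vanish at particular
   zeta (the zeros of \<Psi>_k), and for such zeta the function F zeta has no pole at a. *)
definition pole_of_order :: "nat \<Rightarrow> (complex \<Rightarrow> complex \<Rightarrow> complex^2) \<Rightarrow> complex \<Rightarrow> bool" where
  "pole_of_order n F a \<longleftrightarrow> 0 < n \<and> (\<exists>r>0. \<exists>G. jointly_holomorphic G (ball a r) \<and>
     (\<forall>\<zeta>. \<forall>z\<in>ball a r - {a}. (z - a) ^ n *s F \<zeta> z = G \<zeta> z) \<and> (\<exists>\<zeta>. G \<zeta> a \<noteq> 0))"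

definition singular_point :: "(complex \<Rightarrow> complex \<Rightarrow> complex^2) \<Rightarrow> complex \<Rightarrow> bool" where
  "singular_point F a \<longleftrightarrow> \<not> (\<forall>\<zeta> i. (\<lambda>z. F \<zeta> z $ i) analytic_on {a})"

end

theory Submission
  imports Defs
begin

text \<open>
  Write \<open>t = z - a\<close> and \<open>y = 1/t\<^sup>2 + t\<^sup>2 R\<close> near a pole \<open>a\<close>. The gauge
  \<open>p = t \<Phi>\<^sub>2\<close>, \<open>w = - \<Phi>\<^sub>1/t + (1/t\<^sup>2 + \<zeta>) \<Phi>\<^sub>2\<close> turns both linear systems into systems that are
  regular at \<open>t = 0\<close>. Gronwall's inequality bounds \<open>p\<close> and \<open>w\<close> on the punctured disc, so they extend
  holomorphically to the pole; this gives the double pole, and at \<open>t = 0\<close> the spectral system reads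
  \<open>p' = 2 w\<close>, \<open>w' = (2 \<zeta>\<^sup>3 - a \<zeta> - 14 b) p\<close>, which is the cubic oscillator for \<open>\<Psi> = p(\<cdot>, a)\<close>.

  The asymptotics at \<open>a\<close> need no WKB analysis in \<open>\<zeta>\<close>: only the \<open>z\<close>-equation is used to propagate the
  normalization from a regular point \<open>z\<^sub>0\<close>. The function \<open>v = t w - \<zeta> p\<close> satisfies \<open>v'' = (h\<^sup>2 + O(1)) v +
  O(h\<^sup>-\<^sup>2) v'\<close> with \<open>h = \<zeta>\<^sup>1\<^sup>/\<^sup>2\<close>, and \<open>z\<^sub>0\<close> can be chosen such that \<open>e\<^sup>h\<^sup>z\<close> does not decay from \<open>z\<^sub>0\<close> to
  \<open>a\<close> for any \<open>\<zeta>\<close> in the sector; then the mode \<open>v' + h v\<close> is transported with relative error \<open>O(1/h)\<close>.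
  The same transport excludes \<open>q\<^sup>2 = h\<close> for the two branches of the normalization.

  Normalized solutions attached to different regions agree where both are defined, since their
  Wronskian is constant in \<open>\<zeta>\<close> and tends to zero along the central ray of the sector. Hence they glue.
\<close>

section \<open>Gronwall estimates and propagation of a growing mode\<close>

text \<open>Eliminating the first component from the z-system gives f'' = (2 y + \<zeta>) f for the
  second component f, and 2 y has the singular part 2 / t^2. The exponents at t = 0 are therefore -1
  and 2: \<open>p\<close> carries the coefficient of 1 / t, and \<open>w\<close> reads off that of
  t^2. The gauge alone would leave poles in the \<zeta>-system; they cancel because P-I forces the
  coefficients a / 10 and 1 / 6 in the expansion of y.

  The obstacle for the asymptotics is that 2 / t^2 is unbounded on every segment ending at the pole,
  so the two exponential modes of f cannot be followed up to it. The function v is f' + f / t, the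
  Darboux transform of f with seed 1 / t. It removes the potential 2 / t^2 and leaves a perturbation
  that is bounded up to the pole, and at t = 0 it equals - \<zeta> p, so that its limit yields
  \<Psi>.

  The direction of transport matters: a growing mode can be followed with small relative error,
  whereas a decaying one may be swamped by an exponentially large admixture of the other.\<close>

lemma gronwall_inner:
  fixes u :: "real \<Rightarrow> 'a::real_inner"
  assumes deriv: "\<And>t. t \<in> {0..T} \<Longrightarrow> (u has_vector_derivative u' t) (at t)"
    and bound: "\<And>t. t \<in> {0..T} \<Longrightarrow> u t \<bullet> u' t \<le> M * (u t \<bullet> u t)"
    and t: "t \<in> {0..T}"
  shows "norm (u t) \<le> exp (M * t) * norm (u 0)"
proof -
  \<comment> \<open>exp (-2 M s) |u|^2 is nonincreasing. A bound on the inner product instead of the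
    norm of \<open>u'\<close> lets a large damping term enter with its sign; this is how
    \<open>Re m \<ge> 0\<close> is exploited for the two modes.\<close>
  define g where "g = (\<lambda>s. exp (- 2 * M * s) * (u s \<bullet> u s))"
  define g' where "g' = (\<lambda>s. exp (- 2 * M * s) * (2 * (u s \<bullet> u' s) - 2 * M * (u s \<bullet> u s)))"
  have g: "(g has_real_derivative g' s) (at s)" if "s \<in> {0..T}" for s
  proof -
    have 1: "((\<lambda>s. u s \<bullet> u s) has_real_derivative 2 * (u s \<bullet> u' s)) (at s)"
      using bounded_bilinear.has_vector_derivative[OF bounded_bilinear_inner deriv[OF that] deriv[OF that]]
      by (simp add: has_real_derivative_iff_has_vector_derivative inner_commute)
    show ?thesis
      unfolding g_def g'_def
      by (rule derivative_eq_intros 1 refl)+ (simp add: algebra_simps)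
  qed
  have "g' s \<le> 0" if "s \<in> {0..T}" for s
    using bound[OF that] by (auto simp: g'_def mult_le_0_iff)
  then have "g t \<le> g 0"
    using t g by (intro DERIV_nonpos_imp_nonincreasing[of 0 t g]) (auto, metis order_trans)
  then have "u t \<bullet> u t \<le> exp (2 * M * t) * (u 0 \<bullet> u 0)"
    by (simp add: g_def exp_minus field_simps)
  also have "\<dots> = (exp (M * t) * norm (u 0))\<^sup>2"
    by (simp add: power_mult_distrib power2_norm_eq_inner exp_double[symmetric] mult.assoc)
  finally show ?thesis
    by (metis power2_norm_eq_inner abs_le_square_iff abs_norm_cancel abs_of_nonneg
        mult_nonneg_nonneg exp_ge_zero norm_ge_zero)
qed

lemma has_vector_derivative_along_line:
  assumes "(f has_field_derivative f') (at (z + of_real t * d))"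
  shows "((\<lambda>s. f (z + of_real s * d)) has_vector_derivative d * f') (at t)"
proof -
  have "((\<lambda>s. z + of_real s * d) has_vector_derivative d) (at t)"
    by (auto intro!: derivative_eq_intros)
  from field_vector_diff_chain_at[OF this, of f f'] assms show ?thesis
    by (simp add: o_def)
qed

lemma gronwall_segment:
  fixes p w :: "complex \<Rightarrow> complex"
  assumes p: "\<And>x. x \<in> closed_segment z0 z1 \<Longrightarrow> (p has_field_derivative p' x) (at x)"
    and w: "\<And>x. x \<in> closed_segment z0 z1 \<Longrightarrow> (w has_field_derivative w' x) (at x)"
    and bound: "\<And>x. x \<in> closed_segment z0 z1 \<Longrightarrow>
      norm (p' x) + norm (w' x) \<le> M * norm (p x, w x)"
  shows "norm (p z1, w z1) \<le> exp (M * dist z0 z1) * norm (p z0, w z0)"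
proof -
  define c where "c = (\<lambda>t::real. z0 + of_real t * (z1 - z0))"
  define u where "u = (\<lambda>t. (p (c t), w (c t)))"
  define u' where "u' = (\<lambda>t. ((z1 - z0) * p' (c t), (z1 - z0) * w' (c t)))"
  have c: "c t \<in> closed_segment z0 z1" if "t \<in> {0..1}" for t
    using that by (auto simp: c_def closed_segment_def algebra_simps scaleR_conv_of_real)
  have "norm (u 1) \<le> exp (M * dist z0 z1 * 1) * norm (u 0)"
  proof (rule gronwall_inner[of 1 u u'])
    show "(u has_vector_derivative u' t) (at t)" if "t \<in> {0..1}" for t
      unfolding u_def u'_def c_def
      by (intro has_vector_derivative_Pair has_vector_derivative_along_line p w
          c[OF that, unfolded c_def])
    show "u t \<bullet> u' t \<le> M * dist z0 z1 * (u t \<bullet> u t)" if "t \<in> {0..1}" for t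
    proof -
      have "norm (u' t) \<le> norm (fst (u' t)) + norm (snd (u' t))"
        by (metis norm_Pair_le prod.collapse)
      also have "\<dots> = dist z0 z1 * (norm (p' (c t)) + norm (w' (c t)))"
        by (simp add: u'_def norm_mult dist_norm norm_minus_commute distrib_left)
      also have "\<dots> \<le> dist z0 z1 * (M * norm (u t))"
        unfolding u_def by (intro mult_left_mono bound c that) auto
      finally have "norm (u t) * norm (u' t) \<le> norm (u t) * (dist z0 z1 * (M * norm (u t)))"
        by (intro mult_left_mono) auto
      with norm_cauchy_schwarz[of "u t" "u' t"] show ?thesis
        by (simp add: power2_norm_eq_inner[symmetric] power2_eq_square mult_ac)
    qed
  qed auto
  then show ?thesis by (simp add: u_def c_def)
qed

text \<open>After multiplication by exp (-t m) the first mode loses its linear term and the second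
  is damped by -2 m, so the bounds depend on m only through the sign of its real part. The coupling
  has relative size \<open>\<kappa>\<close>, hence \<open>X\<close> is transported with an error of
  order \<open>\<kappa>\<close>.\<close>

lemma growing_mode_dominates:
  fixes m :: complex and X Y \<delta> :: "real \<Rightarrow> complex"
  assumes X: "\<And>t. t \<in> {0..1} \<Longrightarrow> (X has_vector_derivative m * X t + \<delta> t) (at t)"
    and Y: "\<And>t. t \<in> {0..1} \<Longrightarrow> (Y has_vector_derivative - m * Y t + \<delta> t) (at t)"
    and \<delta>: "\<And>t. t \<in> {0..1} \<Longrightarrow> norm (\<delta> t) \<le> \<kappa> * (norm (X t) + norm (Y t))"
    and m: "Re m \<ge> 0" and \<kappa>: "\<kappa> \<ge> 0"
  defines "B \<equiv> 2 * \<kappa> * exp (2 * \<kappa>) * (norm (X 0) + norm (Y 0))"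
  shows "norm (exp (- m) * X 1 - X 0) \<le> B"
    and "norm (exp (- m) * Y 1) \<le> norm (Y 0) + B"
proof -
  define e where "e = (\<lambda>t::real. exp (- (of_real t * m)))"
  define x y where "x = (\<lambda>t. e t * X t)" and "y = (\<lambda>t. e t * Y t)"
  define u where "u = (\<lambda>t. (x t, y t))"
  have e: "(e has_vector_derivative - m * e t) (at t)" for t
    unfolding e_def
    by (rule has_vector_derivative_real_field) (auto intro!: derivative_eq_intros)
  have x: "(x has_vector_derivative e t * \<delta> t) (at t)" if "t \<in> {0..1}" for t
    unfolding x_def
    using has_vector_derivative_mult[OF e X[OF that]] by (simp add: algebra_simps)
  have y: "(y has_vector_derivative - 2 * m * y t + e t * \<delta> t) (at t)" if "t \<in> {0..1}" for t
    unfolding y_def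
    using has_vector_derivative_mult[OF e Y[OF that]] by (simp add: algebra_simps)
  have le_u: "norm (x t) \<le> norm (u t)" "norm (y t) \<le> norm (u t)" for t
    by (auto simp: u_def norm_Pair real_le_rsqrt)
  have e\<delta>: "norm (e t * \<delta> t) \<le> \<kappa> * (norm (x t) + norm (y t))" if "t \<in> {0..1}" for t
  proof -
    have "norm (e t * \<delta> t) \<le> norm (e t) * (\<kappa> * (norm (X t) + norm (Y t)))"
      unfolding norm_mult by (intro mult_left_mono \<delta> that) auto
    then show ?thesis by (simp add: x_def y_def norm_mult algebra_simps)
  qed
  have u: "norm (u t) \<le> exp (2 * \<kappa>) * (norm (X 0) + norm (Y 0))" if "t \<in> {0..1}" for t
  proof -
    have "norm (u t) \<le> exp (2 * \<kappa> * t) * norm (u 0)"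
    proof (rule gronwall_inner[of 1 u "\<lambda>t. (e t * \<delta> t, - 2 * m * y t + e t * \<delta> t)"])
      fix s :: real assume s: "s \<in> {0..1}"
      show "(u has_vector_derivative (e s * \<delta> s, - 2 * m * y s + e s * \<delta> s)) (at s)"
        unfolding u_def by (intro has_vector_derivative_Pair x y s)
      have 1: "y s \<bullet> (- 2 * m * y s) = - 2 * Re m * (norm (y s))\<^sup>2"
        unfolding cmod_power2 by (simp add: inner_complex_def power2_eq_square algebra_simps)
      have "u s \<bullet> (e s * \<delta> s, - 2 * m * y s + e s * \<delta> s)
          = x s \<bullet> (e s * \<delta> s) + y s \<bullet> (e s * \<delta> s) - 2 * Re m * (norm (y s))\<^sup>2"
        unfolding u_def inner_Pair inner_add_right 1 by simp
      also have "\<dots> \<le> norm (x s) * norm (e s * \<delta> s) + norm (y s) * norm (e s * \<delta> s)"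
        using norm_cauchy_schwarz[of "x s" "e s * \<delta> s"] norm_cauchy_schwarz[of "y s" "e s * \<delta> s"] m
        by (smt (verit) mult_nonneg_nonneg zero_le_power2)
      also have "\<dots> \<le> norm (x s) * (\<kappa> * (norm (x s) + norm (y s))) + norm (y s) * (\<kappa> * (norm (x s) + norm (y s)))"
        by (intro add_mono mult_left_mono e\<delta> s) auto
      also have "\<dots> = \<kappa> * (norm (x s) + norm (y s))\<^sup>2"
        by (simp add: power2_eq_square algebra_simps)
      also have "\<dots> \<le> \<kappa> * (2 * ((norm (x s))\<^sup>2 + (norm (y s))\<^sup>2))"
        using sum_squares_bound[of "norm (x s)" "norm (y s)"] \<kappa>
        by (intro mult_left_mono) (auto simp: power2_sum)
      also have "\<dots> = 2 * \<kappa> * (u s \<bullet> u s)"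
        by (simp add: u_def power2_norm_eq_inner)
      finally show "u s \<bullet> (e s * \<delta> s, - 2 * m * y s + e s * \<delta> s) \<le> 2 * \<kappa> * (u s \<bullet> u s)" .
    qed (use that in auto)
    also have "\<dots> \<le> exp (2 * \<kappa>) * (norm (X 0) + norm (Y 0))"
      using that \<kappa> norm_Pair_le[of "X 0" "Y 0"]
      by (intro mult_mono) (auto simp: u_def x_def y_def e_def mult_left_le)
    finally show ?thesis .
  qed
  have dB: "norm (e t * \<delta> t) \<le> B" if "t \<in> {0..1}" for t
  proof -
    have "norm (x t) + norm (y t) \<le> 2 * norm (u t)" using le_u[of t] by simp
    also have "\<dots> \<le> 2 * (exp (2 * \<kappa>) * (norm (X 0) + norm (Y 0)))" using u[OF that] by simp
    finally have "\<kappa> * (norm (x t) + norm (y t)) \<le> \<kappa> * (2 * (exp (2 * \<kappa>) * (norm (X 0) + norm (Y 0))))"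
      using \<kappa> by (intro mult_left_mono) auto
    with e\<delta>[OF that] show ?thesis by (simp add: B_def mult_ac)
  qed
  have incr: "norm (f 1 - f 0) \<le> K"
    if "\<And>t. t \<in> {0..1} \<Longrightarrow> (f has_vector_derivative f' t) (at t)"
      and "\<And>t. t \<in> {0..1} \<Longrightarrow> norm (f' t) \<le> K" for f f' :: "real \<Rightarrow> complex" and K
  proof -
    have "norm (f 1 - f 0) \<le> K * norm (1 - 0 :: real)"
    proof (rule differentiable_bound[of "{0..1}" f "\<lambda>t s. s *\<^sub>R f' t"])
      show "onorm (\<lambda>s. s *\<^sub>R f' t) \<le> K" if "t \<in> {0..1}" for t
        using that \<open>\<And>t. t \<in> {0..1} \<Longrightarrow> norm (f' t) \<le> K\<close>[OF that]
        by (intro onorm_bound) (auto simp: mult.commute[of K] mult_left_mono intro: order_trans[OF norm_ge_zero])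
    qed (use that in \<open>auto simp: has_vector_derivative_def intro: has_derivative_at_withinI\<close>)
    then show ?thesis by simp
  qed
  show "norm (exp (- m) * X 1 - X 0) \<le> B"
    using incr[OF x dB] by (simp add: x_def e_def)
  \<comment> \<open>Gronwall bounds the damped mode only by the total initial size. To keep the
    factor \<open>\<kappa>\<close> on the part fed in by \<open>\<delta>\<close>, the integrating
    factor exp (t m) removes the linear term of \<open>Y\<close> altogether.\<close>
  define s where "s = (\<lambda>t::real. exp (of_real t * m) * Y t)"
  have s: "(s has_vector_derivative exp (of_real t * m) * \<delta> t) (at t)" if "t \<in> {0..1}" for t
  proof -
    have "((\<lambda>t::real. exp (of_real t * m)) has_vector_derivative m * exp (of_real t * m)) (at t)"
      by (rule has_vector_derivative_real_field) (auto intro!: derivative_eq_intros)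
    from has_vector_derivative_mult[OF this Y[OF that]] show ?thesis
      unfolding s_def by (rule back_subst[where P = "\<lambda>d. (_ has_vector_derivative d) _"]) (simp add: algebra_simps)
  qed
  have "norm (s 1 - s 0) \<le> exp (2 * Re m) * B"
  proof (rule incr[OF s])
    fix t :: real assume t: "t \<in> {0..1}"
    \<comment> \<open>The surplus weight exp (2 t m) over \<open>e t\<close> has modulus at most exp
      (2 Re m); this is cancelled by exp (-2 m) when \<open>s 1\<close> is turned back into exp (-m)
      times \<open>Y 1\<close>.\<close>
    have "exp (of_real t * m) = exp (2 * of_real t * m) * e t"
      by (simp add: e_def exp_add[symmetric] algebra_simps)
    from this have "exp (of_real t * m) * \<delta> t = exp (2 * of_real t * m) * (e t * \<delta> t)"
      by simp
    then have "norm (exp (of_real t * m) * \<delta> t) = norm (exp (2 * of_real t * m) * (e t * \<delta> t))"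
      by (rule arg_cong)
    also have "\<dots> = exp (2 * t * Re m) * norm (e t * \<delta> t)"
      by (simp add: norm_mult norm_exp_eq_Re)
    also have "\<dots> \<le> exp (2 * Re m) * B"
      using t m dB[OF t] by (intro mult_mono) (auto simp: mult_left_le_one_le)
    finally show "norm (exp (of_real t * m) * \<delta> t) \<le> exp (2 * Re m) * B" .
  qed
  then have "norm (s 1) \<le> norm (Y 0) + exp (2 * Re m) * B"
    using norm_triangle_ineq2[of "s 1" "s 0"] by (simp add: s_def)
  then have "exp (- 2 * Re m) * norm (s 1) \<le> exp (- 2 * Re m) * (norm (Y 0) + exp (2 * Re m) * B)"
    by (intro mult_left_mono) auto
  also have "\<dots> = exp (- 2 * Re m) * norm (Y 0) + B"
    by (simp add: distrib_left mult.assoc[symmetric] exp_add[symmetric])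
  also have "\<dots> \<le> norm (Y 0) + B"
    using m by (simp add: mult_left_le_one_le)
  finally have 2: "exp (- 2 * Re m) * norm (s 1) \<le> norm (Y 0) + B" .
  have "exp (- m) * Y 1 = exp (- 2 * m) * s 1"
    by (simp add: s_def mult.assoc[symmetric] exp_add[symmetric])
  then have "norm (exp (- m) * Y 1) = exp (- 2 * Re m) * norm (s 1)"
    by (simp add: norm_mult norm_exp_eq_Re)
  with 2 show "norm (exp (- m) * Y 1) \<le> norm (Y 0) + B" by simp
qed

text \<open>\<open>c\<close> is the common scale of the initial data. The preceding bounds are
  homogeneous in the data, so division by \<open>c\<close> turns them into limits as
  \<open>\<kappa>\<close> tends to 0: the scaled amplitude \<open>l\<close> is preserved and no
  second mode appears.\<close>

lemma growing_mode_limit: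
  fixes m c :: "'b \<Rightarrow> complex" and X Y \<delta> :: "'b \<Rightarrow> real \<Rightarrow> complex"
  assumes ev: "eventually (\<lambda>s. (\<forall>t\<in>{0..1}.
        (X s has_vector_derivative m s * X s t + \<delta> s t) (at t) \<and>
        (Y s has_vector_derivative - m s * Y s t + \<delta> s t) (at t) \<and>
        norm (\<delta> s t) \<le> \<kappa> s * (norm (X s t) + norm (Y s t))) \<and> Re (m s) \<ge> 0 \<and> \<kappa> s \<ge> 0) F"
    and \<kappa>: "(\<kappa> \<longlongrightarrow> 0) F"
    and X0: "((\<lambda>s. X s 0 / c s) \<longlongrightarrow> l) F" and Y0: "((\<lambda>s. Y s 0 / c s) \<longlongrightarrow> 0) F"
  shows "((\<lambda>s. exp (- m s) * X s 1 / c s) \<longlongrightarrow> l) F"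
    and "((\<lambda>s. exp (- m s) * Y s 1 / c s) \<longlongrightarrow> 0) F"
proof -
  define B where "B s = 2 * \<kappa> s * exp (2 * \<kappa> s) * (norm (X s 0 / c s) + norm (Y s 0 / c s))" for s
  have "(B \<longlongrightarrow> 2 * 0 * exp (2 * 0) * (norm l + norm (0::complex))) F"
    unfolding B_def by (intro tendsto_intros \<kappa> X0 Y0)
  then have B: "(B \<longlongrightarrow> 0) F" by simp
  have est: "eventually (\<lambda>s. norm (exp (- m s) * X s 1 / c s - X s 0 / c s) \<le> B s \<and>
      norm (exp (- m s) * Y s 1 / c s) \<le> norm (Y s 0 / c s) + B s) F"
    using ev
  proof eventually_elim
    case (elim s)
    note G = growing_mode_dominates[of "X s" "m s" "\<delta> s" "Y s" "\<kappa> s"]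
    define B' where "B' = 2 * \<kappa> s * exp (2 * \<kappa> s) * (norm (X s 0) + norm (Y s 0))"
    have B': "B' / norm (c s) = B s"
      by (simp add: B_def B'_def norm_divide add_divide_distrib[symmetric])
    have "norm (exp (- m s) * X s 1 - X s 0) / norm (c s) \<le> B' / norm (c s)"
      using G elim by (intro divide_right_mono) (auto simp: B'_def)
    moreover have "norm (exp (- m s) * Y s 1) / norm (c s) \<le> (norm (Y s 0) + B') / norm (c s)"
      using G elim by (intro divide_right_mono) (auto simp: B'_def)
    ultimately show ?case
      unfolding B'[symmetric] by (simp add: norm_divide diff_divide_distrib[symmetric] add_divide_distrib)
  qed
  have "((\<lambda>s. exp (- m s) * X s 1 / c s - X s 0 / c s) \<longlongrightarrow> 0) F"
    using est by (intro Lim_null_comparison[OF _ B]) (auto elim: eventually_mono)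
  from tendsto_add[OF this X0] show "((\<lambda>s. exp (- m s) * X s 1 / c s) \<longlongrightarrow> l) F"
    by simp
  have "((\<lambda>s. norm (Y s 0 / c s) + B s) \<longlongrightarrow> norm (0::complex) + 0) F"
    by (intro tendsto_intros Y0 B)
  then have bnd: "((\<lambda>s. norm (Y s 0 / c s) + B s) \<longlongrightarrow> 0) F" by simp
  have "eventually (\<lambda>s. norm (exp (- m s) * Y s 1 / c s) \<le> norm (Y s 0 / c s) + B s) F"
    using est by (rule eventually_mono) simp
  from this bnd show "((\<lambda>s. exp (- m s) * Y s 1 / c s) \<longlongrightarrow> 0) F"
    by (rule Lim_null_comparison)
qed

text \<open>Recovers a function v and its derivative u from the modes u + h v and u - h v. The
  additional factor 1 / |h| for v makes coupling terms that contain only v small for large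
  h.\<close>

lemma half_sum_diff_bound:
  fixes u v h :: complex
  assumes h: "h \<noteq> 0"
  shows "norm u \<le> (norm (u + h * v) + norm (u - h * v)) / 2"
    and "norm v \<le> (norm (u + h * v) + norm (u - h * v)) / (2 * norm h)"
proof -
  have "2 * u = (u + h * v) + (u - h * v)" by simp
  then have "2 * norm u \<le> norm (u + h * v) + norm (u - h * v)"
    by (metis norm_triangle_ineq norm_mult norm_numeral)
  then show "norm u \<le> (norm (u + h * v) + norm (u - h * v)) / 2" by simp
  have "2 * h * v = (u + h * v) - (u - h * v)" by simp
  then have "norm (2 * h * v) \<le> norm (u + h * v) + norm (u - h * v)"
    by (metis norm_triangle_ineq4)
  then show "norm v \<le> (norm (u + h * v) + norm (u - h * v)) / (2 * norm h)"
    using h by (simp add: norm_mult field_simps)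
qed

section \<open>Removable singularities with a parameter\<close>

text \<open>Cauchy's estimate on circles of radius r / 2, which stay in the large ball. The constant
  depends only on \<open>M\<close> and \<open>r\<close>, so it is uniform over a family with a
  common bound.\<close>

lemma bounded_holomorphic_lipschitz:
  assumes "f holomorphic_on ball c (2 * r)" "r > 0"
    and bound: "\<And>x. x \<in> ball c (2 * r) \<Longrightarrow> norm (f x) \<le> M"
    and "z \<in> ball c r" "z' \<in> ball c r"
  shows "norm (f z - f z') \<le> 2 * M / r * norm (z - z')"
proof -
  have "norm (deriv f x) \<le> 2 * M / r" if "x \<in> ball c r" for x
  proof -
    have sub: "cball x (r / 2) \<subseteq> ball c (2 * r)"
      using that \<open>r > 0\<close> by (simp add: cball_subset_ball_iff dist_commute)
    have "norm ((deriv ^^ 1) f x) \<le> fact 1 * M / (r / 2) ^ 1"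
    proof (rule Cauchy_inequality)
      show "f holomorphic_on ball x (r / 2)"
        using sub ball_subset_cball by (blast intro: holomorphic_on_subset[OF assms(1)])
      show "continuous_on (cball x (r / 2)) f"
        using holomorphic_on_imp_continuous_on[OF holomorphic_on_subset[OF assms(1) sub]] .
      show "norm (f u) \<le> M" if "norm (x - u) = r / 2" for u
        using that sub by (intro bound) (auto simp: dist_norm subset_iff)
    qed (use \<open>r > 0\<close> in auto)
    then show ?thesis by (simp add: mult.commute)
  qed
  moreover have "(f has_field_derivative deriv f x) (at x within ball c r)" if "x \<in> ball c r" for x
    using that \<open>r > 0\<close> by (intro holomorphic_derivI[OF assms(1)]) auto
  ultimately show ?thesis
    using field_differentiable_bound[of "ball c r" f "deriv f" "2 * M / r" z z'] assms(4,5) by auto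
qed

text \<open>A bound that is local in \<zeta> gives Lipschitz constants in z that are uniform on
  bounded sets of \<zeta>. Thus P \<zeta> z tends to P \<zeta> a locally uniformly in \<zeta>: the
  limit is entire by Weierstrass, P is jointly continuous, and the \<zeta>-derivatives converge. The
  last point later carries the spectral system to the pole.\<close>

lemma parametric_removable_singularity:
  fixes p :: "complex \<Rightarrow> complex \<Rightarrow> complex"
  assumes \<rho>: "\<rho> > 0"
    and holz: "\<And>\<zeta>. p \<zeta> holomorphic_on ball a \<rho> - {a}"
    and hols: "\<And>z. z \<in> ball a \<rho> - {a} \<Longrightarrow> (\<lambda>\<zeta>. p \<zeta> z) holomorphic_on UNIV"
    and bdd: "\<And>K. \<exists>M. \<forall>\<zeta> z. norm \<zeta> \<le> K \<longrightarrow> z \<in> ball a \<rho> - {a} \<longrightarrow> norm (p \<zeta> z) \<le> M"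
  obtains P where "\<And>\<zeta> z. z \<in> ball a \<rho> - {a} \<Longrightarrow> P \<zeta> z = p \<zeta> z"
    "\<And>\<zeta>. P \<zeta> holomorphic_on ball a \<rho>"
    "\<And>z. z \<in> ball a \<rho> \<Longrightarrow> (\<lambda>\<zeta>. P \<zeta> z) holomorphic_on UNIV"
    "continuous_on (UNIV \<times> ball a \<rho>) (\<lambda>(\<zeta>, z). P \<zeta> z)"
    "\<And>\<zeta>. ((\<lambda>z. deriv (\<lambda>s. P s z) \<zeta>) \<longlongrightarrow> deriv (\<lambda>s. P s a) \<zeta>) (at a)"
proof -
  have ev: "eventually (\<lambda>z. z \<in> ball a \<rho> - {a}) (at a)"
    using \<rho> by (intro eventually_at_in_open) auto
  have "\<exists>g. g holomorphic_on ball a \<rho> \<and> (\<forall>z\<in>ball a \<rho> - {a}. g z = p \<zeta> z)" for \<zeta>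
  proof -
    obtain M where "\<forall>z. z \<in> ball a \<rho> - {a} \<longrightarrow> norm (p \<zeta> z) \<le> M"
      using bdd[of "norm \<zeta>"] by auto
    with ev have "\<exists>B. eventually (\<lambda>z. norm (p \<zeta> z) \<le> B) (at a)"
      by (auto elim!: eventually_mono intro!: exI[of _ M])
    then show ?thesis
      using \<rho> by (subst holomorphic_on_extend_bounded[OF holz]) auto
  qed
  then obtain P where P: "\<And>\<zeta>. P \<zeta> holomorphic_on ball a \<rho>"
      and Pp: "\<And>\<zeta> z. z \<in> ball a \<rho> - {a} \<Longrightarrow> P \<zeta> z = p \<zeta> z"
    by metis
  have contz: "(P \<zeta> \<longlongrightarrow> P \<zeta> z) (at z)" if "z \<in> ball a \<rho>" for \<zeta> z
    using holomorphic_on_imp_continuous_on[OF P[of \<zeta>]] that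
    by (metis continuous_on_eq_continuous_at isCont_def open_ball)
  have bddP: "\<exists>M. \<forall>\<zeta> z. norm \<zeta> \<le> K \<longrightarrow> z \<in> ball a \<rho> \<longrightarrow> norm (P \<zeta> z) \<le> M" for K
  proof -
    obtain M where M: "\<And>\<zeta> z. norm \<zeta> \<le> K \<Longrightarrow> z \<in> ball a \<rho> - {a} \<Longrightarrow> norm (p \<zeta> z) \<le> M"
      using bdd[of K] by auto
    have "norm (P \<zeta> z) \<le> M" if "norm \<zeta> \<le> K" "z \<in> ball a \<rho>" for \<zeta> z
    proof (cases "z = a")
      case True
      have "((\<lambda>z. norm (P \<zeta> z)) \<longlongrightarrow> norm (P \<zeta> a)) (at a)"
        using \<rho> by (intro tendsto_intros contz) auto
      moreover have "eventually (\<lambda>z. norm (P \<zeta> z) \<le> M) (at a)"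
        using ev by eventually_elim (use M that Pp in auto)
      ultimately show ?thesis
        using True by (intro tendsto_upperbound) auto
    qed (use M that Pp in auto)
    then show ?thesis by blast
  qed
  have lip: "\<exists>L. \<forall>\<zeta> z. norm \<zeta> \<le> K \<longrightarrow> z \<in> ball z0 r \<longrightarrow> norm (P \<zeta> z - P \<zeta> z0) \<le> L * norm (z - z0)"
    if "r > 0" "ball z0 (2 * r) \<subseteq> ball a \<rho>" for K z0 r
  proof -
    obtain M where "\<And>\<zeta> z. norm \<zeta> \<le> K \<Longrightarrow> z \<in> ball a \<rho> \<Longrightarrow> norm (P \<zeta> z) \<le> M"
      using bddP by metis
    then have "norm (P \<zeta> z - P \<zeta> z0) \<le> 2 * M / r * norm (z - z0)"
      if "norm \<zeta> \<le> K" "z \<in> ball z0 r" for \<zeta> z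
      using that \<open>r > 0\<close> \<open>ball z0 (2 * r) \<subseteq> ball a \<rho>\<close>
      by (intro bounded_holomorphic_lipschitz[of _ z0] holomorphic_on_subset[OF P]) auto
    then show ?thesis by blast
  qed
  have lip_a: "\<exists>L. \<forall>\<zeta> z. norm \<zeta> \<le> K \<longrightarrow> z \<in> ball a (\<rho> / 2) \<longrightarrow> norm (P \<zeta> z - P \<zeta> a) \<le> L * norm (z - a)" for K
    using \<rho> by (intro lip) auto
  have hol: "(\<lambda>\<zeta>. P \<zeta> z) holomorphic_on UNIV" if "z \<in> ball a \<rho>" for z
  proof (cases "z = a")
    case False
    then have "(\<lambda>\<zeta>. P \<zeta> z) = (\<lambda>\<zeta>. p \<zeta> z)" using Pp that by auto
    with hols[of z] that False show ?thesis by simp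
  next
    case True
    \<comment> \<open>The shift by 3 keeps even the term n = 0 within radius \<rho> / 2, where
      \<open>lip_a\<close> applies.\<close>
    define s where "s = (\<lambda>n. a + of_real (\<rho> / (real n + 3)))"
    have s: "s n \<in> ball a (\<rho> / 2)" "s n \<in> ball a \<rho> - {a}" for n
    proof -
      have "\<rho> / (real n + 3) < \<rho> / 2" using \<rho> by (intro divide_strict_left_mono) auto
      moreover from this have "\<rho> / (real n + 3) < \<rho>" by (rule less_trans) (use \<rho> in simp)
      moreover have "\<rho> / (real n + 3) > 0" using \<rho> by simp
      ultimately show "s n \<in> ball a (\<rho> / 2)" "s n \<in> ball a \<rho> - {a}" using \<rho>
        by (auto simp: s_def dist_norm simp del: of_real_divide)
    qed
    have s0: "(\<lambda>n. norm (s n - a)) \<longlonglongrightarrow> 0"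
      unfolding s_def using \<rho> by (simp add: norm_divide del: of_real_add) real_asymp
    have "(\<lambda>\<zeta>. P \<zeta> a) holomorphic_on UNIV"
    proof (rule holomorphic_uniform_sequence[of _ "\<lambda>n \<zeta>. P \<zeta> (s n)"])
      show "(\<lambda>\<zeta>. P \<zeta> (s n)) holomorphic_on UNIV" for n
        using hols[OF s(2)[of n]] Pp[OF s(2)[of n]] by simp
      fix x :: complex
      obtain L where L: "\<And>\<zeta> z. norm \<zeta> \<le> norm x + 1 \<Longrightarrow> z \<in> ball a (\<rho> / 2) \<Longrightarrow>
          norm (P \<zeta> z - P \<zeta> a) \<le> L * norm (z - a)"
        using lip_a by metis
      have "uniform_limit (cball x 1) (\<lambda>n \<zeta>. P \<zeta> (s n)) (\<lambda>\<zeta>. P \<zeta> a) sequentially"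
      proof (rule uniform_limitI)
        fix e :: real assume "e > 0"
        have "(\<lambda>n. L * norm (s n - a)) \<longlonglongrightarrow> L * 0" by (intro tendsto_intros s0)
        with \<open>e > 0\<close> have "eventually (\<lambda>n. L * norm (s n - a) < e) sequentially"
          by (simp add: order_tendstoD(2))
        then show "eventually (\<lambda>n. \<forall>\<zeta>\<in>cball x 1. dist (P \<zeta> (s n)) (P \<zeta> a) < e) sequentially"
        proof eventually_elim
          case (elim n)
          have "norm \<zeta> \<le> norm x + 1" if "\<zeta> \<in> cball x 1" for \<zeta>
            using that norm_triangle_ineq2[of \<zeta> x] by (auto simp: dist_norm norm_minus_commute)
          then show ?case using L s(1)[of n] elim by (fastforce simp: dist_norm)
        qed
      qed
      then show "\<exists>d>0. cball x d \<subseteq> UNIV \<and>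
          uniform_limit (cball x d) (\<lambda>n \<zeta>. P \<zeta> (s n)) (\<lambda>\<zeta>. P \<zeta> a) sequentially"
        by (intro exI[of _ 1]) auto
    qed auto
    with True show ?thesis by simp
  qed
  have joint: "continuous_on (UNIV \<times> ball a \<rho>) (\<lambda>(\<zeta>, z). P \<zeta> z)"
  proof (rule continuous_at_imp_continuous_on, safe)
    fix \<zeta>0 z0 :: complex assume z0: "z0 \<in> ball a \<rho>"
    obtain r' where r': "r' > 0" "ball z0 r' \<subseteq> ball a \<rho>"
      using z0 by (meson open_ball open_contains_ball)
    define r where "r = r' / 2"
    have r: "r > 0" "ball z0 (2 * r) \<subseteq> ball a \<rho>" using r' by (auto simp: r_def)
    obtain L where L: "\<And>\<zeta> z. norm \<zeta> \<le> norm \<zeta>0 + 1 \<Longrightarrow> z \<in> ball z0 r \<Longrightarrow>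
        norm (P \<zeta> z - P \<zeta> z0) \<le> L * norm (z - z0)"
      using lip[OF r] by metis
    have ev2: "eventually (\<lambda>x. x \<in> ball \<zeta>0 1 \<times> ball z0 r) (at (\<zeta>0, z0))"
      using r by (intro eventually_at_in_open') (auto intro: open_Times)
    have Pc: "isCont (\<lambda>\<zeta>. P \<zeta> z0) \<zeta>0"
      using holomorphic_on_imp_continuous_on[OF hol[OF z0]] by (simp add: continuous_on_eq_continuous_at)
    have lim1: "((\<lambda>x. P (fst x) z0) \<longlongrightarrow> P \<zeta>0 z0) (at (\<zeta>0, z0))"
      by (rule isCont_tendsto_compose[OF Pc]) (auto intro!: tendsto_eq_intros)
    have "((\<lambda>x. P (fst x) (snd x) - P (fst x) z0) \<longlongrightarrow> 0) (at (\<zeta>0, z0))"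
    proof (rule Lim_null_comparison[of _ "\<lambda>x. L * norm (snd x - z0)"])
      show "eventually (\<lambda>x. norm (P (fst x) (snd x) - P (fst x) z0) \<le> L * norm (snd x - z0)) (at (\<zeta>0, z0))"
        using ev2
      proof eventually_elim
        case (elim x)
        then have "norm (fst x) \<le> norm \<zeta>0 + 1"
          using norm_triangle_ineq2[of "fst x" \<zeta>0] by (auto simp: dist_norm norm_minus_commute mem_Times_iff)
        with elim show ?case by (intro L) (auto simp: mem_Times_iff)
      qed
      show "((\<lambda>x. L * norm (snd x - z0)) \<longlongrightarrow> 0) (at (\<zeta>0, z0))"
        by (auto intro!: tendsto_eq_intros)
    qed
    from tendsto_add[OF this lim1] show "isCont (\<lambda>(\<zeta>, z). P \<zeta> z) (\<zeta>0, z0)"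
      by (simp add: isCont_def case_prod_unfold)
  qed
  have "((\<lambda>z. deriv (\<lambda>s. P s z) \<zeta>) \<longlongrightarrow> deriv (\<lambda>s. P s a) \<zeta>) (at a)" for \<zeta>
  proof -
    obtain L where L: "\<And>s z. norm s \<le> norm \<zeta> + 1 \<Longrightarrow> z \<in> ball a (\<rho> / 2) \<Longrightarrow>
        norm (P s z - P s a) \<le> L * norm (z - a)"
      using lip_a by metis
    have ev': "eventually (\<lambda>z. z \<in> ball a (\<rho> / 2)) (at a)"
      using \<rho> by (intro eventually_at_in_open') auto
    have diff: "(\<lambda>s. P s z) field_differentiable (at \<zeta>)" if "z \<in> ball a \<rho>" for z
      using hol[OF that] by (simp add: holomorphic_on_imp_differentiable_at)
    have "((\<lambda>z. deriv (\<lambda>s. P s z) \<zeta> - deriv (\<lambda>s. P s a) \<zeta>) \<longlongrightarrow> 0) (at a)"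
    proof (rule Lim_null_comparison[of _ "\<lambda>z. L * norm (z - a)"])
      show "eventually (\<lambda>z. norm (deriv (\<lambda>s. P s z) \<zeta> - deriv (\<lambda>s. P s a) \<zeta>) \<le> L * norm (z - a)) (at a)"
        using ev'
      proof eventually_elim
        case (elim z)
        then have z: "z \<in> ball a \<rho>" "a \<in> ball a \<rho>" using \<rho> by auto
        \<comment> \<open>Cauchy's estimate in \<zeta> on the unit circle, applied to a difference
          that is already of size L |z - a| by the Lipschitz bound in z.\<close>
        have "norm ((deriv ^^ 1) (\<lambda>s. P s z - P s a) \<zeta>) \<le> fact 1 * (L * norm (z - a)) / 1 ^ 1"
        proof (rule Cauchy_inequality)
          have h: "(\<lambda>s. P s z - P s a) holomorphic_on UNIV"
            by (intro holomorphic_intros hol z)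
          show "(\<lambda>s. P s z - P s a) holomorphic_on ball \<zeta> 1" "continuous_on (cball \<zeta> 1) (\<lambda>s. P s z - P s a)"
            using h by (auto intro: holomorphic_on_subset holomorphic_on_imp_continuous_on)
          show "norm (P s z - P s a) \<le> L * norm (z - a)" if "norm (\<zeta> - s) = 1" for s
            using that norm_triangle_ineq3[of \<zeta> s] elim by (intro L) auto
        qed auto
        then show ?case using diff[OF z(1)] diff[OF z(2)] by simp
      qed
      show "((\<lambda>z. L * norm (z - a)) \<longlongrightarrow> 0) (at a)"
        by (auto intro!: tendsto_eq_intros)
    qed
    then show ?thesis by (simp add: LIM_zero_iff)
  qed
  from that[OF Pp P hol joint this] show ?thesis .
qed

text \<open>The derivative of \<open>g\<close> is itself continuous at a, so the equation off a
  determines it there.\<close>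

lemma deriv_eq_by_continuity:
  assumes g: "g holomorphic_on ball a \<rho>" and \<rho>: "\<rho> > 0" and rhs: "isCont f a"
    and eq: "\<And>z. z \<in> ball a \<rho> - {a} \<Longrightarrow> (g has_field_derivative f z) (at z)"
    and z: "z \<in> ball a \<rho>"
  shows "(g has_field_derivative f z) (at z)"
proof (cases "z = a")
  case True
  have "deriv g holomorphic_on ball a \<rho>" using g by (intro holomorphic_deriv) auto
  then have "isCont (deriv g) a"
    using \<rho> by (metis centre_in_ball continuous_on_eq_continuous_at holomorphic_on_imp_continuous_on open_ball)
  then have "(deriv g \<longlongrightarrow> deriv g a) (at a)" by (simp add: isCont_def)
  moreover have "eventually (\<lambda>z. z \<in> ball a \<rho> - {a}) (at a)"
    using \<rho> by (intro eventually_at_in_open) auto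
  then have "eventually (\<lambda>z. f z = deriv g z) (at a)"
    by eventually_elim (use eq in \<open>auto intro!: DERIV_imp_deriv[symmetric]\<close>)
  then have "(deriv g \<longlongrightarrow> f a) (at a)"
    using rhs by (auto simp: isCont_def intro: Lim_transform_eventually)
  ultimately have "deriv g a = f a" by (intro LIM_unique)
  moreover have "(g has_field_derivative deriv g a) (at a)"
    using g \<rho> by (simp add: holomorphic_derivI)
  ultimately show ?thesis using True by simp
qed (use z eq in auto)

section \<open>Laurent expansion at a pole of the Painleve transcendent\<close>

text \<open>Comparison of coefficients in the formal identity F'' = 6 F^2 - (a + X). It fixes the
  order -2 and all coefficients up to index 3; index 4 is resonant and stays free.\<close>

lemma painleve_laurent:
  assumes PI: "PI_solution y" and pole: "is_pole y a"
  defines "b \<equiv> fls_nth (laurent_expansion y a) 4"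
  obtains \<rho> S where "\<rho> > 0" "S holomorphic_on ball a \<rho>"
    "\<And>z. z \<in> ball a \<rho> - {a} \<Longrightarrow> \<not> is_pole y z \<and>
       y z = 1 / (z - a)\<^sup>2 + a * (z - a)\<^sup>2 / 10 + (z - a) ^ 3 / 6 + b * (z - a) ^ 4 + (z - a) ^ 5 * S z"
proof -
  define F where "F = laurent_expansion y a"
  define Y where "Y = (\<lambda>w. y (a + w))"
  have mero: "y meromorphic_on {a}" and reg: "\<And>z. \<not> is_pole y z \<Longrightarrow>
      y analytic_on {z} \<and> deriv (deriv y) z = 6 * (y z)\<^sup>2 - z"
    using PI by (auto simp: PI_solution_def intro: meromorphic_on_subset)
  have F: "Y has_laurent_expansion F"
    unfolding Y_def F_def using mero by (intro meromorphic_on_imp_has_laurent_expansion) auto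
  have np: "eventually (\<lambda>z. \<not> is_pole y z) (at a)"
    by (rule eventually_not_pole[OF meromorphic_on_isolated_singularity[OF mero]])
  then have np0: "eventually (\<lambda>w. \<not> is_pole y (a + w)) (at 0)"
    by (simp add: at_to_0'[of a] eventually_filtermap add.commute)
  have shift: "deriv (\<lambda>w. g (a + w)) = (\<lambda>w. deriv g (a + w))" for g :: "complex \<Rightarrow> complex"
    by (rule ext) (metis (no_types, lifting) deriv_shift_0 comp_def ext add.assoc)
  have "deriv (deriv Y) has_laurent_expansion fls_deriv (fls_deriv F)"
    by (intro laurent_expansion_intros F)
  moreover have "(\<lambda>w. 6 * (Y w)\<^sup>2 - (a + w)) has_laurent_expansion
      fls_const 6 * F ^ 2 - (fls_const a + fls_X)"
    by (intro laurent_expansion_intros F)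
  moreover have "eventually (\<lambda>w. deriv (deriv Y) w = 6 * (Y w)\<^sup>2 - (a + w)) (at 0)"
    using np0 by eventually_elim (use reg in \<open>simp add: Y_def shift\<close>)
  ultimately have ode: "fls_deriv (fls_deriv F) = fls_const 6 * F ^ 2 - (fls_const a + fls_X)"
    by (metis has_laurent_expansion_cong has_laurent_expansion_unique)
  define n where "n = fls_subdegree F"
  have n0: "n < 0"
    unfolding n_def using is_pole_imp_neg_fls_subdegree[OF F[unfolded Y_def] pole] .
  then have Fn: "fls_nth F n \<noteq> 0" and below: "\<And>m. m < n \<Longrightarrow> fls_nth F m = 0"
    by (auto simp: n_def intro!: nth_fls_subdegree_nonzero)
  have coeff: "of_int (m + 2) * of_int (m + 1) * fls_nth F (m + 2)
      = 6 * fls_nth (F * F) m - (if m = 0 then a else 0) - (if m = 1 then 1 else 0)" for m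
  proof -
    have "fls_nth (fls_const 6 * F ^ 2) m = 6 * fls_nth (F * F) m"
      by (simp only: power2_eq_square fls_mult_const_nth mult.assoc)
    moreover have "fls_nth (fls_deriv (fls_deriv F)) m = of_int (m + 2) * of_int (m + 1) * fls_nth F (m + 2)"
      by (simp add: add.assoc)
    ultimately show ?thesis
      unfolding ode by (auto simp: fls_const_nth split: if_splits)
  qed
  have FF: "fls_nth (F * F) (2 * n) = fls_nth F n * fls_nth F n" "\<And>m. m < 2 * n \<Longrightarrow> fls_nth (F * F) m = 0"
    using fls_times_base[of F F] by (auto simp: n_def fls_times_nth_eq0 simp flip: mult_2)
  \<comment> \<open>For n < -2 the index 2 n + 2 lies below the order n, so F'' contributes nothing
    at 2 n, while 6 F^2 has the nonzero coefficient 6 (F_n)^2 there. The inhomogeneity sits at the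
    indices 0 and 1 only.\<close>
  have "n \<ge> -2"
    using coeff[of "2 * n"] below[of "2 * n + 2"] Fn n0 FF(1) by (cases "n < -2") auto
  \<comment> \<open>For n = -1 the coefficient of F'' at n - 2 is n (n - 1) F_n, which is nonzero,
    while F^2 starts only at 2 n > n - 2.\<close>
  moreover have "n \<noteq> -1"
    using coeff[of "n - 2"] FF(2)[of "n - 2"] Fn by auto
  ultimately have n: "n = -2" using n0 by auto
  have conv: "fls_nth (F * F) m = (\<Sum>i=-2..m + 2. fls_nth F i * fls_nth F (m - i))" for m
    using fls_times_nth(2)[of F F m] by (simp add: n n_def[symmetric])
  \<comment> \<open>Index m of the identity determines the coefficient m + 2. At m = -4 it reads 6 c
    = 6 c^2 with c nonzero.\<close>
  have c_2: "fls_nth F (-2) = 1" using coeff[of "-4"] Fn by (simp add: conv n simp_from_to)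
  have c_1: "fls_nth F (-1) = 0" using coeff[of "-3"] by (simp add: conv simp_from_to c_2)
  have c0: "fls_nth F 0 = 0" using coeff[of "-2"] by (simp add: conv simp_from_to c_2 c_1)
  have c1: "fls_nth F 1 = 0" using coeff[of "-1"] by (simp add: conv simp_from_to c_2 c_1 c0)
  have c2: "fls_nth F 2 = a / 10" using coeff[of 0] by (simp add: conv simp_from_to c_2 c_1 c0 c1 field_simps)
  have c3: "fls_nth F 3 = 1 / 6" using coeff[of 1] by (simp add: conv simp_from_to c_2 c_1 c0 c1 field_simps)
  \<comment> \<open>At index 2 both sides contain 12 c_4: 4 * 3 from F'', and 6 * 2 from the cross
    terms with c_-2 = 1. The coefficient is a free parameter of the solution and is merely
    named.\<close>
  have c4: "fls_nth F 4 = b" by (simp add: b_def F_def)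
  define R where "R = F - fls_X_intpow (-2) - fls_const (a / 10) * fls_X_intpow 2
    - fls_const (1 / 6) * fls_X_intpow 3 - fls_const b * fls_X_intpow 4"
  define G where "G = fls_shift 5 R"
  have "(\<lambda>w. (Y w - w powi (-2) - a / 10 * w powi 2 - 1 / 6 * w powi 3 - b * w powi 4) * w powi (-5))
      has_laurent_expansion G"
    unfolding G_def R_def by (intro laurent_expansion_intros F)
  then have rad: "fls_conv_radius G > 0" and ev: "eventually (\<lambda>w. eval_fls G w =
      (Y w - w powi (-2) - a / 10 * w powi 2 - 1 / 6 * w powi 3 - b * w powi 4) * w powi (-5)) (at 0)"
    by (auto simp: has_laurent_expansion_def)
  have R0: "fls_nth R m = 0" if "m < 5" for m
  proof (cases "m < -2")
    case True
    then show ?thesis using below[of m] n by (simp add: R_def)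
  next
    case False
    with that have "m \<in> {-2, -1, 0, 1, 2, 3, 4}" by auto
    then show ?thesis
      by (auto simp: R_def c_2 c_1 c0 c1 c2 c3 c4)
  qed
  have "fls_subdegree G \<ge> 0"
    by (cases "G = 0") (auto intro!: fls_subdegree_geI simp: G_def R0)
  obtain r1 :: real where r1: "r1 > 0" "ereal r1 < fls_conv_radius G"
    using rad ereal_dense2[of 0 "fls_conv_radius G"] by (auto simp: zero_ereal_def)
  from ev obtain r2 where r2: "r2 > 0" "\<And>w. w \<noteq> 0 \<Longrightarrow> norm w < r2 \<Longrightarrow> eval_fls G w =
      (Y w - w powi (-2) - a / 10 * w powi 2 - 1 / 6 * w powi 3 - b * w powi 4) * w powi (-5)"
    unfolding eventually_at by (auto simp: dist_norm)
  from np obtain r3 where r3: "r3 > 0" "\<And>z. z \<noteq> a \<Longrightarrow> dist z a < r3 \<Longrightarrow> \<not> is_pole y z"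
    unfolding eventually_at by auto
  define \<rho> where "\<rho> = min r1 (min r2 r3)"
  define S where "S = (\<lambda>z. eval_fls G (z - a))"
  show ?thesis
  proof (rule that[of \<rho> S])
    show "\<rho> > 0" using r1 r2 r3 by (simp add: \<rho>_def)
    have "ereal \<rho> \<le> fls_conv_radius G"
      using r1 by (auto simp: \<rho>_def intro: order_trans[of _ "ereal r1"] less_imp_le)
    then have "eval_fls G holomorphic_on ball 0 \<rho>"
      using \<open>fls_subdegree G \<ge> 0\<close>
      by (intro holomorphic_on_eval_fls) (use ball_eball_mono in auto)
    moreover have "(\<lambda>z. z - a) ` ball a \<rho> \<subseteq> ball 0 \<rho>"
      by (auto simp: dist_norm norm_minus_commute)
    moreover have "(\<lambda>z. z - a) holomorphic_on ball a \<rho>" by (intro holomorphic_intros)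
    ultimately show "S holomorphic_on ball a \<rho>"
      unfolding S_def using holomorphic_on_compose_gen[of "\<lambda>z. z - a"] by (simp add: o_def)
    fix z assume z: "z \<in> ball a \<rho> - {a}"
    then have z': "z - a \<noteq> 0" "norm (z - a) < r2" "dist z a < r3"
      by (auto simp: \<rho>_def dist_norm norm_minus_commute)
    have "S z = (y z - 1 / (z - a)\<^sup>2 - a * (z - a)\<^sup>2 / 10 - (z - a) ^ 3 / 6 - b * (z - a) ^ 4) / (z - a) ^ 5"
      unfolding S_def r2(2)[OF z'(1,2)] by (simp add: Y_def power_int_def field_simps)
    then have "(z - a) ^ 5 * S z = y z - 1 / (z - a)\<^sup>2 - a * (z - a)\<^sup>2 / 10 - (z - a) ^ 3 / 6 - b * (z - a) ^ 4"
      using z'(1) by simp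
    then show "\<not> is_pole y z \<and>
       y z = 1 / (z - a)\<^sup>2 + a * (z - a)\<^sup>2 / 10 + (z - a) ^ 3 / 6 + b * (z - a) ^ 4 + (z - a) ^ 5 * S z"
      using r3(2)[of z] z' by auto
  qed
qed

section \<open>The Lax pair near a pole\<close>

text \<open>These are the coefficients of f1 and f2 in the \<zeta>-system for p = t f2 and w = - f1
  / t + (1 / t^2 + \<zeta>) f2; the first two identities belong to p, the others to w. The leading 1
  in the last one is the derivative of the explicit \<zeta> in w. The dangerous part of t \<gamma>
  is 2 + a / t - 10 R / t - 2 R1: the values a / 10 and 1 / 6 cancel its orders -1 and 0, and the
  next order leaves -10 b - 4 b = -14 b.\<close>

lemma gauge_coefficients:
  fixes t S S1 R R1 y y1 \<zeta> a b :: complex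
  assumes t: "t \<noteq> 0"
    and R: "R = a / 10 + t / 6 + b * t\<^sup>2 + t ^ 3 * S"
    and R1: "R1 = 1 / 6 + 2 * b * t + 3 * t\<^sup>2 * S + t ^ 3 * S1"
    and y: "y = 1 / t\<^sup>2 + t\<^sup>2 * R" and y1: "y1 = - 2 / t ^ 3 + 2 * t * R + t\<^sup>2 * R1"
  defines "\<alpha> \<equiv> 2 * \<zeta>\<^sup>2 * t - 4 * t * R - 2 * \<zeta> * t ^ 3 * R - t\<^sup>2 * R1"
    and "\<beta> \<equiv> 2 * (1 + t ^ 4 * R - \<zeta> * t\<^sup>2)"
    and "\<gamma> \<equiv> 2 * \<zeta> ^ 3 - 14 * b - 10 * \<zeta> * R + t * (- 2 * \<zeta>\<^sup>2 * t * R - 16 * S - 2 * t * S1 - 2 * \<zeta> * R1 - 2 * t * R\<^sup>2)"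
  shows "t * (2 * (\<zeta> - y)) = - \<beta> / t" (is ?p1)
    and "- t * y1 = \<alpha> * t + \<beta> * (1 / t\<^sup>2 + \<zeta>)" (is ?p2)
    and "- y1 / t + (1 / t\<^sup>2 + \<zeta>) * (2 * (\<zeta> - y)) = \<alpha> / t" (is ?w1)
    and "1 - (2 * \<zeta>\<^sup>2 + 2 * \<zeta> * y - (a + t) + 2 * y\<^sup>2) / t - (1 / t\<^sup>2 + \<zeta>) * y1
      = \<gamma> * t - \<alpha> * (1 / t\<^sup>2 + \<zeta>)" (is ?w2)
proof -
  show ?p1 ?p2 ?w1
    unfolding \<alpha>_def \<beta>_def y y1 using t by (simp_all add: field_simps power_numeral_reduce)
  show ?w2
    unfolding \<alpha>_def \<gamma>_def y y1 R R1 using t by (simp add: field_simps power_numeral_reduce)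
qed

section \<open>The regularized Lax pair in a punctured disc around a pole\<close>

locale lax_at_pole =
  fixes y S :: "complex \<Rightarrow> complex" and a b :: complex and \<rho> :: real
    and f1 f2 :: "complex \<Rightarrow> complex \<Rightarrow> complex"
  assumes \<rho>: "\<rho> > 0" and S: "S holomorphic_on ball a (2 * \<rho>)"
    and y: "\<And>z. z \<in> ball a (2 * \<rho>) - {a} \<Longrightarrow>
      y z = 1 / (z - a)\<^sup>2 + a * (z - a)\<^sup>2 / 10 + (z - a) ^ 3 / 6 + b * (z - a) ^ 4 + (z - a) ^ 5 * S z"
    and f1_z: "\<And>\<zeta> z. z \<in> ball a (2 * \<rho>) - {a} \<Longrightarrow>
      (f1 \<zeta> has_field_derivative - (2 * y z + \<zeta>) * f2 \<zeta> z) (at z)"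
    and f2_z: "\<And>\<zeta> z. z \<in> ball a (2 * \<rho>) - {a} \<Longrightarrow>
      (f2 \<zeta> has_field_derivative - f1 \<zeta> z) (at z)"
    and f1_s: "\<And>\<zeta> z. z \<in> ball a (2 * \<rho>) - {a} \<Longrightarrow>
      ((\<lambda>s. f1 s z) has_field_derivative
        deriv y z * f1 \<zeta> z + (2 * \<zeta>\<^sup>2 + 2 * \<zeta> * y z - z + 2 * (y z)\<^sup>2) * f2 \<zeta> z) (at \<zeta>)"
    and f2_s: "\<And>\<zeta> z. z \<in> ball a (2 * \<rho>) - {a} \<Longrightarrow>
      ((\<lambda>s. f2 s z) has_field_derivative 2 * (\<zeta> - y z) * f1 \<zeta> z - deriv y z * f2 \<zeta> z) (at \<zeta>)"
begin

definition R where "R z = a / 10 + (z - a) / 6 + b * (z - a)\<^sup>2 + (z - a) ^ 3 * S z"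
text \<open>The second unknown is characterized by t^2 w = p' + \<zeta> t p with t = z - a. A
  Frobenius series for p starts with A - (\<zeta> A / 2) t^2 + B t^3, so the summand \<zeta> t p
  cancels the term of order 1 in p' and the division by t^2 is regular, with value 3 B at the
  pole.\<close>

definition p where "p \<zeta> z = (z - a) * f2 \<zeta> z"
definition w where "w \<zeta> z = - f1 \<zeta> z / (z - a) + (1 / (z - a)\<^sup>2 + \<zeta>) * f2 \<zeta> z"

lemma y_eq: "z \<in> ball a (2 * \<rho>) - {a} \<Longrightarrow> y z = 1 / (z - a)\<^sup>2 + (z - a)\<^sup>2 * R z"
proof -
  have "1 / t\<^sup>2 + a * t\<^sup>2 / 10 + t ^ 3 / 6 + b * t ^ 4 + t ^ 5 * s
      = 1 / t\<^sup>2 + t\<^sup>2 * (a / 10 + t / 6 + b * t\<^sup>2 + t ^ 3 * s)" for t s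
    by (simp add: algebra_simps power_numeral_reduce)
  then show "z \<in> ball a (2 * \<rho>) - {a} \<Longrightarrow> y z = 1 / (z - a)\<^sup>2 + (z - a)\<^sup>2 * R z"
    using y[of z] by (simp only: R_def)
qed

lemma R_holomorphic: "R holomorphic_on ball a (2 * \<rho>)"
  unfolding R_def by (intro holomorphic_intros S) auto

lemma S_deriv: "z \<in> ball a (2 * \<rho>) \<Longrightarrow> (S has_field_derivative deriv S z) (at z)"
  using S by (simp add: holomorphic_derivI)

lemma R_deriv: "z \<in> ball a (2 * \<rho>) \<Longrightarrow> (R has_field_derivative deriv R z) (at z)"
  using R_holomorphic by (simp add: holomorphic_derivI)

lemma deriv_R:
  assumes "z \<in> ball a (2 * \<rho>)"
  shows "deriv R z = 1 / 6 + 2 * b * (z - a) + 3 * (z - a)\<^sup>2 * S z + (z - a) ^ 3 * deriv S z"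
proof (rule DERIV_imp_deriv)
  show "(R has_field_derivative 1 / 6 + 2 * b * (z - a) + 3 * (z - a)\<^sup>2 * S z + (z - a) ^ 3 * deriv S z) (at z)"
    unfolding R_def
    by (auto intro!: derivative_eq_intros S_deriv[OF assms] simp: algebra_simps power_numeral_reduce)
qed

lemma deriv_y:
  assumes z: "z \<in> ball a (2 * \<rho>) - {a}"
  shows "deriv y z = - 2 / (z - a) ^ 3 + 2 * (z - a) * R z + (z - a)\<^sup>2 * deriv R z"
proof (rule DERIV_imp_deriv)
  define t where "t = z - a"
  have t: "t \<noteq> 0" using z by (simp add: t_def)
  have "((\<lambda>z. 1 / (z - a)\<^sup>2 + (z - a)\<^sup>2 * R z) has_field_derivative
      - 2 / (z - a) ^ 3 + 2 * (z - a) * R z + (z - a)\<^sup>2 * deriv R z) (at z)"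
    by (rule derivative_eq_intros R_deriv refl | use z in force)+
       (use t in \<open>simp add: t_def[symmetric] field_simps power_numeral_reduce\<close>)
  then show "(y has_field_derivative - 2 / (z - a) ^ 3 + 2 * (z - a) * R z + (z - a)\<^sup>2 * deriv R z) (at z)"
    by (rule has_field_derivative_transform_within_open[of _ _ _ "ball a (2 * \<rho>) - {a}"])
       (use z y_eq in auto)
qed

lemma p_z:
  assumes z: "z \<in> ball a (2 * \<rho>) - {a}"
  shows "(p \<zeta> has_field_derivative (z - a)\<^sup>2 * w \<zeta> z - \<zeta> * (z - a) * p \<zeta> z) (at z)"
proof -
  define t where "t = z - a"
  have t: "t \<noteq> 0" using z by (simp add: t_def)
  show ?thesis
    unfolding p_def [abs_def] w_def
    by (rule derivative_eq_intros f2_z[OF z] refl)+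
       (use t in \<open>simp add: t_def[symmetric] field_simps power_numeral_reduce\<close>)
qed

lemma w_z:
  assumes z: "z \<in> ball a (2 * \<rho>) - {a}"
  shows "(w \<zeta> has_field_derivative (2 * R z - \<zeta>\<^sup>2) * p \<zeta> z + \<zeta> * (z - a) * w \<zeta> z) (at z)"
proof -
  define t where "t = z - a"
  have t: "t \<noteq> 0" using z by (simp add: t_def)
  show ?thesis
    unfolding p_def w_def [abs_def]
    by (rule derivative_eq_intros f1_z[OF z] f2_z[OF z] refl | use z in force)+
       (use t in \<open>simp add: y_eq[OF z] t_def[symmetric] field_simps power_numeral_reduce\<close>)
qed

text \<open>\<open>\<alpha>\<close>, \<open>\<beta>\<close>, \<open>\<gamma>\<close> and -
  \<open>\<alpha>\<close> are the entries of the traceless matrix of the \<zeta>-system for (p, w);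
  they are holomorphic in z across the pole.\<close>

definition \<alpha> where "\<alpha> \<zeta> z = 2 * \<zeta>\<^sup>2 * (z - a) - 4 * (z - a) * R z - 2 * \<zeta> * (z - a) ^ 3 * R z - (z - a)\<^sup>2 * deriv R z"
definition \<beta> where "\<beta> \<zeta> z = 2 * (1 + (z - a) ^ 4 * R z - \<zeta> * (z - a)\<^sup>2)"
definition \<gamma> where "\<gamma> \<zeta> z = 2 * \<zeta> ^ 3 - 14 * b - 10 * \<zeta> * R z + (z - a) * (- 2 * \<zeta>\<^sup>2 * (z - a) * R z
  - 16 * S z - 2 * (z - a) * deriv S z - 2 * \<zeta> * deriv R z - 2 * (z - a) * (R z)\<^sup>2)"

lemma
  assumes z: "z \<in> ball a (2 * \<rho>) - {a}"
  shows p_s: "((\<lambda>s. p s z) has_field_derivative \<alpha> \<zeta> z * p \<zeta> z + \<beta> \<zeta> z * w \<zeta> z) (at \<zeta>)"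
    and w_s: "((\<lambda>s. w s z) has_field_derivative \<gamma> \<zeta> z * p \<zeta> z - \<alpha> \<zeta> z * w \<zeta> z) (at \<zeta>)"
proof -
  have t: "z - a \<noteq> 0" and z': "z \<in> ball a (2 * \<rho>)" using z by auto
  note G = gauge_coefficients[OF t R_def[of z] deriv_R[OF z'] y_eq[OF z] deriv_y[OF z],
      of \<zeta>, folded \<alpha>_def \<beta>_def \<gamma>_def]
  have "((\<lambda>s. p s z) has_field_derivative
      (z - a) * (2 * (\<zeta> - y z) * f1 \<zeta> z - deriv y z * f2 \<zeta> z)) (at \<zeta>)"
    unfolding p_def by (rule derivative_eq_intros f2_s[OF z] refl)+ simp
  also have "(z - a) * (2 * (\<zeta> - y z) * f1 \<zeta> z - deriv y z * f2 \<zeta> z)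
      = ((z - a) * (2 * (\<zeta> - y z))) * f1 \<zeta> z + (- (z - a) * deriv y z) * f2 \<zeta> z"
    by (simp add: algebra_simps)
  also have "\<dots> = \<alpha> \<zeta> z * p \<zeta> z + \<beta> \<zeta> z * w \<zeta> z"
    unfolding G p_def w_def by (simp add: algebra_simps)
  finally show "((\<lambda>s. p s z) has_field_derivative \<alpha> \<zeta> z * p \<zeta> z + \<beta> \<zeta> z * w \<zeta> z) (at \<zeta>)" .
  define u where "u = z - a"
  \<comment> \<open>The form a + (z - a) of z is the one in which \<open>gauge_coefficients\<close>
    contains this entry of the Lax matrix.\<close>
  have u: "u \<noteq> 0" and zu: "a + (z - a) = z" using t by (simp_all add: u_def)
  have "((\<lambda>s. w s z) has_field_derivative
      - (deriv y z * f1 \<zeta> z + (2 * \<zeta>\<^sup>2 + 2 * \<zeta> * y z - z + 2 * (y z)\<^sup>2) * f2 \<zeta> z) / (z - a)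
      + f2 \<zeta> z + (1 / (z - a)\<^sup>2 + \<zeta>) * (2 * (\<zeta> - y z) * f1 \<zeta> z - deriv y z * f2 \<zeta> z)) (at \<zeta>)"
    unfolding w_def by (rule derivative_eq_intros f1_s[OF z] f2_s[OF z] refl t)+
      (use u in \<open>simp add: u_def[symmetric] field_simps\<close>)
  also have "- (deriv y z * f1 \<zeta> z + (2 * \<zeta>\<^sup>2 + 2 * \<zeta> * y z - z + 2 * (y z)\<^sup>2) * f2 \<zeta> z) / (z - a)
      + f2 \<zeta> z + (1 / (z - a)\<^sup>2 + \<zeta>) * (2 * (\<zeta> - y z) * f1 \<zeta> z - deriv y z * f2 \<zeta> z)
      = (- deriv y z / (z - a) + (1 / (z - a)\<^sup>2 + \<zeta>) * (2 * (\<zeta> - y z))) * f1 \<zeta> z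
      + (1 - (2 * \<zeta>\<^sup>2 + 2 * \<zeta> * y z - (a + (z - a)) + 2 * (y z)\<^sup>2) / (z - a) - (1 / (z - a)\<^sup>2 + \<zeta>) * deriv y z) * f2 \<zeta> z"
    unfolding zu using u unfolding u_def[symmetric] by (simp add: field_simps)
  also have "\<dots> = \<gamma> \<zeta> z * p \<zeta> z - \<alpha> \<zeta> z * w \<zeta> z"
    unfolding G p_def w_def by (simp add: algebra_simps)
  finally show "((\<lambda>s. w s z) has_field_derivative \<gamma> \<zeta> z * p \<zeta> z - \<alpha> \<zeta> z * w \<zeta> z) (at \<zeta>)" .
qed

section \<open>Boundedness near the pole and extension across it\<close>

lemma \<rho>_sub: "z \<in> ball a \<rho> - {a} \<Longrightarrow> z \<in> ball a (2 * \<rho>) - {a}" "z \<in> ball a \<rho> \<Longrightarrow> z \<in> ball a (2 * \<rho>)"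
  using \<rho> by auto

lemma p_entire: "z \<in> ball a \<rho> - {a} \<Longrightarrow> (\<lambda>\<zeta>. p \<zeta> z) holomorphic_on UNIV"
  and w_entire: "z \<in> ball a \<rho> - {a} \<Longrightarrow> (\<lambda>\<zeta>. w \<zeta> z) holomorphic_on UNIV"
  unfolding holomorphic_on_open[OF open_UNIV] using p_s[OF \<rho>_sub(1)] w_s[OF \<rho>_sub(1)] by blast+

text \<open>Every \<open>z \<noteq> a\<close> can be joined by a segment avoiding \<open>a\<close> to one of two opposite base points.\<close>

lemma pw_bounded: "\<exists>M. \<forall>\<zeta> z. norm \<zeta> \<le> K \<longrightarrow> z \<in> ball a \<rho> - {a} \<longrightarrow> norm (p \<zeta> z, w \<zeta> z) \<le> M"
proof -
  have "compact (R ` cball a \<rho>)"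
    using \<rho> by (intro compact_continuous_image holomorphic_on_imp_continuous_on
        holomorphic_on_subset[OF R_holomorphic]) auto
  then have "bounded (R ` cball a \<rho>)" by (rule compact_imp_bounded)
  then obtain C where "\<forall>z\<in>cball a \<rho>. norm (R z) \<le> C" by (auto simp: bounded_iff)
  then have C: "\<And>z. z \<in> cball a \<rho> \<Longrightarrow> norm (R z) \<le> C" by blast
  \<comment> \<open>The sum of bounds for the moduli of the four entries of the z-system on
    |\<zeta>| \<le> K; no negative power of z - a occurs among them.\<close>
  define L where "L = \<rho>\<^sup>2 + K * \<rho> + (2 * C + K\<^sup>2) + K * \<rho>"
  have lip: "norm ((z - a)\<^sup>2 * w \<zeta> z - \<zeta> * (z - a) * p \<zeta> z)
      + norm ((2 * R z - \<zeta>\<^sup>2) * p \<zeta> z + \<zeta> * (z - a) * w \<zeta> z) \<le> L * norm (p \<zeta> z, w \<zeta> z)"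
    if "norm \<zeta> \<le> K" "z \<in> ball a \<rho>" for \<zeta> z
  proof -
    let ?N = "norm (p \<zeta> z, w \<zeta> z)"
    have N: "norm (p \<zeta> z) \<le> ?N" "norm (w \<zeta> z) \<le> ?N"
      by (auto simp: norm_Pair real_le_rsqrt)
    have K: "K \<ge> 0" using that(1) norm_ge_zero[of \<zeta>] by linarith
    have t: "norm (z - a) \<le> \<rho>" using that by (simp add: dist_norm norm_minus_commute)
    have 1: "norm ((z - a)\<^sup>2 * w \<zeta> z) \<le> \<rho>\<^sup>2 * ?N"
      unfolding norm_mult norm_power using t \<rho> N by (intro mult_mono power_mono) auto
    have 2: "norm (\<zeta> * (z - a) * p \<zeta> z) \<le> K * \<rho> * ?N" "norm (\<zeta> * (z - a) * w \<zeta> z) \<le> K * \<rho> * ?N"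
      unfolding norm_mult using t \<rho> N that K by (intro mult_mono; auto)+
    have "norm (2 * R z - \<zeta>\<^sup>2) \<le> norm (2 * R z) + norm (\<zeta>\<^sup>2)" by (rule norm_triangle_ineq4)
    also have "\<dots> \<le> 2 * C + K\<^sup>2"
      using C[of z] that by (intro add_mono) (auto simp: norm_mult norm_power power_mono)
    finally have 3: "norm ((2 * R z - \<zeta>\<^sup>2) * p \<zeta> z) \<le> (2 * C + K\<^sup>2) * ?N"
      unfolding norm_mult by (intro mult_mono N) (auto intro: order_trans[OF norm_ge_zero])
    from 1 2 3 norm_triangle_ineq4[of "(z - a)\<^sup>2 * w \<zeta> z" "\<zeta> * (z - a) * p \<zeta> z"]
      norm_triangle_ineq[of "(2 * R z - \<zeta>\<^sup>2) * p \<zeta> z" "\<zeta> * (z - a) * w \<zeta> z"]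
    show ?thesis by (simp add: L_def algebra_simps)
  qed
  have base: "\<exists>M. \<forall>\<zeta>. norm \<zeta> \<le> K \<longrightarrow> norm (p \<zeta> z, w \<zeta> z) \<le> M" if "z \<in> ball a \<rho> - {a}" for z
  proof -
    have "continuous_on (cball 0 K) (\<lambda>\<zeta>. (p \<zeta> z, w \<zeta> z))"
      by (intro continuous_on_Pair holomorphic_on_imp_continuous_on
          holomorphic_on_subset[OF p_entire[OF that]] holomorphic_on_subset[OF w_entire[OF that]]) auto
    then have "bounded ((\<lambda>\<zeta>. (p \<zeta> z, w \<zeta> z)) ` cball 0 K)"
      by (intro compact_imp_bounded compact_continuous_image) auto
    then obtain M where "\<forall>\<zeta>\<in>cball 0 K. norm (p \<zeta> z, w \<zeta> z) \<le> M" by (auto simp: bounded_iff)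
    then show ?thesis by (intro exI[of _ M]) auto
  qed
  define z1 z2 where "z1 = a + of_real (\<rho> / 2)" and "z2 = a - of_real (\<rho> / 2)"
  have z12: "z1 \<in> ball a \<rho> - {a}" "z2 \<in> ball a \<rho> - {a}"
    using \<rho> by (auto simp: z1_def z2_def dist_norm)
  obtain M1 M2 where M1: "\<And>\<zeta>. norm \<zeta> \<le> K \<Longrightarrow> norm (p \<zeta> z1, w \<zeta> z1) \<le> M1"
    and M2: "\<And>\<zeta>. norm \<zeta> \<le> K \<Longrightarrow> norm (p \<zeta> z2, w \<zeta> z2) \<le> M2"
    using base[OF z12(1)] base[OF z12(2)] by blast
  define M where "M = max M1 M2"
  have "norm (p \<zeta> z, w \<zeta> z) \<le> exp (L * (2 * \<rho>)) * M" if \<zeta>: "norm \<zeta> \<le> K" and z: "z \<in> ball a \<rho> - {a}" for \<zeta> z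
  proof -
    define x where "x = (if Re (z - a) \<ge> 0 then z1 else z2)"
    have x: "x \<in> ball a \<rho>" "norm (p \<zeta> x, w \<zeta> x) \<le> M"
      using z12 M1[OF \<zeta>] M2[OF \<zeta>] by (auto simp: x_def M_def)
    have seg: "u \<in> ball a \<rho> - {a}" if u: "u \<in> closed_segment x z" for u
    proof -
      have "u \<in> ball a \<rho>"
        using closed_segment_subset[OF x(1) _ convex_ball, of z] z u by (simp add: subset_iff)
      moreover have "u \<noteq> a"
      proof
        assume "u = a"
        then obtain s where s: "0 \<le> s" "s \<le> 1" "a = (1 - s) *\<^sub>R x + s *\<^sub>R z"
          using u by (auto simp: closed_segment_def)
        then have eq: "(1 - s) *\<^sub>R (x - a) + s *\<^sub>R (z - a) = 0"
          by (simp add: algebra_simps)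
        \<comment> \<open>The base point lies strictly on the side of the vertical line through a
          that contains z (on the right if z is on the line). A vanishing convex combination of the
          real parts thus forces s = 1, that is z = a.\<close>
        have Re: "(1 - s) * Re (x - a) + s * Re (z - a) = 0"
          using arg_cong[OF eq, of Re] by simp
        show False
        proof (cases "s = 1")
          case True
          then show False using eq z by simp
        next
          case False
          then have "(1 - s) * (\<rho> / 2) > 0" using s \<rho> by simp
          moreover have "x - a = of_real (if Re (z - a) \<ge> 0 then \<rho> / 2 else - \<rho> / 2)"
            by (simp add: x_def z1_def z2_def)
          then have "Re (x - a) = (if Re (z - a) \<ge> 0 then \<rho> / 2 else - \<rho> / 2)" by simp
          moreover have "Re (z - a) \<ge> 0 \<Longrightarrow> s * Re (z - a) \<ge> 0" "Re (z - a) < 0 \<Longrightarrow> s * Re (z - a) \<le> 0"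
            using s by (auto intro: mult_nonneg_nonneg mult_nonneg_nonpos)
          ultimately show False
            using Re by (cases "Re (z - a) \<ge> 0") (auto simp del: minus_complex.simps)
        qed
      qed
      ultimately show ?thesis by auto
    qed
    have "norm (p \<zeta> z, w \<zeta> z) \<le> exp (L * dist x z) * norm (p \<zeta> x, w \<zeta> x)"
    proof (rule gronwall_segment)
      fix u assume "u \<in> closed_segment x z"
      then have u: "u \<in> ball a \<rho>" "u \<in> ball a (2 * \<rho>) - {a}"
        using seg \<rho>_sub by blast+
      show "(p \<zeta> has_field_derivative (u - a)\<^sup>2 * w \<zeta> u - \<zeta> * (u - a) * p \<zeta> u) (at u)" by (rule p_z[OF u(2)])
      show "(w \<zeta> has_field_derivative (2 * R u - \<zeta>\<^sup>2) * p \<zeta> u + \<zeta> * (u - a) * w \<zeta> u) (at u)" by (rule w_z[OF u(2)])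
      show "norm ((u - a)\<^sup>2 * w \<zeta> u - \<zeta> * (u - a) * p \<zeta> u)
        + norm ((2 * R u - \<zeta>\<^sup>2) * p \<zeta> u + \<zeta> * (u - a) * w \<zeta> u) \<le> L * norm (p \<zeta> u, w \<zeta> u)"
        by (rule lip[OF \<zeta> u(1)])
    qed
    also have "\<dots> \<le> exp (L * (2 * \<rho>)) * M"
    proof (intro mult_mono)
      have "K \<ge> 0" using \<zeta> norm_ge_zero[of \<zeta>] by linarith
      moreover have "C \<ge> 0" using order_trans[OF norm_ge_zero C[of a]] \<rho> by simp
      ultimately have "L \<ge> 0" using \<rho> by (auto simp: L_def)
      moreover have "dist x z \<le> 2 * \<rho>"
        using x z dist_triangle[of x z a] by (simp add: dist_commute)
      ultimately show "exp (L * dist x z) \<le> exp (L * (2 * \<rho>))" by (simp add: mult_left_mono)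
    qed (use x in auto)
    finally show ?thesis .
  qed
  then show ?thesis by blast
qed

lemma isCont_R: "isCont R a" and isCont_deriv_R: "isCont (deriv R) a"
  and isCont_S: "isCont S a" and isCont_deriv_S: "isCont (deriv S) a"
proof -
  have "isCont f a \<and> isCont (deriv f) a" if f: "f holomorphic_on ball a (2 * \<rho>)" for f
  proof -
    have "deriv f holomorphic_on ball a (2 * \<rho>)" using f by (intro holomorphic_deriv) auto
    with f \<rho> show ?thesis
      by (auto dest!: holomorphic_on_imp_continuous_on simp: continuous_on_eq_continuous_at)
  qed
  from this[OF R_holomorphic] this[OF S]
  show "isCont R a" "isCont (deriv R) a" "isCont S a" "isCont (deriv S) a" by auto
qed

text \<open>The linear term of the cubic potential stems from R a = a / 10, which turns -10 \<zeta>
  R into - a \<zeta>.\<close>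

lemma coefficient_limits:
  "(\<alpha> \<zeta> \<longlongrightarrow> 0) (at a)" "(\<beta> \<zeta> \<longlongrightarrow> 2) (at a)" "(\<gamma> \<zeta> \<longlongrightarrow> 2 * \<zeta> ^ 3 - a * \<zeta> - 14 * b) (at a)"
proof -
  have lims: "(R \<longlongrightarrow> a / 10) (at a)" "(deriv R \<longlongrightarrow> deriv R a) (at a)" "(S \<longlongrightarrow> S a) (at a)" "(deriv S \<longlongrightarrow> deriv S a) (at a)"
    using isCont_R isCont_deriv_R isCont_S isCont_deriv_S by (auto simp: isCont_def R_def[of a])
  show "(\<alpha> \<zeta> \<longlongrightarrow> 0) (at a)" "(\<beta> \<zeta> \<longlongrightarrow> 2) (at a)"
    unfolding \<alpha>_def [abs_def] \<beta>_def [abs_def] by (auto intro!: tendsto_eq_intros lims)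
  show "(\<gamma> \<zeta> \<longlongrightarrow> 2 * \<zeta> ^ 3 - a * \<zeta> - 14 * b) (at a)"
    unfolding \<gamma>_def [abs_def] by (auto intro!: tendsto_eq_intros lims)
qed

text \<open>The z-equations persist at a by continuity of derivatives, the \<zeta>-equations by
  letting z tend to a on both sides. Since \<alpha> tends to 0 and \<beta> to 2, the limit system
  has zero diagonal and is a second-order equation for P.\<close>

lemma extension:
  obtains P W where
    "\<And>\<zeta> z. z \<in> ball a \<rho> - {a} \<Longrightarrow> P \<zeta> z = p \<zeta> z" "\<And>\<zeta> z. z \<in> ball a \<rho> - {a} \<Longrightarrow> W \<zeta> z = w \<zeta> z"
    "\<And>\<zeta>. P \<zeta> holomorphic_on ball a \<rho>" "\<And>\<zeta>. W \<zeta> holomorphic_on ball a \<rho>"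
    "\<And>z. z \<in> ball a \<rho> \<Longrightarrow> (\<lambda>\<zeta>. P \<zeta> z) holomorphic_on UNIV"
    "\<And>z. z \<in> ball a \<rho> \<Longrightarrow> (\<lambda>\<zeta>. W \<zeta> z) holomorphic_on UNIV"
    "continuous_on (UNIV \<times> ball a \<rho>) (\<lambda>(\<zeta>, z). P \<zeta> z)"
    "continuous_on (UNIV \<times> ball a \<rho>) (\<lambda>(\<zeta>, z). W \<zeta> z)"
    "\<And>\<zeta> z. z \<in> ball a \<rho> \<Longrightarrow>
       (P \<zeta> has_field_derivative (z - a)\<^sup>2 * W \<zeta> z - \<zeta> * (z - a) * P \<zeta> z) (at z)"
    "\<And>\<zeta> z. z \<in> ball a \<rho> \<Longrightarrow>
       (W \<zeta> has_field_derivative (2 * R z - \<zeta>\<^sup>2) * P \<zeta> z + \<zeta> * (z - a) * W \<zeta> z) (at z)"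
    "\<And>\<zeta>. ((\<lambda>s. P s a) has_field_derivative 2 * W \<zeta> a) (at \<zeta>)"
    "\<And>\<zeta>. ((\<lambda>s. W s a) has_field_derivative (2 * \<zeta> ^ 3 - a * \<zeta> - 14 * b) * P \<zeta> a) (at \<zeta>)"
proof -
  have le: "norm u \<le> norm (u, v)" "norm v \<le> norm (u, v)" for u v :: complex
    by (auto simp: norm_Pair real_le_rsqrt)
  have punct: "z \<in> ball a (2 * \<rho>) - {a}" if "z \<in> ball a \<rho> - {a}" for z
    using \<rho>_sub that by blast
  obtain P where P: "\<And>\<zeta> z. z \<in> ball a \<rho> - {a} \<Longrightarrow> P \<zeta> z = p \<zeta> z"
    "\<And>\<zeta>. P \<zeta> holomorphic_on ball a \<rho>" "\<And>z. z \<in> ball a \<rho> \<Longrightarrow> (\<lambda>\<zeta>. P \<zeta> z) holomorphic_on UNIV"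
    "continuous_on (UNIV \<times> ball a \<rho>) (\<lambda>(\<zeta>, z). P \<zeta> z)"
    "\<And>\<zeta>. ((\<lambda>z. deriv (\<lambda>s. P s z) \<zeta>) \<longlongrightarrow> deriv (\<lambda>s. P s a) \<zeta>) (at a)"
  proof (rule parametric_removable_singularity[of \<rho> p a])
    show "p \<zeta> holomorphic_on ball a \<rho> - {a}" for \<zeta>
      using p_z[OF punct] by (subst holomorphic_on_open) (blast intro: open_delete open_ball)+
    show "\<exists>M. \<forall>\<zeta> z. norm \<zeta> \<le> K \<longrightarrow> z \<in> ball a \<rho> - {a} \<longrightarrow> norm (p \<zeta> z) \<le> M" for K
      using pw_bounded[of K] order_trans[OF le(1)] by metis
  qed (use \<rho> p_entire in auto)
  obtain W where W: "\<And>\<zeta> z. z \<in> ball a \<rho> - {a} \<Longrightarrow> W \<zeta> z = w \<zeta> z"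
    "\<And>\<zeta>. W \<zeta> holomorphic_on ball a \<rho>" "\<And>z. z \<in> ball a \<rho> \<Longrightarrow> (\<lambda>\<zeta>. W \<zeta> z) holomorphic_on UNIV"
    "continuous_on (UNIV \<times> ball a \<rho>) (\<lambda>(\<zeta>, z). W \<zeta> z)"
    "\<And>\<zeta>. ((\<lambda>z. deriv (\<lambda>s. W s z) \<zeta>) \<longlongrightarrow> deriv (\<lambda>s. W s a) \<zeta>) (at a)"
  proof (rule parametric_removable_singularity[of \<rho> w a])
    show "w \<zeta> holomorphic_on ball a \<rho> - {a}" for \<zeta>
      using w_z[OF punct] by (subst holomorphic_on_open) (blast intro: open_delete open_ball)+
    show "\<exists>M. \<forall>\<zeta> z. norm \<zeta> \<le> K \<longrightarrow> z \<in> ball a \<rho> - {a} \<longrightarrow> norm (w \<zeta> z) \<le> M" for K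
      using pw_bounded[of K] order_trans[OF le(2)] by metis
  qed (use \<rho> w_entire in auto)
  have cont: "isCont (P \<zeta>) a" "isCont (W \<zeta>) a" for \<zeta>
    using holomorphic_on_imp_continuous_on[OF P(2)[of \<zeta>]] holomorphic_on_imp_continuous_on[OF W(2)[of \<zeta>]] \<rho>
    by (auto simp: continuous_on_eq_continuous_at)
  have transfer: "(g' has_field_derivative D) (at z)"
    if "(g has_field_derivative D) (at z)" "z \<in> ball a \<rho> - {a}"
      "\<And>z. z \<in> ball a \<rho> - {a} \<Longrightarrow> g' z = g z" for g g' D z
    using that by (intro has_field_derivative_transform_within_open[OF that(1), of "ball a \<rho> - {a}"]) auto
  have Pz: "(P \<zeta> has_field_derivative (z - a)\<^sup>2 * W \<zeta> z - \<zeta> * (z - a) * P \<zeta> z) (at z)"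
    if "z \<in> ball a \<rho>" for \<zeta> z
  proof (rule deriv_eq_by_continuity[OF P(2) \<rho> _ _ that])
    show "isCont (\<lambda>z. (z - a)\<^sup>2 * W \<zeta> z - \<zeta> * (z - a) * P \<zeta> z) a"
      by (intro continuous_intros cont)
    fix z assume z: "z \<in> ball a \<rho> - {a}"
    show "(P \<zeta> has_field_derivative (z - a)\<^sup>2 * W \<zeta> z - \<zeta> * (z - a) * P \<zeta> z) (at z)"
      unfolding P(1)[OF z] W(1)[OF z] by (rule transfer[OF p_z[OF punct[OF z]] z P(1)])
  qed
  have Wz: "(W \<zeta> has_field_derivative (2 * R z - \<zeta>\<^sup>2) * P \<zeta> z + \<zeta> * (z - a) * W \<zeta> z) (at z)"
    if "z \<in> ball a \<rho>" for \<zeta> z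
  proof (rule deriv_eq_by_continuity[OF W(2) \<rho> _ _ that])
    show "isCont (\<lambda>z. (2 * R z - \<zeta>\<^sup>2) * P \<zeta> z + \<zeta> * (z - a) * W \<zeta> z) a"
      by (intro continuous_intros cont isCont_R)
    fix z assume z: "z \<in> ball a \<rho> - {a}"
    show "(W \<zeta> has_field_derivative (2 * R z - \<zeta>\<^sup>2) * P \<zeta> z + \<zeta> * (z - a) * W \<zeta> z) (at z)"
      unfolding P(1)[OF z] W(1)[OF z] by (rule transfer[OF w_z[OF punct[OF z]] z W(1)])
  qed
  have ev: "eventually (\<lambda>z. z \<in> ball a \<rho> - {a}) (at a)"
    using \<rho> by (intro eventually_at_in_open) auto
  have limPW: "(P \<zeta> \<longlongrightarrow> P \<zeta> a) (at a)" "(W \<zeta> \<longlongrightarrow> W \<zeta> a) (at a)" for \<zeta>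
    using cont by (auto simp: isCont_def)
  have Ps: "((\<lambda>s. P s a) has_field_derivative 2 * W \<zeta> a) (at \<zeta>)" for \<zeta>
  proof -
    have "eventually (\<lambda>z. \<alpha> \<zeta> z * P \<zeta> z + \<beta> \<zeta> z * W \<zeta> z = deriv (\<lambda>s. P s z) \<zeta>) (at a)"
      using ev
    proof eventually_elim
      case (elim z)
      have "(\<lambda>s. P s z) = (\<lambda>s. p s z)" using P(1)[OF elim] by auto
      with DERIV_imp_deriv[OF p_s[OF punct[OF elim]]] show ?case
        using P(1)[OF elim] W(1)[OF elim] by simp
    qed
    moreover have "((\<lambda>z. \<alpha> \<zeta> z * P \<zeta> z + \<beta> \<zeta> z * W \<zeta> z) \<longlongrightarrow> 0 * P \<zeta> a + 2 * W \<zeta> a) (at a)"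
      by (intro tendsto_intros coefficient_limits limPW)
    ultimately have "((\<lambda>z. deriv (\<lambda>s. P s z) \<zeta>) \<longlongrightarrow> 2 * W \<zeta> a) (at a)"
      by (auto intro: Lim_transform_eventually)
    with P(5) have "deriv (\<lambda>s. P s a) \<zeta> = 2 * W \<zeta> a" by (rule LIM_unique)
    then show ?thesis using holomorphic_derivI[OF P(3)[of a], of \<zeta>] \<rho> by simp
  qed
  have Ws: "((\<lambda>s. W s a) has_field_derivative (2 * \<zeta> ^ 3 - a * \<zeta> - 14 * b) * P \<zeta> a) (at \<zeta>)" for \<zeta>
  proof -
    have "eventually (\<lambda>z. \<gamma> \<zeta> z * P \<zeta> z - \<alpha> \<zeta> z * W \<zeta> z = deriv (\<lambda>s. W s z) \<zeta>) (at a)"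
      using ev
    proof eventually_elim
      case (elim z)
      have "(\<lambda>s. W s z) = (\<lambda>s. w s z)" using W(1)[OF elim] by auto
      with DERIV_imp_deriv[OF w_s[OF punct[OF elim]]] show ?case
        using P(1)[OF elim] W(1)[OF elim] by simp
    qed
    moreover have "((\<lambda>z. \<gamma> \<zeta> z * P \<zeta> z - \<alpha> \<zeta> z * W \<zeta> z) \<longlongrightarrow>
        (2 * \<zeta> ^ 3 - a * \<zeta> - 14 * b) * P \<zeta> a - 0 * W \<zeta> a) (at a)"
      by (intro tendsto_intros coefficient_limits limPW)
    ultimately have "((\<lambda>z. deriv (\<lambda>s. W s z) \<zeta>) \<longlongrightarrow> (2 * \<zeta> ^ 3 - a * \<zeta> - 14 * b) * P \<zeta> a) (at a)"
      by (auto intro: Lim_transform_eventually)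
    with W(5) have "deriv (\<lambda>s. W s a) \<zeta> = (2 * \<zeta> ^ 3 - a * \<zeta> - 14 * b) * P \<zeta> a" by (rule LIM_unique)
    then show ?thesis using holomorphic_derivI[OF W(3)[of a], of \<zeta>] \<rho> by simp
  qed
  show ?thesis
    by (rule that[OF P(1) W(1) P(2) W(2) P(3) W(3) P(4) W(4) Pz Wz Ps Ws])
qed

text \<open>\<open>lim2\<close> and \<open>lim1\<close> say that f2 and f2' = - f1 behave like 1 / e
  and h / e at z0, which is the mode exp (h z) alone; \<open>dir\<close> says that this mode does
  not decay on the way to a. So its amplitude can be read off again at the pole.\<close>

lemma pole_asymptotics:
  fixes e h :: "complex \<Rightarrow> complex"
  assumes P: "\<And>\<zeta> z. z \<in> ball a \<rho> - {a} \<Longrightarrow> P \<zeta> z = p \<zeta> z"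
    and W: "\<And>\<zeta> z. z \<in> ball a \<rho> - {a} \<Longrightarrow> W \<zeta> z = w \<zeta> z"
    and P_z: "\<And>\<zeta> z. z \<in> ball a \<rho> \<Longrightarrow>
       (P \<zeta> has_field_derivative (z - a)\<^sup>2 * W \<zeta> z - \<zeta> * (z - a) * P \<zeta> z) (at z)"
    and W_z: "\<And>\<zeta> z. z \<in> ball a \<rho> \<Longrightarrow>
       (W \<zeta> has_field_derivative (2 * R z - \<zeta>\<^sup>2) * P \<zeta> z + \<zeta> * (z - a) * W \<zeta> z) (at z)"
    and z0: "z0 \<in> ball a \<rho> - {a}"
    and inf: "filterlim (\<lambda>\<zeta>. \<zeta>) at_infinity F"
    and h2: "eventually (\<lambda>\<zeta>. (h \<zeta>)\<^sup>2 = \<zeta>) F"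
    and dir: "eventually (\<lambda>\<zeta>. Re (h \<zeta> * (a - z0)) \<ge> 0) F"
    and e: "eventually (\<lambda>\<zeta>. e \<zeta> \<noteq> 0) F"
    and lim2: "((\<lambda>\<zeta>. e \<zeta> * f2 \<zeta> z0) \<longlongrightarrow> 1) F"
    and lim1: "((\<lambda>\<zeta>. e \<zeta> * f1 \<zeta> z0 / h \<zeta>) \<longlongrightarrow> - 1) F"
  shows "((\<lambda>\<zeta>. exp (- (h \<zeta> * (a - z0))) * e \<zeta> * h \<zeta> * P \<zeta> a) \<longlongrightarrow> - 1) F"
proof -
  define D where "D = a - z0"
  \<comment> \<open>For z \<noteq> a this is f2' + f2 / (z - a). Written with P and W it makes sense
    at a as well, where only - \<zeta> P remains.\<close>
  define v where "v \<zeta> z = (z - a) * W \<zeta> z - \<zeta> * P \<zeta> z" for \<zeta> z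
  define v1 where "v1 \<zeta> z = W \<zeta> z + 2 * (z - a) * R z * P \<zeta> z" for \<zeta> z
  define g where "g \<zeta> z = (4 * R z + 2 * (z - a) * deriv R z) * P \<zeta> z + 2 * (z - a)\<^sup>2 * R z * v \<zeta> z" for \<zeta> z
  have R_z: "(R has_field_derivative deriv R z) (at z)" if "z \<in> ball a \<rho>" for z
    using that \<rho>_sub by (intro R_deriv)
  have v: "(v \<zeta> has_field_derivative v1 \<zeta> z) (at z)" if z: "z \<in> ball a \<rho>" for \<zeta> z
    unfolding v_def [abs_def] v1_def
    by (rule derivative_eq_intros P_z[OF z] W_z[OF z] refl)+
       (simp add: algebra_simps power2_eq_square)
  have v1: "(v1 \<zeta> has_field_derivative \<zeta> * v \<zeta> z + g \<zeta> z) (at z)" if z: "z \<in> ball a \<rho>" for \<zeta> z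
    unfolding v1_def [abs_def]
    by (rule derivative_eq_intros P_z[OF z] W_z[OF z] R_z[OF z] refl)+
       (simp add: v_def g_def algebra_simps power2_eq_square)
  \<comment> \<open>W is eliminated. For large \<zeta> the factor on the left has modulus at least
    |\<zeta>| / 2, so P is controlled by v and v', and the remainder g in v'' = \<zeta> v + g
    becomes a small perturbation.\<close>
  have P_eq: "(\<zeta> + 2 * (z - a)\<^sup>2 * R z) * P \<zeta> z = (z - a) * v1 \<zeta> z - v \<zeta> z" for \<zeta> z
    by (simp add: v_def v1_def algebra_simps power2_eq_square)
  have "compact ((\<lambda>z. (R z, deriv R z)) ` cball a \<rho>)"
    using \<rho> by (intro compact_continuous_image continuous_on_Pair holomorphic_on_imp_continuous_on
        holomorphic_on_subset[OF R_holomorphic] holomorphic_on_subset[OF holomorphic_deriv[OF R_holomorphic]]) auto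
  then have "bounded ((\<lambda>z. (R z, deriv R z)) ` cball a \<rho>)" by (rule compact_imp_bounded)
  then obtain C where C0: "\<And>z. z \<in> cball a \<rho> \<Longrightarrow> norm (R z, deriv R z) \<le> C"
    unfolding bounded_iff by blast
  have C: "norm (R z) \<le> C" "norm (deriv R z) \<le> C" if "z \<in> ball a \<rho>" for z
    using C0[of z] that by (auto simp: norm_Pair intro: order_trans[OF real_sqrt_sum_squares_ge1] order_trans[OF real_sqrt_sum_squares_ge2])
  have Cpos: "C \<ge> 0" using order_trans[OF norm_ge_zero C(1)[of a]] \<rho> by simp
  define K where "K = (4 * C + 2 * \<rho> * C) * (\<rho> + 1) + \<rho>\<^sup>2 * C"
  have K: "K \<ge> 0" using Cpos \<rho> by (simp add: K_def)
  define X where "X \<zeta> t = v1 \<zeta> (z0 + of_real t * D) + h \<zeta> * v \<zeta> (z0 + of_real t * D)" for \<zeta> t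
  define Y where "Y \<zeta> t = v1 \<zeta> (z0 + of_real t * D) - h \<zeta> * v \<zeta> (z0 + of_real t * D)" for \<zeta> t
  define \<delta> where "\<delta> \<zeta> t = D * g \<zeta> (z0 + of_real t * D)" for \<zeta> t
  define \<kappa> where "\<kappa> \<zeta> = norm D * K / norm (h \<zeta>)" for \<zeta>
  \<comment> \<open>At z0 both e v / h and e v' / h^2 tend to 1. Hence the growing mode starts with
    size 2 h^2 / e, and the other one is negligible on this scale.\<close>
  define c where "c \<zeta> = (h \<zeta>)\<^sup>2 / e \<zeta>" for \<zeta>
  have seg: "z0 + of_real t * D \<in> ball a \<rho>" if "t \<in> {0..1}" for t
  proof -
    have "z0 + of_real t * D \<in> closed_segment z0 a"
      using that by (auto simp: D_def closed_segment_def algebra_simps scaleR_conv_of_real)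
    moreover have "closed_segment z0 a \<subseteq> ball a \<rho>"
      using z0 \<rho> by (intro closed_segment_subset) auto
    ultimately show ?thesis by blast
  qed
  have normh: "eventually (\<lambda>\<zeta>. norm (h \<zeta>) = sqrt (norm \<zeta>)) F"
    using h2 by eventually_elim (metis norm_power norm_ge_zero real_sqrt_unique)
  have "filterlim (\<lambda>\<zeta>. norm \<zeta>) at_top F"
    using inf by (rule filterlim_compose[OF filterlim_norm_at_top])
  then have norm_top: "filterlim (\<lambda>\<zeta>. sqrt (norm \<zeta>)) at_top F"
    by (rule filterlim_compose[OF sqrt_at_top])
  then have "filterlim (\<lambda>\<zeta>. norm (h \<zeta>)) at_top F"
    by (rule filterlim_mono_eventually[OF _ order_refl order_refl]) (use normh in \<open>auto elim: eventually_mono\<close>)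
  then have h_inf: "filterlim h at_infinity F"
    by (simp add: filterlim_at_infinity_conv_norm_at_top)
  have h_top: "filterlim (\<lambda>\<zeta>. norm (h \<zeta>)) at_top F" by fact
  have h_large: "eventually (\<lambda>\<zeta>. norm (h \<zeta>) \<ge> B) F" for B
    using h_top by (simp add: filterlim_at_top)
  have \<kappa>: "(\<kappa> \<longlongrightarrow> 0) F"
    unfolding \<kappa>_def [abs_def] by (rule real_tendsto_divide_at_top[OF tendsto_const h_top])
  have inv_h: "((\<lambda>\<zeta>. inverse (h \<zeta>)) \<longlongrightarrow> 0) F"
    by (rule filterlim_compose[OF tendsto_inverse_0 h_inf])
  have main: "eventually (\<lambda>\<zeta>. (\<forall>t\<in>{0..1}.
        (X \<zeta> has_vector_derivative (h \<zeta> * D) * X \<zeta> t + \<delta> \<zeta> t) (at t) \<and>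
        (Y \<zeta> has_vector_derivative - (h \<zeta> * D) * Y \<zeta> t + \<delta> \<zeta> t) (at t) \<and>
        norm (\<delta> \<zeta> t) \<le> \<kappa> \<zeta> * (norm (X \<zeta> t) + norm (Y \<zeta> t))) \<and> Re (h \<zeta> * D) \<ge> 0 \<and> \<kappa> \<zeta> \<ge> 0) F"
    \<comment> \<open>With |h| \<ge> 1 one has |\<zeta>| = |h|^2 \<ge> |h|, so the second threshold
      yields 2 \<rho>^2 C \<le> |\<zeta>| / 2, which is what solving \<open>P_eq\<close> for P
      requires.\<close>
    using h2 dir h_large[of 1] h_large[of "4 * \<rho>\<^sup>2 * C + 1"]
  proof eventually_elim
    case (elim \<zeta>)
    have "(X \<zeta> has_vector_derivative (h \<zeta> * D) * X \<zeta> t + \<delta> \<zeta> t) (at t)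
      \<and> (Y \<zeta> has_vector_derivative - (h \<zeta> * D) * Y \<zeta> t + \<delta> \<zeta> t) (at t)
      \<and> norm (\<delta> \<zeta> t) \<le> \<kappa> \<zeta> * (norm (X \<zeta> t) + norm (Y \<zeta> t))" if t: "t \<in> {0..1}" for t
    proof -
      define z where "z = z0 + of_real t * D"
      have z: "z \<in> ball a \<rho>" using seg[OF t] by (simp add: z_def)
      note dv = has_vector_derivative_along_line[OF v[OF z, unfolded z_def], of \<zeta>, folded z_def]
      note dv1 = has_vector_derivative_along_line[OF v1[OF z, unfolded z_def], of \<zeta>, folded z_def]
      define N where "N = norm (X \<zeta> t) + norm (Y \<zeta> t)"
      have hn: "norm (h \<zeta>) \<ge> 1" "h \<zeta> \<noteq> 0" using elim by auto
      have nz: "norm \<zeta> = norm (h \<zeta>) * norm (h \<zeta>)" using elim by (metis norm_mult power2_eq_square)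
      have tz: "norm (z - a) \<le> \<rho>" using z by (simp add: dist_norm norm_minus_commute)
      have N: "norm (v1 \<zeta> z) \<le> N / 2" "norm (v \<zeta> z) \<le> N / (2 * norm (h \<zeta>))"
        using half_sum_diff_bound[OF hn(2), where u = "v1 \<zeta> z" and v = "v \<zeta> z"] by (auto simp: N_def X_def Y_def z_def)
      have "N \<ge> 0" by (simp add: N_def)
      have vN: "norm (v \<zeta> z) \<le> N / 2"
        using mult_left_mono[OF hn(1) \<open>N \<ge> 0\<close>] hn by (intro order_trans[OF N(2)]) (simp add: field_simps)
      have Pb: "norm (P \<zeta> z) \<le> (\<rho> + 1) * N / norm (h \<zeta>)"
      proof -
        have "norm (2 * (z - a)\<^sup>2 * R z) \<le> 2 * \<rho>\<^sup>2 * C"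
          unfolding norm_mult norm_power using tz C(1)[OF z] by (intro mult_mono power_mono) auto
        also have "\<dots> \<le> norm \<zeta> / 2"
        proof -
          have "4 * \<rho>\<^sup>2 * C + 1 \<le> norm (h \<zeta>) * norm (h \<zeta>)"
            using elim(4) hn(1) mult_mono[of 1 "norm (h \<zeta>)" "4 * \<rho>\<^sup>2 * C + 1" "norm (h \<zeta>)"] Cpos by simp
          then show ?thesis by (simp add: nz)
        qed
        finally have "norm \<zeta> / 2 \<le> norm (\<zeta> + 2 * (z - a)\<^sup>2 * R z)"
          using norm_diff_ineq[of \<zeta> "2 * (z - a)\<^sup>2 * R z"] by linarith
        then have "norm \<zeta> / 2 * norm (P \<zeta> z) \<le> norm ((\<zeta> + 2 * (z - a)\<^sup>2 * R z) * P \<zeta> z)"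
          unfolding norm_mult by (rule mult_right_mono) simp
        also have "\<dots> \<le> norm ((z - a) * v1 \<zeta> z) + norm (v \<zeta> z)"
          unfolding P_eq by (rule norm_triangle_ineq4)
        also have "\<dots> \<le> \<rho> * (N / 2) + N / 2"
          unfolding norm_mult using tz N(1) vN \<rho> by (intro add_mono mult_mono) auto
        finally have "norm (h \<zeta>) * norm (h \<zeta>) * norm (P \<zeta> z) \<le> (\<rho> + 1) * N"
          by (simp add: nz algebra_simps)
        moreover have "norm (h \<zeta>) * norm (P \<zeta> z) \<le> norm (h \<zeta>) * (norm (h \<zeta>) * norm (P \<zeta> z))"
          using hn(1) mult_right_mono[of 1 "norm (h \<zeta>)" "norm (h \<zeta>) * norm (P \<zeta> z)"] by simp
        ultimately have "norm (h \<zeta>) * norm (P \<zeta> z) \<le> (\<rho> + 1) * N" by (simp add: mult.assoc)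
        then show ?thesis using hn by (simp add: field_simps)
      qed
      have "norm (g \<zeta> z) \<le> norm (4 * R z + 2 * (z - a) * deriv R z) * norm (P \<zeta> z) + norm (2 * (z - a)\<^sup>2 * R z) * norm (v \<zeta> z)"
        unfolding g_def norm_mult[symmetric] by (rule norm_triangle_ineq)
      also have "\<dots> \<le> (4 * C + 2 * \<rho> * C) * ((\<rho> + 1) * N / norm (h \<zeta>)) + (2 * \<rho>\<^sup>2 * C) * (N / (2 * norm (h \<zeta>)))"
      proof (intro add_mono mult_mono Pb N)
        show "norm (4 * R z + 2 * (z - a) * deriv R z) \<le> 4 * C + 2 * \<rho> * C"
          by (rule order_trans[OF norm_triangle_ineq]; unfold norm_mult; intro add_mono mult_mono)
             (use tz C[OF z] \<rho> in auto)
        show "norm (2 * (z - a)\<^sup>2 * R z) \<le> 2 * \<rho>\<^sup>2 * C"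
          unfolding norm_mult norm_power using tz C(1)[OF z] by (intro mult_mono power_mono) auto
      qed (use Cpos \<rho> in auto)
      also have "\<dots> = K / norm (h \<zeta>) * N"
        using hn by (simp add: K_def field_simps)
      finally have "norm D * norm (g \<zeta> z) \<le> norm D * (K / norm (h \<zeta>) * N)"
        by (rule mult_left_mono) simp
      then have bd: "norm (\<delta> \<zeta> t) \<le> \<kappa> \<zeta> * N"
        by (simp add: \<delta>_def \<kappa>_def z_def norm_mult)
      have sq: "\<zeta> = h \<zeta> * h \<zeta>" using elim(1) by (simp add: power2_eq_square)
      have "(X \<zeta> has_vector_derivative D * (\<zeta> * v \<zeta> z + g \<zeta> z) + h \<zeta> * (D * v1 \<zeta> z)) (at t)"
        unfolding X_def [abs_def] by (intro derivative_intros dv dv1 has_vector_derivative_mult_right)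
      moreover have "D * (\<zeta> * v \<zeta> z + g \<zeta> z) + h \<zeta> * (D * v1 \<zeta> z) = (h \<zeta> * D) * X \<zeta> t + \<delta> \<zeta> t"
        by (subst sq) (simp add: X_def \<delta>_def z_def algebra_simps)
      moreover have "(Y \<zeta> has_vector_derivative D * (\<zeta> * v \<zeta> z + g \<zeta> z) - h \<zeta> * (D * v1 \<zeta> z)) (at t)"
        unfolding Y_def [abs_def] by (intro derivative_intros dv dv1 has_vector_derivative_mult_right)
      moreover have "D * (\<zeta> * v \<zeta> z + g \<zeta> z) - h \<zeta> * (D * v1 \<zeta> z) = - (h \<zeta> * D) * Y \<zeta> t + \<delta> \<zeta> t"
        by (subst sq) (simp add: Y_def \<delta>_def z_def algebra_simps)
      ultimately show ?thesis using bd by (simp add: N_def)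
    qed
    with elim K show ?case by (auto simp: D_def \<kappa>_def)
  qed
  have ev0: "eventually (\<lambda>\<zeta>. e \<zeta> \<noteq> 0 \<and> h \<zeta> \<noteq> 0 \<and> (h \<zeta>)\<^sup>2 = \<zeta>) F"
    using e h_large[of 1] h2 by eventually_elim auto
  have ev1: "eventually (\<lambda>\<zeta>. e \<zeta> \<noteq> 0 \<and> h \<zeta> \<noteq> 0) F"
    using ev0 by eventually_elim auto
  define t0 where "t0 = z0 - a"
  have t0: "t0 \<noteq> 0" using z0 by (simp add: t0_def)
  have v_z0: "v \<zeta> z0 = - f1 \<zeta> z0 + f2 \<zeta> z0 / t0" for \<zeta>
    using t0 unfolding v_def P[OF z0] W[OF z0] p_def w_def t0_def[symmetric]
    by (simp add: field_simps power2_eq_square)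
  have v1_z0: "v1 \<zeta> z0 = - f1 \<zeta> z0 / t0 + (1 / t0\<^sup>2 + \<zeta>) * f2 \<zeta> z0 + 2 * t0\<^sup>2 * R z0 * f2 \<zeta> z0" for \<zeta>
    using t0 unfolding v1_def P[OF z0] W[OF z0] p_def w_def t0_def[symmetric]
    by (simp add: power2_eq_square mult_ac)
  have "((\<lambda>\<zeta>. - (e \<zeta> * f1 \<zeta> z0 / h \<zeta>) + (e \<zeta> * f2 \<zeta> z0) * (inverse (h \<zeta>) / t0)) \<longlongrightarrow> - (- 1) + 1 * (0 / t0)) F"
    by (intro tendsto_intros lim1 lim2 inv_h t0)
  then have limv: "((\<lambda>\<zeta>. e \<zeta> * v \<zeta> z0 / h \<zeta>) \<longlongrightarrow> 1) F"
    by (simp add: v_z0 divide_inverse algebra_simps)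
  have "((\<lambda>\<zeta>. - (e \<zeta> * f1 \<zeta> z0 / h \<zeta>) * (inverse (h \<zeta>) / t0)
      + (e \<zeta> * f2 \<zeta> z0) * ((1 / t0\<^sup>2 + 2 * t0\<^sup>2 * R z0) * (inverse (h \<zeta>))\<^sup>2) + e \<zeta> * f2 \<zeta> z0)
      \<longlongrightarrow> - (- 1) * (0 / t0) + 1 * ((1 / t0\<^sup>2 + 2 * t0\<^sup>2 * R z0) * 0\<^sup>2) + 1) F"
    by (intro tendsto_intros lim1 lim2 inv_h t0)
  moreover have "eventually (\<lambda>\<zeta>. - (e \<zeta> * f1 \<zeta> z0 / h \<zeta>) * (inverse (h \<zeta>) / t0)
      + (e \<zeta> * f2 \<zeta> z0) * ((1 / t0\<^sup>2 + 2 * t0\<^sup>2 * R z0) * (inverse (h \<zeta>))\<^sup>2) + e \<zeta> * f2 \<zeta> z0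
      = e \<zeta> * v1 \<zeta> z0 / (h \<zeta>)\<^sup>2) F"
    using ev0
  proof eventually_elim
    case (elim \<zeta>)
    define k where "k = inverse (h \<zeta>)"
    have v1_eq: "v1 \<zeta> z0 = - f1 \<zeta> z0 / t0 + (1 / t0\<^sup>2 + 2 * t0\<^sup>2 * R z0) * f2 \<zeta> z0 + (h \<zeta>)\<^sup>2 * f2 \<zeta> z0"
      unfolding v1_z0 using elim by (simp add: algebra_simps)
    have "e \<zeta> * v1 \<zeta> z0 / (h \<zeta>)\<^sup>2 = e \<zeta> * (- f1 \<zeta> z0 / t0 + (1 / t0\<^sup>2 + 2 * t0\<^sup>2 * R z0) * f2 \<zeta> z0) * k\<^sup>2
        + e \<zeta> * f2 \<zeta> z0 * ((h \<zeta>)\<^sup>2 * k\<^sup>2)"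
      unfolding v1_eq k_def divide_inverse power_inverse by (simp only: algebra_simps)
    moreover have "(h \<zeta>)\<^sup>2 * k\<^sup>2 = 1" using elim unfolding k_def power_mult_distrib[symmetric] by simp
    ultimately show ?case
      by (simp add: k_def divide_inverse power2_eq_square algebra_simps)
  qed
  ultimately have limv1: "((\<lambda>\<zeta>. e \<zeta> * v1 \<zeta> z0 / (h \<zeta>)\<^sup>2) \<longlongrightarrow> 1) F"
    by (auto intro: Lim_transform_eventually)
  have X0: "((\<lambda>\<zeta>. X \<zeta> 0 / c \<zeta>) \<longlongrightarrow> 2) F"
  proof (rule Lim_transform_eventually)
    show "((\<lambda>\<zeta>. e \<zeta> * v1 \<zeta> z0 / (h \<zeta>)\<^sup>2 + e \<zeta> * v \<zeta> z0 / h \<zeta>) \<longlongrightarrow> 2) F"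
      using tendsto_add[OF limv1 limv] by simp
    show "eventually (\<lambda>\<zeta>. e \<zeta> * v1 \<zeta> z0 / (h \<zeta>)\<^sup>2 + e \<zeta> * v \<zeta> z0 / h \<zeta> = X \<zeta> 0 / c \<zeta>) F"
      using ev1 by eventually_elim (simp add: X_def c_def field_simps power2_eq_square)
  qed
  have Y0: "((\<lambda>\<zeta>. Y \<zeta> 0 / c \<zeta>) \<longlongrightarrow> 0) F"
  proof (rule Lim_transform_eventually)
    show "((\<lambda>\<zeta>. e \<zeta> * v1 \<zeta> z0 / (h \<zeta>)\<^sup>2 - e \<zeta> * v \<zeta> z0 / h \<zeta>) \<longlongrightarrow> 0) F"
      using tendsto_diff[OF limv1 limv] by simp
    show "eventually (\<lambda>\<zeta>. e \<zeta> * v1 \<zeta> z0 / (h \<zeta>)\<^sup>2 - e \<zeta> * v \<zeta> z0 / h \<zeta> = Y \<zeta> 0 / c \<zeta>) F"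
      using ev1 by eventually_elim (simp add: Y_def c_def field_simps power2_eq_square)
  qed
  note G = growing_mode_limit[OF main \<kappa> X0 Y0]
  have "((\<lambda>\<zeta>. - ((exp (- (h \<zeta> * D)) * X \<zeta> 1 / c \<zeta> - exp (- (h \<zeta> * D)) * Y \<zeta> 1 / c \<zeta>) / 2)) \<longlongrightarrow> - ((2 - 0) / 2)) F"
    by (intro tendsto_intros G) auto
  then have lim: "((\<lambda>\<zeta>. - ((exp (- (h \<zeta> * D)) * X \<zeta> 1 / c \<zeta> - exp (- (h \<zeta> * D)) * Y \<zeta> 1 / c \<zeta>) / 2)) \<longlongrightarrow> - 1) F"
    by simp
  have "eventually (\<lambda>\<zeta>. - ((exp (- (h \<zeta> * D)) * X \<zeta> 1 / c \<zeta> - exp (- (h \<zeta> * D)) * Y \<zeta> 1 / c \<zeta>) / 2)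
      = exp (- (h \<zeta> * (a - z0))) * e \<zeta> * h \<zeta> * P \<zeta> a) F"
    using ev0
  proof eventually_elim
    case (elim \<zeta>)
    have sq: "(h \<zeta>)\<^sup>2 = \<zeta>" and nz: "e \<zeta> \<noteq> 0" "h \<zeta> \<noteq> 0" using elim by auto
    \<comment> \<open>At parameter 1 the point is a itself: X - Y = 2 h v, and v reduces to -
      \<zeta> P there.\<close>
    have "X \<zeta> 1 - Y \<zeta> 1 = - 2 * h \<zeta> * (h \<zeta>)\<^sup>2 * P \<zeta> a"
      unfolding sq by (simp add: X_def Y_def D_def v_def)
    then have "exp (- (h \<zeta> * D)) * X \<zeta> 1 / c \<zeta> - exp (- (h \<zeta> * D)) * Y \<zeta> 1 / c \<zeta>
        = exp (- (h \<zeta> * D)) * (- 2 * h \<zeta> * (h \<zeta>)\<^sup>2 * P \<zeta> a) / c \<zeta>"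
      by (metis diff_divide_distrib right_diff_distrib)
    then show ?case
      using nz by (simp add: c_def D_def field_simps)
  qed
  with lim show ?thesis by (rule Lim_transform_eventually)
qed

text \<open>Inverting the gauge shows that P \<zeta> a is the coefficient of (z - a)^-2 in f1 and of
  (z - a)^-1 in f2. The potential is 2 times the limit of \<gamma>. Filter, base point and branch
  stay general because the admissible direction depends on the sector.\<close>

lemma pole_structure:
  obtains P W :: "complex \<Rightarrow> complex \<Rightarrow> complex" where
    "\<And>\<zeta> z. z \<in> ball a \<rho> - {a} \<Longrightarrow> f1 \<zeta> z = P \<zeta> z / (z - a)\<^sup>2 - (z - a) * W \<zeta> z + \<zeta> * P \<zeta> z"
    "\<And>\<zeta> z. z \<in> ball a \<rho> - {a} \<Longrightarrow> f2 \<zeta> z = P \<zeta> z / (z - a)"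
    "\<And>\<zeta>. P \<zeta> holomorphic_on ball a \<rho>" "\<And>\<zeta>. W \<zeta> holomorphic_on ball a \<rho>"
    "\<And>z. z \<in> ball a \<rho> \<Longrightarrow> (\<lambda>\<zeta>. P \<zeta> z) holomorphic_on UNIV"
    "\<And>z. z \<in> ball a \<rho> \<Longrightarrow> (\<lambda>\<zeta>. W \<zeta> z) holomorphic_on UNIV"
    "continuous_on (UNIV \<times> ball a \<rho>) (\<lambda>(\<zeta>, z). P \<zeta> z)"
    "continuous_on (UNIV \<times> ball a \<rho>) (\<lambda>(\<zeta>, z). W \<zeta> z)"
    "\<And>\<zeta>. deriv (deriv (\<lambda>s. P s a)) \<zeta> = (4 * \<zeta> ^ 3 - 2 * a * \<zeta> - 28 * b) * P \<zeta> a"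
    "\<And>F z0 e h. z0 \<in> ball a \<rho> - {a} \<Longrightarrow> filterlim (\<lambda>\<zeta>. \<zeta>) at_infinity F \<Longrightarrow>
      eventually (\<lambda>\<zeta>. (h \<zeta>)\<^sup>2 = \<zeta>) F \<Longrightarrow> eventually (\<lambda>\<zeta>. Re (h \<zeta> * (a - z0)) \<ge> 0) F \<Longrightarrow>
      eventually (\<lambda>\<zeta>. e \<zeta> \<noteq> 0) F \<Longrightarrow>
      ((\<lambda>\<zeta>. e \<zeta> * f2 \<zeta> z0) \<longlongrightarrow> 1) F \<Longrightarrow> ((\<lambda>\<zeta>. e \<zeta> * f1 \<zeta> z0 / h \<zeta>) \<longlongrightarrow> - 1) F \<Longrightarrow>
      ((\<lambda>\<zeta>. exp (- (h \<zeta> * (a - z0))) * e \<zeta> * h \<zeta> * P \<zeta> a) \<longlongrightarrow> - 1) F"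
proof (rule extension)
  fix P W
  assume P: "\<And>\<zeta> z. z \<in> ball a \<rho> - {a} \<Longrightarrow> P \<zeta> z = p \<zeta> z"
    and W: "\<And>\<zeta> z. z \<in> ball a \<rho> - {a} \<Longrightarrow> W \<zeta> z = w \<zeta> z"
    and hol: "\<And>\<zeta>. P \<zeta> holomorphic_on ball a \<rho>" "\<And>\<zeta>. W \<zeta> holomorphic_on ball a \<rho>"
    "\<And>z. z \<in> ball a \<rho> \<Longrightarrow> (\<lambda>\<zeta>. P \<zeta> z) holomorphic_on UNIV"
    "\<And>z. z \<in> ball a \<rho> \<Longrightarrow> (\<lambda>\<zeta>. W \<zeta> z) holomorphic_on UNIV"
    "continuous_on (UNIV \<times> ball a \<rho>) (\<lambda>(\<zeta>, z). P \<zeta> z)"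
    "continuous_on (UNIV \<times> ball a \<rho>) (\<lambda>(\<zeta>, z). W \<zeta> z)"
    and P_z: "\<And>\<zeta> z. z \<in> ball a \<rho> \<Longrightarrow>
       (P \<zeta> has_field_derivative (z - a)\<^sup>2 * W \<zeta> z - \<zeta> * (z - a) * P \<zeta> z) (at z)"
    and W_z: "\<And>\<zeta> z. z \<in> ball a \<rho> \<Longrightarrow>
       (W \<zeta> has_field_derivative (2 * R z - \<zeta>\<^sup>2) * P \<zeta> z + \<zeta> * (z - a) * W \<zeta> z) (at z)"
    and P_s: "\<And>\<zeta>. ((\<lambda>s. P s a) has_field_derivative 2 * W \<zeta> a) (at \<zeta>)"
    and W_s: "\<And>\<zeta>. ((\<lambda>s. W s a) has_field_derivative (2 * \<zeta> ^ 3 - a * \<zeta> - 14 * b) * P \<zeta> a) (at \<zeta>)"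
  show thesis
  proof (rule that[OF _ _ hol])
    fix \<zeta> z assume z: "z \<in> ball a \<rho> - {a}"
    define t where "t = z - a"
    have t: "t \<noteq> 0" using z by (simp add: t_def)
    show "f2 \<zeta> z = P \<zeta> z / (z - a)"
      unfolding P[OF z] p_def using z by simp
    show "f1 \<zeta> z = P \<zeta> z / (z - a)\<^sup>2 - (z - a) * W \<zeta> z + \<zeta> * P \<zeta> z"
      unfolding P[OF z] W[OF z] p_def w_def t_def[symmetric] using t
      by (simp add: field_simps power2_eq_square)
  next
    fix \<zeta>
    have "deriv (\<lambda>s. P s a) = (\<lambda>s. 2 * W s a)"
      using P_s by (auto intro!: DERIV_imp_deriv)
    moreover have "((\<lambda>s. 2 * W s a) has_field_derivative 2 * ((2 * \<zeta> ^ 3 - a * \<zeta> - 14 * b) * P \<zeta> a)) (at \<zeta>)"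
      by (intro DERIV_cmult W_s)
    ultimately show "deriv (deriv (\<lambda>s. P s a)) \<zeta> = (4 * \<zeta> ^ 3 - 2 * a * \<zeta> - 28 * b) * P \<zeta> a"
      by (simp add: DERIV_imp_deriv algebra_simps)
  next
    fix F z0 and e h :: "complex \<Rightarrow> complex"
    assume "z0 \<in> ball a \<rho> - {a}" "filterlim (\<lambda>\<zeta>. \<zeta>) at_infinity F"
      "eventually (\<lambda>\<zeta>. (h \<zeta>)\<^sup>2 = \<zeta>) F" "eventually (\<lambda>\<zeta>. Re (h \<zeta> * (a - z0)) \<ge> 0) F"
      "eventually (\<lambda>\<zeta>. e \<zeta> \<noteq> 0) F"
      "((\<lambda>\<zeta>. e \<zeta> * f2 \<zeta> z0) \<longlongrightarrow> 1) F" "((\<lambda>\<zeta>. e \<zeta> * f1 \<zeta> z0 / h \<zeta>) \<longlongrightarrow> - 1) F"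
    from pole_asymptotics[OF P W P_z W_z this]
    show "((\<lambda>\<zeta>. exp (- (h \<zeta> * (a - z0))) * e \<zeta> * h \<zeta> * P \<zeta> a) \<longlongrightarrow> - 1) F" .
  qed
qed

end

section \<open>Branches of the square root and of the fourth root\<close>

text \<open>The asymptotics \<open>f2 \<approx> 1/e\<close>, \<open>f1 \<approx> h/e\<close> at \<open>z0\<close> single out the mode \<open>e\<^sup>-\<^sup>h\<^sup>z\<close>, whereas the factors at
  \<open>z0\<close> and \<open>z1\<close> are related by \<open>e\<^sup>h\<^sup>z\<close>.\<close>

lemma oscillator_sign:
  fixes y e h :: "complex \<Rightarrow> complex" and f1 f2 :: "complex \<Rightarrow> complex \<Rightarrow> complex"
  assumes f1_z: "\<And>\<zeta> z. z \<in> closed_segment z0 z1 \<Longrightarrow>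
      (f1 \<zeta> has_field_derivative - (2 * y z + \<zeta>) * f2 \<zeta> z) (at z)"
    and f2_z: "\<And>\<zeta> z. z \<in> closed_segment z0 z1 \<Longrightarrow> (f2 \<zeta> has_field_derivative - f1 \<zeta> z) (at z)"
    and y: "continuous_on (closed_segment z0 z1) y"
    and F: "F \<noteq> bot" and h_top: "filterlim (\<lambda>\<zeta>. norm (h \<zeta>)) at_top F"
    and h2: "eventually (\<lambda>\<zeta>. (h \<zeta>)\<^sup>2 = \<zeta>) F"
    and dir: "filterlim (\<lambda>\<zeta>. Re (h \<zeta> * (z1 - z0))) at_bot F"
    and lim2: "((\<lambda>\<zeta>. e \<zeta> * f2 \<zeta> z0) \<longlongrightarrow> 1) F" and lim1: "((\<lambda>\<zeta>. e \<zeta> * f1 \<zeta> z0 / h \<zeta>) \<longlongrightarrow> 1) F"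
    and lim2': "((\<lambda>\<zeta>. exp (- (h \<zeta> * (z1 - z0))) * e \<zeta> * f2 \<zeta> z1) \<longlongrightarrow> 1) F"
    and lim1': "((\<lambda>\<zeta>. exp (- (h \<zeta> * (z1 - z0))) * e \<zeta> * f1 \<zeta> z1 / h \<zeta>) \<longlongrightarrow> 1) F"
  shows False
proof -
  define D where "D = z1 - z0"
  define c where "c \<zeta> = h \<zeta> / e \<zeta>" for \<zeta>
  \<comment> \<open>This is f2' - h f2, which annihilates exp (h z) and keeps exp (- h z). The
    latter grows along the segment, so the transport is applied with rate - h D.\<close>
  define X where "X \<zeta> t = - f1 \<zeta> (z0 + of_real t * D) - h \<zeta> * f2 \<zeta> (z0 + of_real t * D)" for \<zeta> t
  define Y where "Y \<zeta> t = - f1 \<zeta> (z0 + of_real t * D) + h \<zeta> * f2 \<zeta> (z0 + of_real t * D)" for \<zeta> t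
  define \<delta> where "\<delta> \<zeta> t = D * (2 * y (z0 + of_real t * D) * f2 \<zeta> (z0 + of_real t * D))" for \<zeta> t
  have seg: "z0 + of_real t * D \<in> closed_segment z0 z1" if "t \<in> {0..1}" for t
    using that by (auto simp: D_def closed_segment_def algebra_simps scaleR_conv_of_real)
  have "bounded (y ` closed_segment z0 z1)"
    by (intro compact_imp_bounded compact_continuous_image y) auto
  then obtain C where C: "\<And>z. z \<in> closed_segment z0 z1 \<Longrightarrow> norm (y z) \<le> C"
    unfolding bounded_iff by blast
  have Cpos: "C \<ge> 0" using order_trans[OF norm_ge_zero C[of z0]] by simp
  define \<kappa> where "\<kappa> \<zeta> = norm D * C / norm (h \<zeta>)" for \<zeta>
  have \<kappa>: "(\<kappa> \<longlongrightarrow> 0) F"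
    unfolding \<kappa>_def [abs_def] by (rule real_tendsto_divide_at_top[OF tendsto_const h_top])
  have hpos: "eventually (\<lambda>\<zeta>. norm (h \<zeta>) \<ge> 1) F"
    using h_top by (simp add: filterlim_at_top)
  have dir0: "eventually (\<lambda>\<zeta>. Re (h \<zeta> * D) \<le> 0) F"
    using dir unfolding filterlim_at_bot D_def by blast
  have main: "eventually (\<lambda>\<zeta>. (\<forall>t\<in>{0..1}.
        (X \<zeta> has_vector_derivative (- (h \<zeta> * D)) * X \<zeta> t + \<delta> \<zeta> t) (at t) \<and>
        (Y \<zeta> has_vector_derivative - (- (h \<zeta> * D)) * Y \<zeta> t + \<delta> \<zeta> t) (at t) \<and>
        norm (\<delta> \<zeta> t) \<le> \<kappa> \<zeta> * (norm (X \<zeta> t) + norm (Y \<zeta> t))) \<and> Re (- (h \<zeta> * D)) \<ge> 0 \<and> \<kappa> \<zeta> \<ge> 0) F"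
    using h2 dir0 hpos
  proof eventually_elim
    case (elim \<zeta>)
    have "(X \<zeta> has_vector_derivative (- (h \<zeta> * D)) * X \<zeta> t + \<delta> \<zeta> t) (at t) \<and>
        (Y \<zeta> has_vector_derivative - (- (h \<zeta> * D)) * Y \<zeta> t + \<delta> \<zeta> t) (at t) \<and>
        norm (\<delta> \<zeta> t) \<le> \<kappa> \<zeta> * (norm (X \<zeta> t) + norm (Y \<zeta> t))" if t: "t \<in> {0..1}" for t
    proof -
      define z where "z = z0 + of_real t * D"
      have z: "z \<in> closed_segment z0 z1" using seg[OF t] by (simp add: z_def)
      note d1 = has_vector_derivative_along_line[OF f1_z[OF z, unfolded z_def], of \<zeta>, folded z_def]
      note d2 = has_vector_derivative_along_line[OF f2_z[OF z, unfolded z_def], of \<zeta>, folded z_def]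
      have h0: "h \<zeta> \<noteq> 0" using elim by auto
      have sq: "\<zeta> = h \<zeta> * h \<zeta>" using elim(1) by (simp add: power2_eq_square)
      define N where "N = norm (X \<zeta> t) + norm (Y \<zeta> t)"
      have "norm (f2 \<zeta> z) \<le> N / (2 * norm (h \<zeta>))"
        using half_sum_diff_bound(2)[OF h0, where u = "- f1 \<zeta> z" and v = "f2 \<zeta> z"]
        by (simp add: N_def X_def Y_def z_def add.commute)
      then have "norm D * (2 * norm (y z) * norm (f2 \<zeta> z)) \<le> norm D * (2 * C * (N / (2 * norm (h \<zeta>))))"
        using C[OF z] Cpos by (intro mult_left_mono mult_mono) auto
      then have bd: "norm (\<delta> \<zeta> t) \<le> \<kappa> \<zeta> * N"
        by (simp add: \<delta>_def \<kappa>_def z_def norm_mult)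
      have "(X \<zeta> has_vector_derivative - (D * (- (2 * y z + \<zeta>) * f2 \<zeta> z)) - h \<zeta> * (D * - f1 \<zeta> z)) (at t)"
        unfolding X_def [abs_def] by (intro derivative_intros d1 d2 has_vector_derivative_mult_right)
      moreover have "- (D * (- (2 * y z + \<zeta>) * f2 \<zeta> z)) - h \<zeta> * (D * - f1 \<zeta> z) = (- (h \<zeta> * D)) * X \<zeta> t + \<delta> \<zeta> t"
        by (subst sq) (simp add: X_def \<delta>_def z_def algebra_simps)
      moreover have "(Y \<zeta> has_vector_derivative - (D * (- (2 * y z + \<zeta>) * f2 \<zeta> z)) + h \<zeta> * (D * - f1 \<zeta> z)) (at t)"
        unfolding Y_def [abs_def] by (intro derivative_intros d1 d2 has_vector_derivative_mult_right)
      moreover have "- (D * (- (2 * y z + \<zeta>) * f2 \<zeta> z)) + h \<zeta> * (D * - f1 \<zeta> z) = - (- (h \<zeta> * D)) * Y \<zeta> t + \<delta> \<zeta> t"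
        by (subst sq) (simp add: Y_def \<delta>_def z_def algebra_simps)
      ultimately show ?thesis using bd by (simp add: N_def)
    qed
    with elim Cpos show ?case by (auto simp: \<kappa>_def)
  qed
  have ev0: "eventually (\<lambda>\<zeta>. h \<zeta> \<noteq> 0) F" using hpos by eventually_elim auto
  have X0: "((\<lambda>\<zeta>. X \<zeta> 0 / c \<zeta>) \<longlongrightarrow> - 2) F"
  proof (rule Lim_transform_eventually)
    show "((\<lambda>\<zeta>. - (e \<zeta> * f1 \<zeta> z0 / h \<zeta>) - e \<zeta> * f2 \<zeta> z0) \<longlongrightarrow> - 2) F"
      using tendsto_diff[OF tendsto_minus[OF lim1] lim2] by simp
    show "eventually (\<lambda>\<zeta>. - (e \<zeta> * f1 \<zeta> z0 / h \<zeta>) - e \<zeta> * f2 \<zeta> z0 = X \<zeta> 0 / c \<zeta>) F"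
      using ev0 by eventually_elim (simp add: X_def c_def field_simps)
  qed
  have Y0: "((\<lambda>\<zeta>. Y \<zeta> 0 / c \<zeta>) \<longlongrightarrow> 0) F"
  proof (rule Lim_transform_eventually)
    show "((\<lambda>\<zeta>. - (e \<zeta> * f1 \<zeta> z0 / h \<zeta>) + e \<zeta> * f2 \<zeta> z0) \<longlongrightarrow> 0) F"
      using tendsto_add[OF tendsto_minus[OF lim1] lim2] by simp
    show "eventually (\<lambda>\<zeta>. - (e \<zeta> * f1 \<zeta> z0 / h \<zeta>) + e \<zeta> * f2 \<zeta> z0 = Y \<zeta> 0 / c \<zeta>) F"
      using ev0 by eventually_elim (simp add: Y_def c_def field_simps)
  qed
  \<comment> \<open>Transport gives the limit -2 for X 1 scaled by exp (h D) / c, and the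
    normalization at z1 gives -2 with the scale exp (- h D) / c. The quotient exp (2 h D) of the
    scales tends to 0, so both cannot hold.\<close>
  have X1: "((\<lambda>\<zeta>. exp (h \<zeta> * D) * X \<zeta> 1 / c \<zeta>) \<longlongrightarrow> - 2) F"
    using growing_mode_limit(1)[OF main \<kappa> X0 Y0] by simp
  have "((\<lambda>\<zeta>. - (exp (- (h \<zeta> * D)) * e \<zeta> * f1 \<zeta> z1 / h \<zeta>) - exp (- (h \<zeta> * D)) * e \<zeta> * f2 \<zeta> z1) \<longlongrightarrow> - 2) F"
    using tendsto_diff[OF tendsto_minus[OF lim1'] lim2'] by (simp add: D_def)
  moreover have "((\<lambda>\<zeta>. exp (2 * (h \<zeta> * D))) \<longlongrightarrow> 0) F"
  proof (rule tendsto_norm_zero_cancel)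
    have "filterlim (\<lambda>\<zeta>. 2 * Re (h \<zeta> * D)) at_bot F"
      using dir by (intro filterlim_tendsto_pos_mult_at_bot[OF tendsto_const]) (auto simp: D_def)
    then have "((\<lambda>\<zeta>. exp (2 * Re (h \<zeta> * D))) \<longlongrightarrow> 0) F"
      by (rule filterlim_compose[OF exp_at_bot])
    then show "((\<lambda>\<zeta>. norm (exp (2 * (h \<zeta> * D)))) \<longlongrightarrow> 0) F" by (simp add: norm_exp_eq_Re)
  qed
  ultimately have "((\<lambda>\<zeta>. exp (2 * (h \<zeta> * D)) * (- (exp (- (h \<zeta> * D)) * e \<zeta> * f1 \<zeta> z1 / h \<zeta>)
      - exp (- (h \<zeta> * D)) * e \<zeta> * f2 \<zeta> z1)) \<longlongrightarrow> 0 * - 2) F"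
    by (intro tendsto_mult)
  moreover have "eventually (\<lambda>\<zeta>. exp (2 * (h \<zeta> * D)) * (- (exp (- (h \<zeta> * D)) * e \<zeta> * f1 \<zeta> z1 / h \<zeta>)
      - exp (- (h \<zeta> * D)) * e \<zeta> * f2 \<zeta> z1) = exp (h \<zeta> * D) * X \<zeta> 1 / c \<zeta>) F"
    using ev0
  proof eventually_elim
    case (elim \<zeta>)
    define E where "E = exp (h \<zeta> * D)"
    have E: "E \<noteq> 0" "exp (h \<zeta> * D) = E" "exp (2 * (h \<zeta> * D)) = E * E" "exp (- (h \<zeta> * D)) = inverse E"
      unfolding E_def by (simp_all only: mult_2 exp_add exp_minus exp_not_eq_zero not_False_eq_True)
    have X1: "X \<zeta> 1 = - f1 \<zeta> z1 - h \<zeta> * f2 \<zeta> z1" by (simp add: X_def D_def)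
    show ?case
      unfolding E X1 c_def using elim E(1) by (simp add: field_simps)
  qed
  ultimately have "((\<lambda>\<zeta>. exp (h \<zeta> * D) * X \<zeta> 1 / c \<zeta>) \<longlongrightarrow> 0 * - 2) F"
    by (rule Lim_transform_eventually)
  with X1 F have "(0::complex) * - 2 = - 2" by (metis tendsto_unique)
  then show False by simp
qed

section \<open>Sectors in polar coordinates and continuous branches on them\<close>

lemma sector_mono: "\<epsilon> \<ge> 0 \<Longrightarrow> sector k \<epsilon> \<subseteq> sector k 0"
  unfolding sector_def by fastforce

text \<open>f / g is continuous with values in {1, -1} on a connected set. Applied to h against the
  half-angle formula, and to q^2 against h.\<close>

lemma sign_constant:
  fixes f g :: "'a::topological_space \<Rightarrow> complex"
  assumes A: "connected A" and f: "continuous_on A f" and g: "continuous_on A g"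
    and sq: "\<And>x. x \<in> A \<Longrightarrow> (f x)\<^sup>2 = (g x)\<^sup>2" and nz: "\<And>x. x \<in> A \<Longrightarrow> g x \<noteq> 0"
  obtains s where "s = 1 \<or> s = -1" "\<And>x. x \<in> A \<Longrightarrow> f x = s * g x"
proof (cases "A = {}")
  case True
  then show ?thesis using that[of 1] by auto
next
  case False
  have "f x / g x = 1 \<or> f x / g x = - 1" if "x \<in> A" for x
    using sq[OF that] nz[OF that] by (auto simp: power2_eq_iff)
  then have "(\<lambda>x. f x / g x) ` A \<subseteq> {1, - 1}"
    unfolding image_subset_iff by blast
  moreover have "continuous_on A (\<lambda>x. f x / g x)"
    using nz by (intro continuous_intros f g) auto
  ultimately have "(\<lambda>x. f x / g x) constant_on A"
    using A by (intro continuous_finite_range_constant) (auto intro: finite_subset)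
  then obtain s where s: "\<And>x. x \<in> A \<Longrightarrow> f x / g x = s"
    unfolding constant_on_def by blast
  obtain x where "x \<in> A" using False by blast
  have "s = 1 \<or> s = - 1" using \<open>x \<in> A\<close> \<open>(\<lambda>x. f x / g x) ` A \<subseteq> {1, - 1}\<close> s by fastforce
  moreover have "f x = s * g x" if "x \<in> A" for x
    using s[OF that] nz[OF that] by (simp add: field_simps)
  ultimately show ?thesis by (rule that)
qed

text \<open>The angle ranges over the real line, so a sector crossing the negative real axis is
  still the image of a product of intervals, on which the half-angle root is continuous.\<close>

definition polar_strip :: "int \<Rightarrow> (real \<times> real) set" where
  "polar_strip k = {0<..} \<times> {2 * pi * of_int k / 5 - 3 * pi / 5 <..< 2 * pi * of_int k / 5 + 3 * pi / 5}"

definition polar :: "real \<times> real \<Rightarrow> complex" where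
  "polar x = of_real (fst x) * cis (snd x)"

lemma sector_eq_polar: "sector k 0 = polar ` polar_strip k"
proof -
  have "\<bar>\<theta> - x\<bar> < u - 0 \<longleftrightarrow> \<theta> \<in> {x - u <..< x + u}" for \<theta> x u :: real
    by auto
  then have "sector k 0 = {of_real r * cis \<theta> | r \<theta>. (r, \<theta>) \<in> polar_strip k}"
    unfolding sector_def polar_strip_def by (simp only: mem_Times_iff fst_conv snd_conv greaterThan_iff)
  then show ?thesis by (force simp: polar_def)
qed

lemma connected_polar_strip: "connected (polar_strip k)"
  unfolding polar_strip_def by (intro connected_Times) auto

lemma continuous_on_polar: "continuous_on A polar"
  unfolding polar_def by (intro continuous_intros)

lemma connected_sector: "connected (sector k 0)"
  unfolding sector_eq_polar by (intro connected_continuous_image continuous_on_polar connected_polar_strip)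

lemma sqrt_branch_polar:
  assumes "sqrt_branch k h"
  obtains s :: complex where "s = 1 \<or> s = -1"
    "\<And>r \<theta>. (r, \<theta>) \<in> polar_strip k \<Longrightarrow> h (of_real r * cis \<theta>) = s * (of_real (sqrt r) * cis (\<theta> / 2))"
proof -
  have h: "continuous_on (sector k 0) h" "\<And>\<zeta>. \<zeta> \<in> sector k 0 \<Longrightarrow> (h \<zeta>)\<^sup>2 = \<zeta>"
    using assms by (auto simp: sqrt_branch_def)
  obtain s where s: "s = 1 \<or> s = -1"
    "\<And>x. x \<in> polar_strip k \<Longrightarrow> h (polar x) = s * (of_real (sqrt (fst x)) * cis (snd x / 2))"
  proof (rule sign_constant)
    show "connected (polar_strip k)" by (rule connected_polar_strip)
    show "continuous_on (polar_strip k) (\<lambda>x. h (polar x))"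
      using continuous_on_compose[OF continuous_on_polar, of "polar_strip k" h] h(1)
      by (simp add: sector_eq_polar o_def)
    show "continuous_on (polar_strip k) (\<lambda>x. of_real (sqrt (fst x)) * cis (snd x / 2))"
      by (intro continuous_intros) auto
    fix x assume x: "x \<in> polar_strip k"
    then have pos: "fst x > 0" by (auto simp: polar_strip_def)
    have "(h (polar x))\<^sup>2 = polar x" using x h(2) by (simp add: sector_eq_polar)
    also have "\<dots> = (of_real (sqrt (fst x)) * of_real (sqrt (fst x))) * (cis (snd x / 2) * cis (snd x / 2))"
      unfolding cis_mult of_real_mult[symmetric] using pos by (simp add: polar_def)
    also have "\<dots> = (of_real (sqrt (fst x)) * cis (snd x / 2))\<^sup>2"
      by (simp add: power2_eq_square)
    finally show "(h (polar x))\<^sup>2 = (of_real (sqrt (fst x)) * cis (snd x / 2))\<^sup>2" .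
    show "of_real (sqrt (fst x)) * cis (snd x / 2) \<noteq> 0" using pos by simp
  qed (rule that)
  show ?thesis
  proof (rule that[of s])
    show "h (of_real r * cis \<theta>) = s * (of_real (sqrt r) * cis (\<theta> / 2))" if "(r, \<theta>) \<in> polar_strip k" for r \<theta>
      using s(2)[OF that] by (simp add: polar_def)
  qed (use s(1) in simp)
qed

text \<open>The sector has half-angle \<open>3\<pi>/5 < \<pi>\<close>, so the values of \<open>h\<close> fill a sector of half-angle less
  than \<open>\<pi>/2\<close>.\<close>

lemma sqrt_branch_half_plane:
  assumes "sqrt_branch k h"
  obtains d where "norm d = 1" "\<And>\<zeta>. \<zeta> \<in> sector k 0 \<Longrightarrow> Re (h \<zeta> * d) \<ge> 0"
    "\<And>r. r > 0 \<Longrightarrow> h (of_real r * cis (2 * pi * of_int k / 5)) * d = of_real (sqrt r)"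
    "(d ^ 5)\<^sup>2 = 1"
proof -
  obtain s where s: "s = 1 \<or> s = -1"
    "\<And>r \<theta>. (r, \<theta>) \<in> polar_strip k \<Longrightarrow> h (of_real r * cis \<theta>) = s * (of_real (sqrt r) * cis (\<theta> / 2))"
    using sqrt_branch_polar[OF assms] by metis
  \<comment> \<open>This unit rotates the values of h on the central ray to the positive reals. Its
    tenth power is 1 for either sign s, so h^5 is real on that ray; which sign it has is decided
    only by the growth condition on the branch.\<close>
  define d where "d = s * cis (- (pi * of_int k / 5))"
  have ss: "s * s = 1" using s(1) by auto
  have hd: "h (of_real r * cis \<theta>) * d = of_real (sqrt r) * cis (\<theta> / 2 - pi * of_int k / 5)"
    if "(r, \<theta>) \<in> polar_strip k" for r \<theta>
  proof -
    have "h (of_real r * cis \<theta>) * d = (s * s) * (of_real (sqrt r) * (cis (\<theta> / 2) * cis (- (pi * of_int k / 5))))"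
      unfolding s(2)[OF that] d_def by (simp only: mult_ac)
    then show ?thesis by (simp only: ss cis_mult) simp
  qed
  show ?thesis
  proof (rule that[of d])
    show "norm d = 1" using s(1) by (auto simp: d_def norm_mult)
    show "Re (h \<zeta> * d) \<ge> 0" if \<zeta>: "\<zeta> \<in> sector k 0" for \<zeta>
    proof -
      obtain x where x: "x \<in> polar_strip k" "\<zeta> = polar x"
        using \<zeta> unfolding sector_eq_polar by blast
      obtain r \<theta> where "x = (r, \<theta>)" by (cases x)
      with x have r: "(r, \<theta>) \<in> polar_strip k" "\<zeta> = of_real r * cis \<theta>" by (simp_all add: polar_def)
      then have "r > 0" "2 * pi * of_int k / 5 - 3 * pi / 5 < \<theta>" "\<theta> < 2 * pi * of_int k / 5 + 3 * pi / 5"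
        by (auto simp: polar_strip_def)
      then have "r > 0" "\<bar>\<theta> - 2 * pi * of_int k / 5\<bar> < 3 * pi / 5" unfolding abs_less_iff by linarith+
      moreover have "\<theta> / 2 - pi * of_int k / 5 = (\<theta> - 2 * pi * of_int k / 5) / 2" by simp
      ultimately have "\<bar>\<theta> / 2 - pi * of_int k / 5\<bar> \<le> pi / 2" using pi_gt_zero by (simp add: abs_if split: if_splits)
      then have "cos (\<theta> / 2 - pi * of_int k / 5) \<ge> 0"
        unfolding abs_le_iff by (intro cos_ge_zero) linarith+
      then show ?thesis using \<open>r > 0\<close> by (simp add: r(2) hd[OF r(1)])
    qed
    show "h (of_real r * cis (2 * pi * of_int k / 5)) * d = of_real (sqrt r)" if "r > 0" for r
      using hd[of r "2 * pi * of_int k / 5"] that by (simp add: polar_strip_def)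
    have "cis (- (pi * of_int k / 5)) ^ 10 = cis (2 * pi * of_int (- k))"
      by (rule trans[OF Complex.DeMoivre arg_cong[of _ _ cis]]) simp
    then have "cis (- (pi * of_int k / 5)) ^ 10 = 1"
      by (metis Ints_of_int cis_multiple_2pi)
    moreover have "s ^ 10 = 1" using s(1) by auto
    ultimately show "(d ^ 5)\<^sup>2 = 1"
      by (simp add: d_def power_mult_distrib flip: power_mult)
  qed
qed

section \<open>The central ray of a sector\<close>

definition central_ray :: "int \<Rightarrow> complex filter" where
  "central_ray k = filtermap (\<lambda>r::real. of_real r * cis (2 * pi * of_int k / 5)) at_top"

lemma central_ray_neq_bot: "central_ray k \<noteq> bot"
  by (simp add: central_ray_def filtermap_bot_iff)

text \<open>Makes limits over a sector available along the ray and, since the ray filter is proper,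
  shows that the sector filter is proper too. The angle pi / 5 is just a convenient value between 0
  and 3 pi / 5.\<close>

lemma central_ray_le: "central_ray k \<le> inf at_infinity (principal (sector k (pi / 5)))"
proof (rule le_infI)
  have "filterlim (\<lambda>r::real. norm (of_real r * cis (2 * pi * of_int k / 5))) at_top at_top"
    by (rule filterlim_at_top_mono[OF filterlim_ident]) (auto simp: norm_mult intro!: always_eventually)
  then show "central_ray k \<le> at_infinity"
    by (simp add: central_ray_def filterlim_def[symmetric] filterlim_at_infinity_conv_norm_at_top)
  have "eventually (\<lambda>r. of_real r * cis (2 * pi * of_int k / 5) \<in> sector k (pi / 5)) at_top"
    using eventually_gt_at_top[of "0::real"] 
  proof eventually_elim
    case (elim r)
    then show ?case unfolding sector_def
      by (intro CollectI exI[of _ r] exI[of _ "2 * pi * of_int k / 5"]) simp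
  qed
  then show "central_ray k \<le> principal (sector k (pi / 5))"
    by (simp add: central_ray_def le_principal eventually_filtermap)
qed

section \<open>Uniqueness of normalized solutions\<close>

lemma eventually_central_ray_sector: "eventually (\<lambda>\<zeta>. \<zeta> \<in> sector k 0) (central_ray k)"
proof -
  have "eventually (\<lambda>\<zeta>. \<zeta> \<in> sector k (pi / 5)) (central_ray k)"
    using central_ray_le[of k] by (simp add: le_principal)
  then show ?thesis
    by (rule eventually_mono) (use sector_mono[of "pi / 5" k] in auto)
qed

lemma zero_notin_sector: "0 \<notin> sector k \<epsilon>"
  by (auto simp: sector_def)

text \<open>On this ray h^5 is plus or minus r^(5/2), and the condition on the branch selects plus;
  this dominates |z| sqrt r. The lower bound 1 lets a vanishing weighted Wronskian force the
  Wronskian itself to vanish.\<close>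

lemma exponential_growth_on_central_ray:
  assumes "sqrt_branch k h"
  shows "eventually (\<lambda>\<zeta>. norm (exp (4 / 5 * h \<zeta> ^ 5 - z * h \<zeta>)) \<ge> 1) (central_ray k)"
proof -
  obtain d where d: "norm d = 1" "(d ^ 5)\<^sup>2 = 1"
    "\<And>r. r > 0 \<Longrightarrow> h (of_real r * cis (2 * pi * of_int k / 5)) * d = of_real (sqrt r)"
    using sqrt_branch_half_plane[OF assms] by metis
  have "filterlim (\<lambda>r::real. Re ((h (of_real r * cis (2 * pi * of_int k / 5))) ^ 5)) at_top at_top"
    using assms by (simp add: sqrt_branch_def)
  then have "eventually (\<lambda>r. Re ((h (of_real r * cis (2 * pi * of_int k / 5))) ^ 5) > 0) at_top"
    by (simp add: filterlim_at_top_dense)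
  moreover have "eventually (\<lambda>r. 4 / 5 * sqrt r ^ 5 - norm z * sqrt r \<ge> 0) at_top"
    by real_asymp
  ultimately show ?thesis
    unfolding central_ray_def eventually_filtermap using eventually_gt_at_top[of 0]
  proof eventually_elim
    case (elim r)
    define u where "u = h (of_real r * cis (2 * pi * of_int k / 5))"
    have ud: "u * d = of_real (sqrt r)" using d(3) elim by (simp add: u_def)
    then have nu: "norm u = sqrt r" using d(1) elim by (metis norm_mult mult.right_neutral norm_of_real abs_of_nonneg real_sqrt_ge_zero less_imp_le)
    have "d ^ 5 = 1 \<or> d ^ 5 = -1" using d(2) by (rule power2_eq_1_iff[THEN iffD1])
    moreover have "u ^ 5 * d ^ 5 = of_real (sqrt r ^ 5)"
      using ud by (metis power_mult_distrib of_real_power)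
    ultimately have "u ^ 5 = of_real (sqrt r ^ 5) \<or> u ^ 5 = - of_real (sqrt r ^ 5)"
      by (metis mult_1_right mult_minus1_right minus_minus)
    moreover have "Re (u ^ 5) > 0" using elim by (simp add: u_def)
    moreover have "sqrt r ^ 5 > 0" using elim by simp
    ultimately have "Re (u ^ 5) = sqrt r ^ 5" by (auto simp del: of_real_power)
    moreover have "Re (z * u) \<le> norm z * sqrt r"
      using complex_Re_le_cmod[of "z * u"] by (simp add: norm_mult nu)
    moreover have "Re (4 / 5 * v) = 4 / 5 * Re v" for v by simp
    ultimately have "Re (4 / 5 * u ^ 5 - z * u) \<ge> 0"
      using elim by (simp only: minus_complex.simps)
    then show ?case by (simp add: norm_exp_eq_Re u_def)
  qed
qed

text \<open>Gronwall along the segment from s0 to s. The diagonal entry occurs in both rows, whence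
  the constant 2 M.\<close>

lemma linear_system_unique:
  fixes u1 u2 A B C :: "complex \<Rightarrow> complex"
  assumes u1: "\<And>s. (u1 has_field_derivative A s * u1 s + B s * u2 s) (at s)"
    and u2: "\<And>s. (u2 has_field_derivative C s * u1 s - A s * u2 s) (at s)"
    and cont: "continuous_on UNIV A" "continuous_on UNIV B" "continuous_on UNIV C"
    and zero: "u1 s0 = 0" "u2 s0 = 0"
  shows "u1 s = 0 \<and> u2 s = 0"
proof -
  have "bounded ((\<lambda>x. norm (A x) + norm (B x) + norm (C x)) ` closed_segment s0 s)"
    by (intro compact_imp_bounded compact_continuous_image continuous_intros continuous_on_subset[OF cont(1)]
        continuous_on_subset[OF cont(2)] continuous_on_subset[OF cont(3)]) auto
  then obtain M where M0: "\<forall>x\<in>closed_segment s0 s. norm (norm (A x) + norm (B x) + norm (C x)) \<le> M"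
    unfolding bounded_iff by blast
  have M: "norm (A x) + norm (B x) + norm (C x) \<le> M" if "x \<in> closed_segment s0 s" for x
    using bspec[OF M0 that] abs_ge_self[of "norm (A x) + norm (B x) + norm (C x)"]
    unfolding real_norm_def by linarith
  have "norm (u1 s, u2 s) \<le> exp (2 * M * dist s0 s) * norm (u1 s0, u2 s0)"
  proof (rule gronwall_segment[OF u1 u2])
    fix x assume x: "x \<in> closed_segment s0 s"
    let ?N = "norm (u1 x, u2 x)"
    have N: "norm (u1 x) \<le> ?N" "norm (u2 x) \<le> ?N"
      by (auto simp: norm_Pair real_le_rsqrt)
    have "norm (A x * u1 x + B x * u2 x) \<le> norm (A x) * ?N + norm (B x) * ?N"
      by (rule order_trans[OF norm_triangle_ineq]) (auto simp: norm_mult intro!: add_mono mult_left_mono N)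
    moreover have "norm (C x * u1 x - A x * u2 x) \<le> norm (C x) * ?N + norm (A x) * ?N"
      by (rule order_trans[OF norm_triangle_ineq4]) (auto simp: norm_mult intro!: add_mono mult_left_mono N)
    ultimately have "norm (A x * u1 x + B x * u2 x) + norm (C x * u1 x - A x * u2 x)
        \<le> (2 * norm (A x) + norm (B x) + norm (C x)) * ?N"
      by (simp add: algebra_simps)
    also have "\<dots> \<le> 2 * M * ?N"
    proof (rule mult_right_mono)
      show "2 * norm (A x) + norm (B x) + norm (C x) \<le> 2 * M"
        using M[OF x] norm_ge_zero[of "B x"] norm_ge_zero[of "C x"] by linarith
    qed simp
    finally show "norm (A x * u1 x + B x * u2 x) + norm (C x * u1 x - A x * u2 x) \<le> 2 * M * ?N" .
  qed
  then have "norm (u1 s, u2 s) = 0" by (simp add: zero)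
  then show ?thesis by (simp add: prod_eq_iff)
qed

text \<open>The Wronskian is constant because the matrix is traceless. In products of the two
  weighted components q and its inverse cancel, so the normalization makes E^2 times the Wronskian
  tend to 1 * 1 - 1 * 1 = 0. The solutions are then proportional, and the normalization fixes the
  factor 1.\<close>

lemma subdominant_solution_unique:
  fixes f1 f2 g1 g2 A B C E q :: "complex \<Rightarrow> complex"
  assumes f1: "\<And>s. (f1 has_field_derivative A s * f1 s + B s * f2 s) (at s)"
    and f2: "\<And>s. (f2 has_field_derivative C s * f1 s - A s * f2 s) (at s)"
    and g1: "\<And>s. (g1 has_field_derivative A s * g1 s + B s * g2 s) (at s)"
    and g2: "\<And>s. (g2 has_field_derivative C s * g1 s - A s * g2 s) (at s)"
    and cont: "continuous_on UNIV A" "continuous_on UNIV B" "continuous_on UNIV C"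
    and F: "F \<noteq> bot" and E: "eventually (\<lambda>s. norm (E s) \<ge> 1) F" and q: "eventually (\<lambda>s. q s \<noteq> 0) F"
    and f1_lim: "((\<lambda>s. E s * (inverse (q s) * f1 s)) \<longlongrightarrow> 1) F" and f2_lim: "((\<lambda>s. E s * (q s * f2 s)) \<longlongrightarrow> 1) F"
    and g1_lim: "((\<lambda>s. E s * (inverse (q s) * g1 s)) \<longlongrightarrow> 1) F" and g2_lim: "((\<lambda>s. E s * (q s * g2 s)) \<longlongrightarrow> 1) F"
  shows "f1 s = g1 s \<and> f2 s = g2 s"
proof -
  have "((\<lambda>s. f1 s * g2 s - f2 s * g1 s) has_field_derivative 0) (at s)" for s
    by (rule derivative_eq_intros f1 f2 g1 g2 refl)+ (simp add: algebra_simps)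
  then obtain d where d: "\<And>s. f1 s * g2 s - f2 s * g1 s = d"
    using has_field_derivative_zero_constant[of UNIV "\<lambda>s. f1 s * g2 s - f2 s * g1 s"] by auto
  have "((\<lambda>s. E s * (inverse (q s) * f1 s) * (E s * (q s * g2 s)) - E s * (q s * f2 s) * (E s * (inverse (q s) * g1 s)))
      \<longlongrightarrow> 1 * 1 - 1 * 1) F"
    by (intro tendsto_intros f1_lim f2_lim g1_lim g2_lim)
  then have "((\<lambda>s. norm (E s * (inverse (q s) * f1 s) * (E s * (q s * g2 s)) - E s * (q s * f2 s) * (E s * (inverse (q s) * g1 s))))
      \<longlongrightarrow> 0) F"
    by (intro tendsto_norm_zero) simp
  moreover have "eventually (\<lambda>s. norm d \<le> norm (E s * (inverse (q s) * f1 s) * (E s * (q s * g2 s))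
      - E s * (q s * f2 s) * (E s * (inverse (q s) * g1 s)))) F"
    using E q
  proof eventually_elim
    case (elim s)
    have "E s * (inverse (q s) * f1 s) * (E s * (q s * g2 s)) - E s * (q s * f2 s) * (E s * (inverse (q s) * g1 s))
        = E s * E s * (q s * inverse (q s)) * (f1 s * g2 s - f2 s * g1 s)"
      by (simp only: algebra_simps)
    also have "\<dots> = E s * E s * d" using elim by (simp add: d)
    moreover have "norm d \<le> norm (E s) * norm (E s) * norm d"
      using mult_mono[of 1 "norm (E s)" 1 "norm (E s)"] elim mult_right_mono[of 1 "norm (E s) * norm (E s)" "norm d"] by simp
    ultimately show ?case by (simp add: norm_mult)
  qed
  ultimately have "norm d \<le> 0"
    using F by (intro tendsto_lowerbound)
  then have d0: "f1 s * g2 s = f2 s * g1 s" for s using d[of s] by simp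
  have "eventually (\<lambda>s. E s * (q s * f2 s) \<noteq> 0) F"
    by (rule tendsto_imp_eventually_ne[OF f2_lim one_neq_zero])
  then obtain s0 where s0: "f2 s0 \<noteq> 0"
    using eventually_happens'[OF F] by fastforce
  \<comment> \<open>With zero Wronskian the data at one point with f2 nonzero are proportional;
    uniqueness for the linear system extends this to every s.\<close>
  define c where "c = g2 s0 / f2 s0"
  have zero: "g1 s0 - c * f1 s0 = 0" "g2 s0 - c * f2 s0 = 0"
    using d0[of s0] s0 by (auto simp: c_def field_simps)
  have gc: "g1 s - c * f1 s = 0 \<and> g2 s - c * f2 s = 0" for s
  proof (rule linear_system_unique[where ?u1.0 = "\<lambda>s. g1 s - c * f1 s" and ?u2.0 = "\<lambda>s. g2 s - c * f2 s", OF _ _ cont zero])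
    show "((\<lambda>s. g1 s - c * f1 s) has_field_derivative A s * (g1 s - c * f1 s) + B s * (g2 s - c * f2 s)) (at s)" for s
      by (rule derivative_eq_intros f1 g1 refl)+ (simp add: algebra_simps)
    show "((\<lambda>s. g2 s - c * f2 s) has_field_derivative C s * (g1 s - c * f1 s) - A s * (g2 s - c * f2 s)) (at s)" for s
      by (rule derivative_eq_intros f2 g2 refl)+ (simp add: algebra_simps)
  qed
  then have "(\<lambda>s. E s * (q s * g2 s)) = (\<lambda>s. c * (E s * (q s * f2 s)))"
    by (auto simp: algebra_simps)
  with tendsto_mult_left[OF f2_lim, of c] have "((\<lambda>s. E s * (q s * g2 s)) \<longlongrightarrow> c) F" by simp
  with g2_lim have "c = 1" using F tendsto_unique by blast
  with gc[of s] show ?thesis by simp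
qed

lemma lax_matrix_components:
  "vec_nth (lax_matrix_spectral y \<zeta> z *v x) 1 =
     deriv y z * vec_nth x 1 + (2 * \<zeta>\<^sup>2 + 2 * \<zeta> * y z - z + 2 * (y z)\<^sup>2) * vec_nth x 2"
  "vec_nth (lax_matrix_spectral y \<zeta> z *v x) 2 = 2 * (\<zeta> - y z) * vec_nth x 1 - deriv y z * vec_nth x 2"
  "vec_nth (lax_matrix_deform y \<zeta> z *v x) 1 = - (2 * y z + \<zeta>) * vec_nth x 2"
  "vec_nth (lax_matrix_deform y \<zeta> z *v x) 2 = - vec_nth x 1"
  by (simp_all add: lax_matrix_spectral_def lax_matrix_deform_def matrix_vector_mult_def sum_2 vector_2 algebra_simps)

lemma lax_solution_components:
  assumes "lax_solution y U \<Phi>" "z \<in> U"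
  shows "((\<lambda>s. vec_nth (\<Phi> s z) 1) has_field_derivative
      deriv y z * vec_nth (\<Phi> \<zeta> z) 1 + (2 * \<zeta>\<^sup>2 + 2 * \<zeta> * y z - z + 2 * (y z)\<^sup>2) * vec_nth (\<Phi> \<zeta> z) 2) (at \<zeta>)"
    "((\<lambda>s. vec_nth (\<Phi> s z) 2) has_field_derivative
      2 * (\<zeta> - y z) * vec_nth (\<Phi> \<zeta> z) 1 - deriv y z * vec_nth (\<Phi> \<zeta> z) 2) (at \<zeta>)"
    "((\<lambda>t. vec_nth (\<Phi> \<zeta> t) 1) has_field_derivative - (2 * y z + \<zeta>) * vec_nth (\<Phi> \<zeta> z) 2) (at z)"
    "((\<lambda>t. vec_nth (\<Phi> \<zeta> t) 2) has_field_derivative - vec_nth (\<Phi> \<zeta> z) 1) (at z)"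
proof -
  have 1: "((\<lambda>s. vec_nth (\<Phi> s z) i) has_field_derivative vec_nth (lax_matrix_spectral y \<zeta> z *v \<Phi> \<zeta> z) i) (at \<zeta>)"
    and 2: "((\<lambda>t. vec_nth (\<Phi> \<zeta> t) i) has_field_derivative vec_nth (lax_matrix_deform y \<zeta> z *v \<Phi> \<zeta> z) i) (at z)" for i
    using assms unfolding lax_solution_def by blast+
  note C = 1[of 1] 1[of 2] 2[of 1] 2[of 2]
  from C[unfolded lax_matrix_components]
  show "((\<lambda>s. vec_nth (\<Phi> s z) 1) has_field_derivative
      deriv y z * vec_nth (\<Phi> \<zeta> z) 1 + (2 * \<zeta>\<^sup>2 + 2 * \<zeta> * y z - z + 2 * (y z)\<^sup>2) * vec_nth (\<Phi> \<zeta> z) 2) (at \<zeta>)"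
    "((\<lambda>s. vec_nth (\<Phi> s z) 2) has_field_derivative
      2 * (\<zeta> - y z) * vec_nth (\<Phi> \<zeta> z) 1 - deriv y z * vec_nth (\<Phi> \<zeta> z) 2) (at \<zeta>)"
    "((\<lambda>t. vec_nth (\<Phi> \<zeta> t) 1) has_field_derivative - (2 * y z + \<zeta>) * vec_nth (\<Phi> \<zeta> z) 2) (at z)"
    "((\<lambda>t. vec_nth (\<Phi> \<zeta> t) 2) has_field_derivative - vec_nth (\<Phi> \<zeta> z) 1) (at z)"
    by blast+
qed

lemma normalized_solution_limits:
  assumes "normalized_solution y k h q U \<Phi>" "z \<in> U" "\<epsilon> > 0"
  shows "((\<lambda>\<zeta>. exp (4 / 5 * h \<zeta> ^ 5 - z * h \<zeta>) * (inverse (q \<zeta>) * vec_nth (\<Phi> \<zeta> z) 1)) \<longlongrightarrow> 1)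
      (inf at_infinity (principal (sector k \<epsilon>)))"
    "((\<lambda>\<zeta>. exp (4 / 5 * h \<zeta> ^ 5 - z * h \<zeta>) * (q \<zeta> * vec_nth (\<Phi> \<zeta> z) 2)) \<longlongrightarrow> 1)
      (inf at_infinity (principal (sector k \<epsilon>)))"
proof -
  have *: "((\<lambda>\<zeta>. exp (4 / 5 * h \<zeta> ^ 5 - z * h \<zeta>) *s
              ((vector [vector [inverse (q \<zeta>), 0], vector [0, q \<zeta>]] :: complex^2^2) *v \<Phi> \<zeta> z))
         \<longlongrightarrow> vector [1, 1]) (inf at_infinity (principal (sector k \<epsilon>)))"
    using assms unfolding normalized_solution_def by blast
  from tendsto_vec_nth[OF *, of 1] tendsto_vec_nth[OF *, of 2]
  show "((\<lambda>\<zeta>. exp (4 / 5 * h \<zeta> ^ 5 - z * h \<zeta>) * (inverse (q \<zeta>) * vec_nth (\<Phi> \<zeta> z) 1)) \<longlongrightarrow> 1)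
      (inf at_infinity (principal (sector k \<epsilon>)))"
    "((\<lambda>\<zeta>. exp (4 / 5 * h \<zeta> ^ 5 - z * h \<zeta>) * (q \<zeta> * vec_nth (\<Phi> \<zeta> z) 2)) \<longlongrightarrow> 1)
      (inf at_infinity (principal (sector k \<epsilon>)))"
    by (simp_all add: matrix_vector_mult_def sum_2 vector_2)
qed

text \<open>The comparison takes place in \<zeta> at one fixed z, so nothing has to be continued
  from one region to the other.\<close>

lemma normalized_solution_unique:
  assumes h: "sqrt_branch k h" and q: "fourth_root_branch k q"
    and U: "normalized_solution y k h q U \<Phi>" "z \<in> U"
    and V: "normalized_solution y k h q V \<Psi>" "z \<in> V"
  shows "\<Phi> \<zeta> z = \<Psi> \<zeta> z"
proof -
  have lax: "lax_solution y U \<Phi>" "lax_solution y V \<Psi>"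
    using U V by (auto simp: normalized_solution_def)
  note L = tendsto_mono[OF central_ray_le]
  have \<epsilon>: "pi / 5 > 0" by simp
  have "eventually (\<lambda>s. q s \<noteq> 0) (central_ray k)"
    using eventually_central_ray_sector
  proof eventually_elim
    case (elim s)
    then have "q s ^ 4 = s" "s \<noteq> 0" using q zero_notin_sector[of k 0] by (auto simp: fourth_root_branch_def)
    then show ?case by auto
  qed
  note qnz = this
  have "vec_nth (\<Phi> \<zeta> z) 1 = vec_nth (\<Psi> \<zeta> z) 1 \<and> vec_nth (\<Phi> \<zeta> z) 2 = vec_nth (\<Psi> \<zeta> z) 2"
    by (rule subdominant_solution_unique[where F = "central_ray k" and q = q
          and ?f1.0 = "\<lambda>s. vec_nth (\<Phi> s z) 1" and ?f2.0 = "\<lambda>s. vec_nth (\<Phi> s z) 2"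
          and ?g1.0 = "\<lambda>s. vec_nth (\<Psi> s z) 1" and ?g2.0 = "\<lambda>s. vec_nth (\<Psi> s z) 2"
          and E = "\<lambda>\<zeta>. exp (4 / 5 * h \<zeta> ^ 5 - z * h \<zeta>)" and A = "\<lambda>_. deriv y z"
          and B = "\<lambda>\<zeta>. 2 * \<zeta>\<^sup>2 + 2 * \<zeta> * y z - z + 2 * (y z)\<^sup>2" and C = "\<lambda>\<zeta>. 2 * (\<zeta> - y z)",
        OF lax_solution_components(1,2)[OF lax(1) U(2)] lax_solution_components(1,2)[OF lax(2) V(2)]
          _ _ _ central_ray_neq_bot exponential_growth_on_central_ray[OF h] qnz
          L[OF normalized_solution_limits(1)[OF U \<epsilon>]] L[OF normalized_solution_limits(2)[OF U \<epsilon>]]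
          L[OF normalized_solution_limits(1)[OF V \<epsilon>]] L[OF normalized_solution_limits(2)[OF V \<epsilon>]]])
       (intro continuous_intros)+
  then show ?thesis by (simp add: vec_eq_iff forall_2)
qed

section \<open>Gluing and the behaviour at the poles\<close>

locale normalized_lax_family =
  fixes y :: "complex \<Rightarrow> complex"
    and h q :: "int \<Rightarrow> complex \<Rightarrow> complex"
    and \<Phi> :: "int \<Rightarrow> complex set \<Rightarrow> complex \<Rightarrow> complex \<Rightarrow> complex^2"
  assumes PI: "PI_solution y"
    and h: "\<And>k. sqrt_branch k (h k)"
    and q: "\<And>k. fourth_root_branch k (q k)"
    and \<Phi>: "\<And>k U. regular_region y U \<Longrightarrow> normalized_solution y k (h k) (q k) U (\<Phi> k U)"
begin

text \<open>By uniqueness every regular region through z gives the same value, which makes the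
  choice harmless. The value 0 at the poles of y is a placeholder: no regular region contains such a
  point.\<close>

definition F :: "int \<Rightarrow> complex \<Rightarrow> complex \<Rightarrow> complex^2" where
  "F k \<zeta> z = (if is_pole y z then 0 else \<Phi> k (SOME U. regular_region y U \<and> z \<in> U) \<zeta> z)"

lemma regular_region_not_pole: "regular_region y U \<Longrightarrow> z \<in> U \<Longrightarrow> \<not> is_pole y z"
  using not_is_pole_holomorphic[of U z y] by (auto simp: regular_region_def)

lemma regular_region_exists:
  assumes "\<not> is_pole y z"
  obtains U where "regular_region y U" "z \<in> U"
proof -
  have "y analytic_on {z}" using PI assms by (auto simp: PI_solution_def)
  then obtain r where "r > 0" "y holomorphic_on ball z r"
    by (auto simp: analytic_on_def)
  then show ?thesis
    by (intro that[of "ball z r"]) (auto simp: regular_region_def convex_imp_simply_connected)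
qed

lemma F_eq:
  assumes "regular_region y U" "z \<in> U"
  shows "F k \<zeta> z = \<Phi> k U \<zeta> z"
proof -
  define V where "V = (SOME U. regular_region y U \<and> z \<in> U)"
  have V: "regular_region y V \<and> z \<in> V"
    unfolding V_def by (rule someI[of _ U]) (use assms in simp)
  have "F k \<zeta> z = \<Phi> k V \<zeta> z"
    using regular_region_not_pole[OF assms] by (simp add: F_def V_def)
  also have "\<dots> = \<Phi> k U \<zeta> z"
    using V by (intro normalized_solution_unique[OF h q \<Phi> _ \<Phi>[OF assms(1)] assms(2)]) auto
  finally show ?thesis .
qed

lemma F_spectral:
  assumes "\<not> is_pole y z"
  shows "((\<lambda>s. vec_nth (F k s z) 1) has_field_derivative
      deriv y z * vec_nth (F k \<zeta> z) 1 + (2 * \<zeta>\<^sup>2 + 2 * \<zeta> * y z - z + 2 * (y z)\<^sup>2) * vec_nth (F k \<zeta> z) 2) (at \<zeta>)"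
    "((\<lambda>s. vec_nth (F k s z) 2) has_field_derivative
      2 * (\<zeta> - y z) * vec_nth (F k \<zeta> z) 1 - deriv y z * vec_nth (F k \<zeta> z) 2) (at \<zeta>)"
proof -
  obtain U where U: "regular_region y U" "z \<in> U" using regular_region_exists[OF assms] .
  have "lax_solution y U (\<Phi> k U)" using \<Phi>[OF U(1)] by (simp add: normalized_solution_def)
  from lax_solution_components(1,2)[OF this U(2)] show
    "((\<lambda>s. vec_nth (F k s z) 1) has_field_derivative
      deriv y z * vec_nth (F k \<zeta> z) 1 + (2 * \<zeta>\<^sup>2 + 2 * \<zeta> * y z - z + 2 * (y z)\<^sup>2) * vec_nth (F k \<zeta> z) 2) (at \<zeta>)"
    "((\<lambda>s. vec_nth (F k s z) 2) has_field_derivative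
      2 * (\<zeta> - y z) * vec_nth (F k \<zeta> z) 1 - deriv y z * vec_nth (F k \<zeta> z) 2) (at \<zeta>)"
    by (simp_all only: F_eq[OF U])
qed

lemma F_deform:
  assumes "\<not> is_pole y z"
  shows "((\<lambda>t. vec_nth (F k \<zeta> t) 1) has_field_derivative - (2 * y z + \<zeta>) * vec_nth (F k \<zeta> z) 2) (at z)"
    "((\<lambda>t. vec_nth (F k \<zeta> t) 2) has_field_derivative - vec_nth (F k \<zeta> z) 1) (at z)"
proof -
  obtain U where U: "regular_region y U" "z \<in> U" using regular_region_exists[OF assms] .
  have "lax_solution y U (\<Phi> k U)" using \<Phi>[OF U(1)] by (simp add: normalized_solution_def)
  note L = lax_solution_components(3,4)[OF this U(2)]
  have "open U" using U by (simp add: regular_region_def)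
  note T = has_field_derivative_transform_within_open[OF _ this U(2)]
  show "((\<lambda>t. vec_nth (F k \<zeta> t) 1) has_field_derivative - (2 * y z + \<zeta>) * vec_nth (F k \<zeta> z) 2) (at z)"
    unfolding F_eq[OF U] by (rule T[OF L(1)]) (simp add: F_eq[OF U(1)])
  show "((\<lambda>t. vec_nth (F k \<zeta> t) 2) has_field_derivative - vec_nth (F k \<zeta> z) 1) (at z)"
    unfolding F_eq[OF U] by (rule T[OF L(2)]) (simp add: F_eq[OF U(1)])
qed

lemma F_limits:
  assumes "\<not> is_pole y z" "\<epsilon> > 0"
  shows "((\<lambda>\<zeta>. exp (4 / 5 * h k \<zeta> ^ 5 - z * h k \<zeta>) * (inverse (q k \<zeta>) * vec_nth (F k \<zeta> z) 1)) \<longlongrightarrow> 1)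
      (inf at_infinity (principal (sector k \<epsilon>)))"
    "((\<lambda>\<zeta>. exp (4 / 5 * h k \<zeta> ^ 5 - z * h k \<zeta>) * (q k \<zeta> * vec_nth (F k \<zeta> z) 2)) \<longlongrightarrow> 1)
      (inf at_infinity (principal (sector k \<epsilon>)))"
proof -
  obtain U where U: "regular_region y U" "z \<in> U" using regular_region_exists[OF assms(1)] .
  from normalized_solution_limits[OF \<Phi>[OF U(1)] U(2) assms(2)]
  show "((\<lambda>\<zeta>. exp (4 / 5 * h k \<zeta> ^ 5 - z * h k \<zeta>) * (inverse (q k \<zeta>) * vec_nth (F k \<zeta> z) 1)) \<longlongrightarrow> 1)
      (inf at_infinity (principal (sector k \<epsilon>)))"
    "((\<lambda>\<zeta>. exp (4 / 5 * h k \<zeta> ^ 5 - z * h k \<zeta>) * (q k \<zeta> * vec_nth (F k \<zeta> z) 2)) \<longlongrightarrow> 1)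
      (inf at_infinity (principal (sector k \<epsilon>)))"
    by (simp_all only: F_eq[OF U])
qed

lemma h_sq: "\<zeta> \<in> sector k 0 \<Longrightarrow> (h k \<zeta>)\<^sup>2 = \<zeta>" and q_fourth: "\<zeta> \<in> sector k 0 \<Longrightarrow> q k \<zeta> ^ 4 = \<zeta>"
  using h[of k] q[of k] by (auto simp: sqrt_branch_def fourth_root_branch_def)

lemma h_nonzero: "\<zeta> \<in> sector k 0 \<Longrightarrow> h k \<zeta> \<noteq> 0" and q_nonzero: "\<zeta> \<in> sector k 0 \<Longrightarrow> q k \<zeta> \<noteq> 0"
  by (metis h_sq zero_notin_sector power_zero_numeral) (metis q_fourth zero_notin_sector power_zero_numeral)

text \<open>Since q^4 = h^2, one sign s with q^2 = s h serves the whole sector. For s = 1 the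
  normalization would say f2' = - f1 ~ - h f2, against the factor exp (z h) that it prescribes for
  f2; comparing two regular points near the pole makes this precise.\<close>

lemma q_sq:
  assumes pole: "is_pole y a" and \<zeta>: "\<zeta> \<in> sector k 0"
  shows "(q k \<zeta>)\<^sup>2 = - h k \<zeta>"
proof -
  obtain s where s: "s = 1 \<or> s = - 1" "\<And>\<zeta>. \<zeta> \<in> sector k 0 \<Longrightarrow> (q k \<zeta>)\<^sup>2 = s * h k \<zeta>"
  proof (rule sign_constant)
    show "continuous_on (sector k 0) (\<lambda>\<zeta>. (q k \<zeta>)\<^sup>2)" "continuous_on (sector k 0) (h k)"
      using h[of k] q[of k] by (auto simp: sqrt_branch_def fourth_root_branch_def intro!: continuous_intros)
    show "((q k \<zeta>)\<^sup>2)\<^sup>2 = (h k \<zeta>)\<^sup>2" if "\<zeta> \<in> sector k 0" for \<zeta>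
      using h_sq[OF that] q_fourth[OF that] by simp
  qed (use connected_sector h_nonzero in auto)
  have "s \<noteq> 1"
  proof
    assume "s = 1"
    then have qh: "(q k \<zeta>)\<^sup>2 = h k \<zeta>" if "\<zeta> \<in> sector k 0" for \<zeta> using s(2)[OF that] by simp
    obtain d where d: "norm d = 1" "\<And>r. r > 0 \<Longrightarrow> h k (of_real r * cis (2 * pi * of_int k / 5)) * d = of_real (sqrt r)"
      using sqrt_branch_half_plane[OF h[of k]] by metis
    obtain \<rho> S where \<rho>: "\<rho> > 0" "\<And>z. z \<in> ball a \<rho> - {a} \<Longrightarrow> \<not> is_pole y z"
      using painleve_laurent[OF PI pole] by metis
    \<comment> \<open>On the central ray h d = sqrt r, so h (z1 - z0) = - (\<rho> / 4) sqrt r tends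
      to minus infinity. Both points lie on the same side of a, and the segment stays in the
      punctured disc.\<close>
    define z0 z1 where "z0 = a - of_real (\<rho> / 4) * d" and "z1 = a - of_real (\<rho> / 2) * d"
    have seg: "\<not> is_pole y z" if zseg: "z \<in> closed_segment z0 z1" for z
    proof (rule \<rho>(2))
      obtain t where t: "0 \<le> t" "t \<le> 1" "z = (1 - t) *\<^sub>R z0 + t *\<^sub>R z1"
        using zseg by (auto simp: closed_segment_def)
      have z: "z - a = of_real (- (\<rho> / 4 * (1 + t))) * d"
        by (simp add: t(3) z0_def z1_def scaleR_conv_of_real field_simps)
      have "norm (z - a) = \<rho> / 4 * (1 + t)"
        unfolding z norm_mult norm_of_real d(1) using \<rho>(1) t by simp
      moreover have "\<rho> / 4 * (1 + t) > 0" "\<rho> / 4 * (1 + t) \<le> \<rho> / 4 * 2"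
        using \<rho>(1) t by (simp_all add: mult_left_mono)
      ultimately have "norm (z - a) > 0" "norm (z - a) < \<rho>" using \<rho>(1) by linarith+
      then show "z \<in> ball a \<rho> - {a}" by (auto simp: dist_norm norm_minus_commute)
    qed
    \<comment> \<open>With q included, e f2 tends to 1; and since 1 / q = q / h when q^2 = h, the
      other normalization becomes the limit 1 of e f1 / h.\<close>
    define e where "e \<zeta> = exp (4 / 5 * h k \<zeta> ^ 5 - z0 * h k \<zeta>) * q k \<zeta>" for \<zeta>
    have e1: "exp (- (h k \<zeta> * (z1 - z0))) * e \<zeta> = exp (4 / 5 * h k \<zeta> ^ 5 - z1 * h k \<zeta>) * q k \<zeta>" for \<zeta>
      by (simp add: e_def mult.assoc[symmetric] exp_add[symmetric] algebra_simps)
    have D: "z1 - z0 = of_real (- (\<rho> / 4)) * d" by (simp add: z0_def z1_def algebra_simps)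
    have ray: "eventually (\<lambda>\<zeta>. \<zeta> \<in> sector k 0) (central_ray k)"
      by (rule eventually_central_ray_sector)
    have lims: "((\<lambda>\<zeta>. exp (4 / 5 * h k \<zeta> ^ 5 - z * h k \<zeta>) * q k \<zeta> * vec_nth (F k \<zeta> z) 2) \<longlongrightarrow> 1) (central_ray k)"
      "((\<lambda>\<zeta>. exp (4 / 5 * h k \<zeta> ^ 5 - z * h k \<zeta>) * q k \<zeta> * vec_nth (F k \<zeta> z) 1 / h k \<zeta>) \<longlongrightarrow> 1) (central_ray k)"
      if "z \<in> closed_segment z0 z1" for z
    proof -
      note L = tendsto_mono[OF central_ray_le F_limits(1)[OF seg[OF that], of "pi / 5"]]
        tendsto_mono[OF central_ray_le F_limits(2)[OF seg[OF that], of "pi / 5"]]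
      show "((\<lambda>\<zeta>. exp (4 / 5 * h k \<zeta> ^ 5 - z * h k \<zeta>) * q k \<zeta> * vec_nth (F k \<zeta> z) 2) \<longlongrightarrow> 1) (central_ray k)"
        using L(2) by (simp add: mult.assoc)
      have "eventually (\<lambda>\<zeta>. exp (4 / 5 * h k \<zeta> ^ 5 - z * h k \<zeta>) * (inverse (q k \<zeta>) * vec_nth (F k \<zeta> z) 1)
          = exp (4 / 5 * h k \<zeta> ^ 5 - z * h k \<zeta>) * q k \<zeta> * vec_nth (F k \<zeta> z) 1 / h k \<zeta>) (central_ray k)"
        using ray
      proof eventually_elim
        case (elim \<zeta>)
        have "E * (inverse (q k \<zeta>) * x) = E * q k \<zeta> * x / h k \<zeta>" for E x
          using q_nonzero[OF elim] by (simp add: qh[OF elim, symmetric] field_simps power2_eq_square)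
        then show ?case .
      qed
      then show "((\<lambda>\<zeta>. exp (4 / 5 * h k \<zeta> ^ 5 - z * h k \<zeta>) * q k \<zeta> * vec_nth (F k \<zeta> z) 1 / h k \<zeta>) \<longlongrightarrow> 1) (central_ray k)"
        by (rule Lim_transform_eventually[OF L(1), rotated]) simp
    qed
    show False
    proof (rule oscillator_sign[of z0 z1 "\<lambda>\<zeta> z. vec_nth (F k \<zeta> z) 1" y "\<lambda>\<zeta> z. vec_nth (F k \<zeta> z) 2"
          "central_ray k" "h k" e])
      show "continuous_on (closed_segment z0 z1) y"
      proof (rule continuous_at_imp_continuous_on, rule ballI)
        fix z assume "z \<in> closed_segment z0 z1"
        then have "y analytic_on {z}" using seg PI by (auto simp: PI_solution_def)
        then show "isCont y z" by (rule analytic_at_imp_isCont)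
      qed
      have sqrt_top: "filterlim (\<lambda>r. sqrt r) at_top at_top" by (rule sqrt_at_top)
      have "eventually (\<lambda>r. sqrt r = norm (h k (of_real r * cis (2 * pi * of_int k / 5)))) at_top"
        using eventually_gt_at_top[of 0]
      proof eventually_elim
        case (elim r)
        have "norm (h k (of_real r * cis (2 * pi * of_int k / 5)) * d) = sqrt r"
          unfolding d(2)[OF elim] using elim by simp
        then show ?case using d(1) by (simp add: norm_mult)
      qed
      then have "filterlim (\<lambda>r. norm (h k (of_real r * cis (2 * pi * of_int k / 5)))) at_top at_top"
        using filterlim_cong[OF refl refl] sqrt_top by fast
      then show "filterlim (\<lambda>\<zeta>. norm (h k \<zeta>)) at_top (central_ray k)"
        by (simp add: central_ray_def filterlim_filtermap)
      have "eventually (\<lambda>r. - (\<rho> / 4) * sqrt r = Re (h k (of_real r * cis (2 * pi * of_int k / 5)) * (z1 - z0))) at_top"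
        using eventually_gt_at_top[of 0]
      proof eventually_elim
        case (elim r)
        have "h k (of_real r * cis (2 * pi * of_int k / 5)) * (z1 - z0)
            = of_real (- (\<rho> / 4)) * (h k (of_real r * cis (2 * pi * of_int k / 5)) * d)"
          unfolding D by (simp only: mult_ac)
        then show ?case unfolding d(2)[OF elim] by simp
      qed
      moreover have "filterlim (\<lambda>r. - (\<rho> / 4) * sqrt r) at_bot at_top"
        using \<rho>(1) by (intro filterlim_tendsto_neg_mult_at_bot[OF tendsto_const _ sqrt_top]) auto
      ultimately have "filterlim (\<lambda>r. Re (h k (of_real r * cis (2 * pi * of_int k / 5)) * (z1 - z0))) at_bot at_top"
        using filterlim_cong[OF refl refl] by fast
      then show "filterlim (\<lambda>\<zeta>. Re (h k \<zeta> * (z1 - z0))) at_bot (central_ray k)"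
        by (simp add: central_ray_def filterlim_filtermap)
      show "eventually (\<lambda>\<zeta>. (h k \<zeta>)\<^sup>2 = \<zeta>) (central_ray k)"
        using ray by eventually_elim (rule h_sq)
    next
      show "((\<lambda>\<zeta>. e \<zeta> * vec_nth (F k \<zeta> z0) 2) \<longlongrightarrow> 1) (central_ray k)"
        "((\<lambda>\<zeta>. e \<zeta> * vec_nth (F k \<zeta> z0) 1 / h k \<zeta>) \<longlongrightarrow> 1) (central_ray k)"
        unfolding e_def by (rule lims[OF ends_in_segment(1)])+
      show "((\<lambda>\<zeta>. exp (- (h k \<zeta> * (z1 - z0))) * e \<zeta> * vec_nth (F k \<zeta> z1) 2) \<longlongrightarrow> 1) (central_ray k)"
        "((\<lambda>\<zeta>. exp (- (h k \<zeta> * (z1 - z0))) * e \<zeta> * vec_nth (F k \<zeta> z1) 1 / h k \<zeta>) \<longlongrightarrow> 1) (central_ray k)"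
        unfolding e1 by (rule lims[OF ends_in_segment(2)])+
    qed (use F_deform[OF seg] central_ray_neq_bot in auto)
  qed
  with s(1) s(2)[OF \<zeta>] show ?thesis by simp
qed

section \<open>Local structure of the glued solutions at a pole\<close>

lemma lax_at_pole_exists:
  assumes pole: "is_pole y a"
  obtains S \<rho> where "\<And>k. lax_at_pole y S a (fls_nth (laurent_expansion y a) 4) \<rho>
      (\<lambda>\<zeta> z. vec_nth (F k \<zeta> z) 1) (\<lambda>\<zeta> z. vec_nth (F k \<zeta> z) 2)"
    "\<rho> > 0" "\<And>z. z \<in> ball a \<rho> - {a} \<Longrightarrow> \<not> is_pole y z"
proof -
  define b where "b = fls_nth (laurent_expansion y a) 4"
  obtain r S where r: "r > 0" "S holomorphic_on ball a r"
    and yS: "\<And>z. z \<in> ball a r - {a} \<Longrightarrow> \<not> is_pole y z \<and>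
       y z = 1 / (z - a)\<^sup>2 + a * (z - a)\<^sup>2 / 10 + (z - a) ^ 3 / 6 + b * (z - a) ^ 4 + (z - a) ^ 5 * S z"
    using painleve_laurent[OF PI pole] unfolding b_def by metis
  have np: "\<And>z. z \<in> ball a r - {a} \<Longrightarrow> \<not> is_pole y z" using yS by blast
  \<comment> \<open>The locale asks for data on the ball of twice its radius parameter, hence the
    parameter r / 2.\<close>
  have rr: "2 * (r / 2) = r" by simp
  have "lax_at_pole y S a b (r / 2) (\<lambda>\<zeta> z. vec_nth (F k \<zeta> z) 1) (\<lambda>\<zeta> z. vec_nth (F k \<zeta> z) 2)" for k
    by (rule lax_at_pole.intro, unfold rr, simp add: r(1), rule r(2), erule conjunct2[OF yS],
        (rule F_deform[OF np] F_spectral[OF np], assumption)+)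
  then show ?thesis
    using r(1) yS by (intro that[of S "r / 2"]) (auto simp: b_def)
qed

lemma pole_data:
  assumes pole: "is_pole y a"
  obtains \<rho> P W where "\<rho> > 0"
    "\<And>\<zeta> z. z \<in> ball a \<rho> - {a} \<Longrightarrow> vec_nth (F k \<zeta> z) 1 = P \<zeta> z / (z - a)\<^sup>2 - (z - a) * W \<zeta> z + \<zeta> * P \<zeta> z"
    "\<And>\<zeta> z. z \<in> ball a \<rho> - {a} \<Longrightarrow> vec_nth (F k \<zeta> z) 2 = P \<zeta> z / (z - a)"
    "\<And>\<zeta>. P \<zeta> holomorphic_on ball a \<rho>" "\<And>\<zeta>. W \<zeta> holomorphic_on ball a \<rho>"
    "\<And>z. z \<in> ball a \<rho> \<Longrightarrow> (\<lambda>\<zeta>. P \<zeta> z) holomorphic_on UNIV"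
    "\<And>z. z \<in> ball a \<rho> \<Longrightarrow> (\<lambda>\<zeta>. W \<zeta> z) holomorphic_on UNIV"
    "continuous_on (UNIV \<times> ball a \<rho>) (\<lambda>(\<zeta>, z). P \<zeta> z)"
    "continuous_on (UNIV \<times> ball a \<rho>) (\<lambda>(\<zeta>, z). W \<zeta> z)"
    "\<And>\<zeta>. deriv (deriv (\<lambda>s. P s a)) \<zeta> =
      (4 * \<zeta> ^ 3 - 2 * a * \<zeta> - 28 * fls_nth (laurent_expansion y a) 4) * P \<zeta> a"
    "\<And>\<epsilon>. \<epsilon> > 0 \<Longrightarrow> ((\<lambda>\<zeta>. three_quarter_power (q k) \<zeta> * exp (4 / 5 * h k \<zeta> ^ 5 - a * h k \<zeta>) * P \<zeta> a)
      \<longlongrightarrow> \<i>) (inf at_infinity (principal (sector k \<epsilon>)))"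
proof -
  obtain S \<rho> where S: "lax_at_pole y S a (fls_nth (laurent_expansion y a) 4) \<rho>
      (\<lambda>\<zeta> z. vec_nth (F k \<zeta> z) 1) (\<lambda>\<zeta> z. vec_nth (F k \<zeta> z) 2)" and \<rho>: "\<rho> > 0"
    and np: "\<And>z. z \<in> ball a \<rho> - {a} \<Longrightarrow> \<not> is_pole y z"
    using lax_at_pole_exists[OF pole] by metis
  show ?thesis
  proof (rule lax_at_pole.pole_structure[OF S])
    fix P W
    assume FP: "\<And>\<zeta> z. z \<in> ball a \<rho> - {a} \<Longrightarrow> vec_nth (F k \<zeta> z) 1 = P \<zeta> z / (z - a)\<^sup>2 - (z - a) * W \<zeta> z + \<zeta> * P \<zeta> z"
      "\<And>\<zeta> z. z \<in> ball a \<rho> - {a} \<Longrightarrow> vec_nth (F k \<zeta> z) 2 = P \<zeta> z / (z - a)"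
      "\<And>\<zeta>. P \<zeta> holomorphic_on ball a \<rho>" "\<And>\<zeta>. W \<zeta> holomorphic_on ball a \<rho>"
      "\<And>z. z \<in> ball a \<rho> \<Longrightarrow> (\<lambda>\<zeta>. P \<zeta> z) holomorphic_on UNIV"
      "\<And>z. z \<in> ball a \<rho> \<Longrightarrow> (\<lambda>\<zeta>. W \<zeta> z) holomorphic_on UNIV"
      "continuous_on (UNIV \<times> ball a \<rho>) (\<lambda>(\<zeta>, z). P \<zeta> z)"
      "continuous_on (UNIV \<times> ball a \<rho>) (\<lambda>(\<zeta>, z). W \<zeta> z)"
      "\<And>\<zeta>. deriv (deriv (\<lambda>s. P s a)) \<zeta> =
        (4 * \<zeta> ^ 3 - 2 * a * \<zeta> - 28 * fls_nth (laurent_expansion y a) 4) * P \<zeta> a"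
    assume asym: "\<And>F' z0 e h. z0 \<in> ball a \<rho> - {a} \<Longrightarrow> filterlim (\<lambda>\<zeta>. \<zeta>) at_infinity F' \<Longrightarrow>
      eventually (\<lambda>\<zeta>. (h \<zeta>)\<^sup>2 = \<zeta>) F' \<Longrightarrow> eventually (\<lambda>\<zeta>. Re (h \<zeta> * (a - z0)) \<ge> 0) F' \<Longrightarrow>
      eventually (\<lambda>\<zeta>. e \<zeta> \<noteq> 0) F' \<Longrightarrow>
      ((\<lambda>\<zeta>. e \<zeta> * vec_nth (F k \<zeta> z0) 2) \<longlongrightarrow> 1) F' \<Longrightarrow> ((\<lambda>\<zeta>. e \<zeta> * vec_nth (F k \<zeta> z0) 1 / h \<zeta>) \<longlongrightarrow> - 1) F' \<Longrightarrow>
      ((\<lambda>\<zeta>. exp (- (h \<zeta> * (a - z0))) * e \<zeta> * h \<zeta> * P \<zeta> a) \<longlongrightarrow> - 1) F'"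
    have "((\<lambda>\<zeta>. three_quarter_power (q k) \<zeta> * exp (4 / 5 * h k \<zeta> ^ 5 - a * h k \<zeta>) * P \<zeta> a)
      \<longlongrightarrow> \<i>) (inf at_infinity (principal (sector k \<epsilon>)))" if \<epsilon>: "\<epsilon> > 0" for \<epsilon>
    proof -
      define G where "G = inf at_infinity (principal (sector k \<epsilon>))"
      have sec: "eventually (\<lambda>\<zeta>. \<zeta> \<in> sector k 0) G"
        unfolding G_def eventually_inf_principal using sector_mono[of \<epsilon> k] \<epsilon> by (auto intro!: always_eventually)
      obtain d where d: "norm d = 1" "\<And>\<zeta>. \<zeta> \<in> sector k 0 \<Longrightarrow> Re (h k \<zeta> * d) \<ge> 0"
        using sqrt_branch_half_plane[OF h[of k]] by metis
      \<comment> \<open>a - z0 is a positive multiple of d, so Re (h (a - z0)) \<ge> 0 on the whole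
        sector and one base point serves all directions at once.\<close>
      define z0 where "z0 = a - of_real (\<rho> / 2) * d"
      have az0: "a - z0 = of_real (\<rho> / 2) * d" by (simp add: z0_def)
      have "norm (a - z0) = \<rho> / 2" unfolding az0 norm_mult using \<rho> d(1) by simp
      then have z0: "z0 \<in> ball a \<rho> - {a}" using \<rho> by (auto simp: dist_norm)
      define e where "e \<zeta> = exp (4 / 5 * h k \<zeta> ^ 5 - z0 * h k \<zeta>) * q k \<zeta>" for \<zeta>
      note L = F_limits[OF np[OF z0] \<epsilon>, of k, folded G_def]
      have "((\<lambda>\<zeta>. exp (- (h k \<zeta> * (a - z0))) * e \<zeta> * h k \<zeta> * P \<zeta> a) \<longlongrightarrow> - 1) G"
      proof (rule asym[OF z0])
        show "filterlim (\<lambda>\<zeta>. \<zeta>) at_infinity G" by (simp add: filterlim_def G_def)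
        show "eventually (\<lambda>\<zeta>. (h k \<zeta>)\<^sup>2 = \<zeta>) G" using sec by eventually_elim (rule h_sq)
        show "eventually (\<lambda>\<zeta>. Re (h k \<zeta> * (a - z0)) \<ge> 0) G"
          using sec
        proof eventually_elim
          case (elim \<zeta>)
          have Re_mult: "Re (of_real x * v) = x * Re v" for x v by simp
          have "h k \<zeta> * (a - z0) = of_real (\<rho> / 2) * (h k \<zeta> * d)" unfolding az0 by (simp only: mult_ac)
          then have "Re (h k \<zeta> * (a - z0)) = \<rho> / 2 * Re (h k \<zeta> * d)" by (simp only: Re_mult)
          then show ?case using mult_nonneg_nonneg[of "\<rho> / 2" "Re (h k \<zeta> * d)"] d(2)[OF elim] \<rho> by linarith
        qed
        show "eventually (\<lambda>\<zeta>. e \<zeta> \<noteq> 0) G"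
          using sec by eventually_elim (simp add: e_def q_nonzero)
        show "((\<lambda>\<zeta>. e \<zeta> * vec_nth (F k \<zeta> z0) 2) \<longlongrightarrow> 1) G"
          using L(2) by (simp add: e_def mult.assoc)
        \<comment> \<open>Here \<open>q_sq\<close> enters: 1 / q = - q / h, which gives the limit -1
          for the first component.\<close>
        have "eventually (\<lambda>\<zeta>. - (exp (4 / 5 * h k \<zeta> ^ 5 - z0 * h k \<zeta>) * (inverse (q k \<zeta>) * vec_nth (F k \<zeta> z0) 1))
          = e \<zeta> * vec_nth (F k \<zeta> z0) 1 / h k \<zeta>) G"
          using sec
        proof eventually_elim
          case (elim \<zeta>)
          have "h k \<zeta> = - (q k \<zeta> * q k \<zeta>)" using q_sq[OF pole elim] by (simp add: power2_eq_square)
          then have "- (E * (inverse (q k \<zeta>) * x)) = E * q k \<zeta> * x / h k \<zeta>" for E x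
            using q_nonzero[OF elim] by (simp add: field_simps)
          then show ?case unfolding e_def .
        qed
        with tendsto_minus[OF L(1)] show "((\<lambda>\<zeta>. e \<zeta> * vec_nth (F k \<zeta> z0) 1 / h k \<zeta>) \<longlongrightarrow> - 1) G"
          by (rule Lim_transform_eventually)
      qed
      \<comment> \<open>The factor comes from (- \<i> q)^3 = - \<i> q h and turns the limit -1 into
        \<i>. The exponential at z0 and the transport factor combine to the exponential at
        a.\<close>
      then have "((\<lambda>\<zeta>. - \<i> * (exp (- (h k \<zeta> * (a - z0))) * e \<zeta> * h k \<zeta> * P \<zeta> a)) \<longlongrightarrow> - \<i> * - 1) G"
        by (intro tendsto_intros)
      moreover have "eventually (\<lambda>\<zeta>. - \<i> * (exp (- (h k \<zeta> * (a - z0))) * e \<zeta> * h k \<zeta> * P \<zeta> a)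
          = three_quarter_power (q k) \<zeta> * exp (4 / 5 * h k \<zeta> ^ 5 - a * h k \<zeta>) * P \<zeta> a) G"
        using sec
      proof eventually_elim
        case (elim \<zeta>)
        have 1: "exp (- (h k \<zeta> * (a - z0))) * e \<zeta> = exp (4 / 5 * h k \<zeta> ^ 5 - a * h k \<zeta>) * q k \<zeta>"
          by (simp add: e_def mult.assoc[symmetric] exp_add[symmetric] algebra_simps)
        have "(- \<i> * q k \<zeta>) ^ 3 = - \<i> * q k \<zeta> * (- \<i> * - \<i>) * (q k \<zeta>)\<^sup>2"
          by (simp only: power3_eq_cube power2_eq_square mult_ac)
        then have 2: "three_quarter_power (q k) \<zeta> = - \<i> * q k \<zeta> * h k \<zeta>"
          unfolding three_quarter_power_def q_sq[OF pole elim] by simp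
        show ?case unfolding 1 2 by (simp only: mult_ac)
      qed
      ultimately have "((\<lambda>\<zeta>. three_quarter_power (q k) \<zeta> * exp (4 / 5 * h k \<zeta> ^ 5 - a * h k \<zeta>) * P \<zeta> a)
          \<longlongrightarrow> - \<i> * - 1) G"
        by (rule Lim_transform_eventually)
      then show ?thesis by (simp add: G_def)
    qed
    from that[OF \<rho> FP this] show thesis .
  qed
qed

section \<open>Meromorphy, order of the poles and Stokes relations\<close>

lemma F_regular:
  assumes "\<not> is_pole y a"
  shows "(\<lambda>z. vec_nth (F k \<zeta> z) i) analytic_on {a}"
proof -
  obtain U where U: "regular_region y U" "a \<in> U" using regular_region_exists[OF assms] .
  have np: "\<not> is_pole y z" if "z \<in> U" for z using regular_region_not_pole[OF U(1) that] .
  have "open U" using U by (simp add: regular_region_def)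
  have "\<forall>i. (\<lambda>z. vec_nth (F k \<zeta> z) i) holomorphic_on U"
    unfolding forall_2 holomorphic_on_open[OF \<open>open U\<close>] using F_deform[OF np] by blast
  then have "(\<lambda>z. vec_nth (F k \<zeta> z) i) analytic_on U"
    using \<open>open U\<close> by (simp add: analytic_on_open)
  then show ?thesis by (rule analytic_on_subset) (use U in simp)
qed

lemma F_meromorphic: "(\<lambda>z. vec_nth (F k \<zeta> z) i) meromorphic_on UNIV"
proof (subst meromorphic_on_meromorphic_at, rule ballI)
  fix a
  show "(\<lambda>z. vec_nth (F k \<zeta> z) i) meromorphic_on {a}"
  proof (cases "is_pole y a")
    case False
    then show ?thesis using F_regular by (intro analytic_on_imp_meromorphic_on)
  next
    case True
    obtain \<rho> P W where P: "\<rho> > 0"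
      "\<And>\<zeta> z. z \<in> ball a \<rho> - {a} \<Longrightarrow> vec_nth (F k \<zeta> z) 1 = P \<zeta> z / (z - a)\<^sup>2 - (z - a) * W \<zeta> z + \<zeta> * P \<zeta> z"
      "\<And>\<zeta> z. z \<in> ball a \<rho> - {a} \<Longrightarrow> vec_nth (F k \<zeta> z) 2 = P \<zeta> z / (z - a)"
      "\<And>\<zeta>. P \<zeta> holomorphic_on ball a \<rho>" "\<And>\<zeta>. W \<zeta> holomorphic_on ball a \<rho>"
      by (rule pole_data[OF True, of k]) blast
    have ev: "eventually (\<lambda>z. z \<in> ball a \<rho> - {a}) (at a)"
      using P(1) by (intro eventually_at_in_open) auto
    have mero: "g meromorphic_on {a}" if "g holomorphic_on ball a \<rho>" for g
      using that P(1) by (intro analytic_on_imp_meromorphic_on) (auto simp: analytic_on_def)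
    have transfer: "f meromorphic_on {a}"
      if "g meromorphic_on {a}" "\<And>z. z \<in> ball a \<rho> - {a} \<Longrightarrow> f z = g z" for f g
    proof -
      have "eventually (\<lambda>z. f z = g z) (at a)"
        using ev by eventually_elim (rule that(2))
      then show ?thesis
        using meromorphic_on_cong[of "{a}" f g "{a}"] that(1) by simp
    qed
    have "(\<lambda>z. vec_nth (F k \<zeta> z) 1) meromorphic_on {a}"
      by (rule transfer[OF _ P(2)]) (intro meromorphic_intros mero P)
    moreover have "(\<lambda>z. vec_nth (F k \<zeta> z) 2) meromorphic_on {a}"
      by (rule transfer[OF _ P(3)]) (intro meromorphic_intros mero P)
    ultimately have "\<forall>i. (\<lambda>z. vec_nth (F k \<zeta> z) i) meromorphic_on {a}" by (simp add: forall_2)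
    then show ?thesis by blast
  qed
qed

lemma sector_filter_neq_bot: "inf at_infinity (principal (sector k (pi / 5))) \<noteq> bot"
  using central_ray_le[of k] central_ray_neq_bot[of k] by (metis bot.extremum_uniqueI)

text \<open>Multiplication by (z - a)^2 leaves P \<zeta> a in the first component at the pole and 0
  in the second. P \<zeta> a cannot vanish for all \<zeta>, because its weighted limit in the sector
  is \<i>.\<close>

lemma F_double_pole:
  assumes pole: "is_pole y a"
  shows "pole_of_order 2 (F k) a"
proof -
  obtain \<rho> P W where \<rho>: "\<rho> > 0"
    and F1: "\<And>\<zeta> z. z \<in> ball a \<rho> - {a} \<Longrightarrow> vec_nth (F k \<zeta> z) 1 = P \<zeta> z / (z - a)\<^sup>2 - (z - a) * W \<zeta> z + \<zeta> * P \<zeta> z"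
    and F2: "\<And>\<zeta> z. z \<in> ball a \<rho> - {a} \<Longrightarrow> vec_nth (F k \<zeta> z) 2 = P \<zeta> z / (z - a)"
    and hol: "\<And>\<zeta>. P \<zeta> holomorphic_on ball a \<rho>" "\<And>\<zeta>. W \<zeta> holomorphic_on ball a \<rho>"
      "\<And>z. z \<in> ball a \<rho> \<Longrightarrow> (\<lambda>\<zeta>. P \<zeta> z) holomorphic_on UNIV"
      "\<And>z. z \<in> ball a \<rho> \<Longrightarrow> (\<lambda>\<zeta>. W \<zeta> z) holomorphic_on UNIV"
    and cont: "continuous_on (UNIV \<times> ball a \<rho>) (\<lambda>(\<zeta>, z). P \<zeta> z)"
      "continuous_on (UNIV \<times> ball a \<rho>) (\<lambda>(\<zeta>, z). W \<zeta> z)"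
    and lim: "\<And>\<epsilon>. \<epsilon> > 0 \<Longrightarrow> ((\<lambda>\<zeta>. three_quarter_power (q k) \<zeta> * exp (4 / 5 * h k \<zeta> ^ 5 - a * h k \<zeta>) * P \<zeta> a)
      \<longlongrightarrow> \<i>) (inf at_infinity (principal (sector k \<epsilon>)))"
    by (rule pole_data[OF pole, of k]) blast
  define G1 where "G1 \<zeta> z = P \<zeta> z - (z - a) ^ 3 * W \<zeta> z + \<zeta> * (z - a)\<^sup>2 * P \<zeta> z" for \<zeta> z
  define G2 where "G2 \<zeta> z = (z - a) * P \<zeta> z" for \<zeta> z
  define G :: "complex \<Rightarrow> complex \<Rightarrow> complex^2" where "G \<zeta> z = vector [G1 \<zeta> z, G2 \<zeta> z]" for \<zeta> z
  have G: "vec_nth (G \<zeta> z) 1 = G1 \<zeta> z" "vec_nth (G \<zeta> z) 2 = G2 \<zeta> z" for \<zeta> z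
    by (simp_all add: G_def)
  have "jointly_holomorphic G (ball a \<rho>)"
    unfolding jointly_holomorphic_def
  proof (intro conjI allI ballI)
    have "continuous_on (UNIV \<times> ball a \<rho>) (\<lambda>x. G1 (fst x) (snd x))"
      "continuous_on (UNIV \<times> ball a \<rho>) (\<lambda>x. G2 (fst x) (snd x))"
      unfolding G1_def G2_def by (intro continuous_intros cont[unfolded case_prod_unfold])+
    then have "\<forall>i. continuous_on (UNIV \<times> ball a \<rho>) (\<lambda>x. vec_nth (G (fst x) (snd x)) i)"
      by (simp add: forall_2 G)
    then have "continuous_on (UNIV \<times> ball a \<rho>) (\<lambda>x. \<chi> i. vec_nth (G (fst x) (snd x)) i)"
      by (intro continuous_on_vec_lambda) blast
    then show "continuous_on (UNIV \<times> ball a \<rho>) (\<lambda>(\<zeta>, z). G \<zeta> z)"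
      by (simp add: case_prod_unfold)
  next
    fix i z assume z: "z \<in> ball a \<rho>"
    have "\<forall>i. (\<lambda>\<zeta>. vec_nth (G \<zeta> z) i) holomorphic_on UNIV"
      unfolding forall_2 G G1_def G2_def by (intro conjI holomorphic_intros hol z)
    then show "(\<lambda>\<zeta>. vec_nth (G \<zeta> z) i) holomorphic_on UNIV" by blast
  next
    fix i \<zeta>
    have "\<forall>i. (\<lambda>z. vec_nth (G \<zeta> z) i) holomorphic_on ball a \<rho>"
      unfolding forall_2 G G1_def G2_def by (intro conjI holomorphic_intros hol)
    then show "(\<lambda>z. vec_nth (G \<zeta> z) i) holomorphic_on ball a \<rho>" by blast
  qed
  moreover have "(z - a)\<^sup>2 *s F k \<zeta> z = G \<zeta> z" if "z \<in> ball a \<rho> - {a}" for \<zeta> z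
  proof -
    define t where "t = z - a"
    have t: "t \<noteq> 0" using that by (simp add: t_def)
    show ?thesis
      unfolding vec_eq_iff forall_2 vector_smult_component G F1[OF that] F2[OF that] G1_def G2_def t_def[symmetric]
      using t by (simp add: field_simps power2_eq_square power3_eq_cube)
  qed
  moreover have "\<exists>\<zeta>. G \<zeta> a \<noteq> 0"
  proof (rule ccontr)
    assume "\<not> (\<exists>\<zeta>. G \<zeta> a \<noteq> 0)"
    then have "P \<zeta> a = 0" for \<zeta> using G(1)[of \<zeta> a] by (simp add: G1_def)
    then have "((\<lambda>\<zeta>. 0) \<longlongrightarrow> \<i>) (inf at_infinity (principal (sector k (pi / 5))))"
      using lim[of "pi / 5"] by simp
    then show False
      using sector_filter_neq_bot[of k] by (simp add: tendsto_const_iff)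
  qed
  ultimately show ?thesis
    unfolding pole_of_order_def using \<rho> by (intro conjI exI[of _ \<rho>] exI[of _ G]) auto
qed

text \<open>Where y is regular F is holomorphic in z, so (z - a)^n F tends to 0 for n > 0, and a
  nonzero leading coefficient is impossible.\<close>

lemma pole_of_order_imp_is_pole:
  assumes "pole_of_order n (F k) a"
  shows "is_pole y a"
proof (rule ccontr)
  assume np: "\<not> is_pole y a"
  obtain r G where n: "0 < n" and r: "r > 0" and G: "jointly_holomorphic G (ball a r)"
    and eq: "\<And>\<zeta> z. z \<in> ball a r - {a} \<Longrightarrow> (z - a) ^ n *s F k \<zeta> z = G \<zeta> z" and nz: "\<exists>\<zeta>. G \<zeta> a \<noteq> 0"
    using assms unfolding pole_of_order_def by blast
  have "vec_nth (G \<zeta> a) i = 0" for \<zeta> i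
  proof (rule tendsto_unique[OF trivial_limit_at])
    have "isCont (\<lambda>z. vec_nth (G \<zeta> z) i) a"
      using G r unfolding jointly_holomorphic_def
      by (metis centre_in_ball continuous_on_eq_continuous_at holomorphic_on_imp_continuous_on open_ball)
    then show "((\<lambda>z. vec_nth (G \<zeta> z) i) \<longlongrightarrow> vec_nth (G \<zeta> a) i) (at a)" by (simp add: isCont_def)
    have "isCont (\<lambda>z. vec_nth (F k \<zeta> z) i) a"
      by (rule analytic_at_imp_isCont[OF F_regular[OF np]])
    then have "((\<lambda>z. (z - a) ^ n * vec_nth (F k \<zeta> z) i) \<longlongrightarrow> (a - a) ^ n * vec_nth (F k \<zeta> a) i) (at a)"
      unfolding isCont_def
      by (intro tendsto_mult[OF tendsto_power[OF tendsto_diff[OF tendsto_ident_at tendsto_const]]])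
    moreover have "eventually (\<lambda>z. z \<in> ball a r - {a}) (at a)"
      using r by (intro eventually_at_in_open) auto
    then have "eventually (\<lambda>z. (z - a) ^ n * vec_nth (F k \<zeta> z) i = vec_nth (G \<zeta> z) i) (at a)"
      by eventually_elim (metis eq vector_smult_component)
    ultimately have "((\<lambda>z. vec_nth (G \<zeta> z) i) \<longlongrightarrow> (a - a) ^ n * vec_nth (F k \<zeta> a) i) (at a)"
      by (rule Lim_transform_eventually)
    then show "((\<lambda>z. vec_nth (G \<zeta> z) i) \<longlongrightarrow> 0) (at a)" using n by (simp add: zero_power)
  qed
  then show False using nz by (simp add: vec_eq_iff)
qed

lemma stokes_relation:
  assumes "stokes_multiplier y \<Phi> k \<sigma>" "\<not> is_pole y z"
  shows "F (k - 1) \<zeta> z = F (k + 1) \<zeta> z + \<sigma> *s F k \<zeta> z"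
proof -
  obtain U where U: "regular_region y U" "z \<in> U" using regular_region_exists[OF assms(2)] .
  then show ?thesis using assms(1) unfolding stokes_multiplier_def by (simp add: F_eq[OF U])
qed

lemma residue_functions:
  assumes pole: "is_pole y a"
  defines "b \<equiv> fls_nth (laurent_expansion y a) 4"
  shows "\<exists>\<Psi> :: int \<Rightarrow> complex \<Rightarrow> complex.
        (\<forall>k \<zeta>. ((\<lambda>z. (z - a) * vec_nth (F k \<zeta> z) 2) \<longlongrightarrow> \<Psi> k \<zeta>) (at a)) \<and>
        (\<forall>k. \<Psi> k holomorphic_on UNIV \<and>
             (\<forall>\<zeta>. deriv (deriv (\<Psi> k)) \<zeta> = (4 * \<zeta> ^ 3 - 2 * a * \<zeta> - 28 * b) * \<Psi> k \<zeta>)) \<and>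
        (\<forall>k. \<forall>\<epsilon>>0.
          ((\<lambda>\<zeta>. three_quarter_power (q k) \<zeta> * exp (4 / 5 * h k \<zeta> ^ 5 - a * h k \<zeta>) * \<Psi> k \<zeta>)
            \<longlongrightarrow> \<i>) (inf at_infinity (principal (sector k \<epsilon>)))) \<and>
        (\<forall>k \<sigma>. stokes_multiplier y \<Phi> k \<sigma> \<longrightarrow>
          (\<forall>\<zeta>. \<Psi> (k - 1) \<zeta> = \<Psi> (k + 1) \<zeta> + \<sigma> * \<Psi> k \<zeta>))"
proof -
  \<comment> \<open>The properties that concern a single index are bundled so that \<Psi> is chosen
    with all of them at once. The Stokes relation couples three indices and follows afterwards from
    uniqueness of limits.\<close>
  define Q where "Q k \<psi> \<longleftrightarrow> (\<forall>\<zeta>. ((\<lambda>z. (z - a) * vec_nth (F k \<zeta> z) 2) \<longlongrightarrow> \<psi> \<zeta>) (at a)) \<and>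
      \<psi> holomorphic_on UNIV \<and>
      (\<forall>\<zeta>. deriv (deriv \<psi>) \<zeta> = (4 * \<zeta> ^ 3 - 2 * a * \<zeta> - 28 * b) * \<psi> \<zeta>) \<and>
      (\<forall>\<epsilon>>0. ((\<lambda>\<zeta>. three_quarter_power (q k) \<zeta> * exp (4 / 5 * h k \<zeta> ^ 5 - a * h k \<zeta>) * \<psi> \<zeta>)
            \<longlongrightarrow> \<i>) (inf at_infinity (principal (sector k \<epsilon>))))" for k \<psi>
  have "\<exists>\<psi>. Q k \<psi>" for k
  proof -
    obtain \<rho> P where \<rho>: "\<rho> > 0"
      and F2: "\<And>\<zeta> z. z \<in> ball a \<rho> - {a} \<Longrightarrow> vec_nth (F k \<zeta> z) 2 = P \<zeta> z / (z - a)"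
      and hol: "\<And>\<zeta>. P \<zeta> holomorphic_on ball a \<rho>" "\<And>z. z \<in> ball a \<rho> \<Longrightarrow> (\<lambda>\<zeta>. P \<zeta> z) holomorphic_on UNIV"
      and ode: "\<And>\<zeta>. deriv (deriv (\<lambda>s. P s a)) \<zeta> = (4 * \<zeta> ^ 3 - 2 * a * \<zeta> - 28 * b) * P \<zeta> a"
      and lim: "\<And>\<epsilon>. \<epsilon> > 0 \<Longrightarrow> ((\<lambda>\<zeta>. three_quarter_power (q k) \<zeta> * exp (4 / 5 * h k \<zeta> ^ 5 - a * h k \<zeta>) * P \<zeta> a)
        \<longlongrightarrow> \<i>) (inf at_infinity (principal (sector k \<epsilon>)))"
      unfolding b_def by (rule pole_data[OF pole, of k]) blast
    have "((\<lambda>z. (z - a) * vec_nth (F k \<zeta> z) 2) \<longlongrightarrow> P \<zeta> a) (at a)" for \<zeta>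
    proof (rule Lim_transform_eventually)
      show "(P \<zeta> \<longlongrightarrow> P \<zeta> a) (at a)"
        using holomorphic_on_imp_continuous_on[OF hol(1)[of \<zeta>]] \<rho>
        by (simp add: continuous_on_eq_continuous_at isCont_def)
      have "eventually (\<lambda>z. z \<in> ball a \<rho> - {a}) (at a)"
        using \<rho> by (intro eventually_at_in_open) auto
      then show "eventually (\<lambda>z. P \<zeta> z = (z - a) * vec_nth (F k \<zeta> z) 2) (at a)"
        by eventually_elim (simp add: F2)
    qed
    then show ?thesis
      unfolding Q_def using hol(2)[of a] \<rho> ode lim by (intro exI[of _ "\<lambda>\<zeta>. P \<zeta> a"]) auto
  qed
  then obtain \<Psi> where "\<And>k. Q k (\<Psi> k)" by metis
  then have \<Psi>: "\<And>k \<zeta>. ((\<lambda>z. (z - a) * vec_nth (F k \<zeta> z) 2) \<longlongrightarrow> \<Psi> k \<zeta>) (at a)"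
    "\<And>k. \<Psi> k holomorphic_on UNIV"
    "\<And>k \<zeta>. deriv (deriv (\<Psi> k)) \<zeta> = (4 * \<zeta> ^ 3 - 2 * a * \<zeta> - 28 * b) * \<Psi> k \<zeta>"
    "\<And>k \<epsilon>. \<epsilon> > 0 \<Longrightarrow> ((\<lambda>\<zeta>. three_quarter_power (q k) \<zeta> * exp (4 / 5 * h k \<zeta> ^ 5 - a * h k \<zeta>) * \<Psi> k \<zeta>)
            \<longlongrightarrow> \<i>) (inf at_infinity (principal (sector k \<epsilon>)))"
    unfolding Q_def by blast+
  have "\<Psi> (k - 1) \<zeta> = \<Psi> (k + 1) \<zeta> + \<sigma> * \<Psi> k \<zeta>" if \<sigma>: "stokes_multiplier y \<Phi> k \<sigma>" for k \<sigma> \<zeta>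
  proof (rule tendsto_unique[OF trivial_limit_at \<Psi>(1)])
    have "eventually (\<lambda>z. \<not> is_pole y z) (at a)"
      using PI by (intro eventually_not_pole meromorphic_on_isolated_singularity)
        (auto simp: PI_solution_def intro: meromorphic_on_subset)
    then have "eventually (\<lambda>z. (z - a) * vec_nth (F (k + 1) \<zeta> z) 2 + \<sigma> * ((z - a) * vec_nth (F k \<zeta> z) 2)
        = (z - a) * vec_nth (F (k - 1) \<zeta> z) 2) (at a)"
      by eventually_elim (simp add: stokes_relation[OF \<sigma>] algebra_simps)
    then show "((\<lambda>z. (z - a) * vec_nth (F (k - 1) \<zeta> z) 2) \<longlongrightarrow> \<Psi> (k + 1) \<zeta> + \<sigma> * \<Psi> k \<zeta>) (at a)"
      by (rule Lim_transform_eventually[OF tendsto_add[OF \<Psi>(1) tendsto_mult_left[OF \<Psi>(1)]]])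
  qed
  note stokes = this
  show ?thesis by (intro exI[of _ \<Psi>] conjI allI impI \<Psi> stokes)
qed

end

theorem theorem2:
  fixes y :: "complex \<Rightarrow> complex"
    and h q :: "int \<Rightarrow> complex \<Rightarrow> complex"
    and \<Phi> :: "int \<Rightarrow> complex set \<Rightarrow> complex \<Rightarrow> complex \<Rightarrow> complex^2"
  assumes "PI_solution y"
    and "\<And>k. sqrt_branch k (h k)"
    and "\<And>k. fourth_root_branch k (q k)"
    and "\<And>k U. regular_region y U \<Longrightarrow> normalized_solution y k (h k) (q k) U (\<Phi> k U)"
  shows "\<exists>F :: int \<Rightarrow> complex \<Rightarrow> complex \<Rightarrow> complex^2.
    (\<forall>k U \<zeta>. regular_region y U \<longrightarrow> (\<forall>z\<in>U. F k \<zeta> z = \<Phi> k U \<zeta> z)) \<and>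
    (\<forall>k. (\<forall>\<zeta> i. (\<lambda>z. F k \<zeta> z $ i) meromorphic_on UNIV) \<and>
         (\<forall>a. singular_point (F k) a \<longrightarrow> pole_of_order 2 (F k) a) \<and>
         (\<forall>a. (\<exists>n. pole_of_order n (F k) a) \<longleftrightarrow> is_pole y a)) \<and>
    (\<forall>a. is_pole y a \<longrightarrow>
      (let b = fls_nth (laurent_expansion y a) 4 in
       \<exists>\<Psi> :: int \<Rightarrow> complex \<Rightarrow> complex.
        (\<forall>k \<zeta>. ((\<lambda>z. (z - a) * F k \<zeta> z $ 2) \<longlongrightarrow> \<Psi> k \<zeta>) (at a)) \<and>
        (\<forall>k. \<Psi> k holomorphic_on UNIV \<and>
             (\<forall>\<zeta>. deriv (deriv (\<Psi> k)) \<zeta> = (4 * \<zeta> ^ 3 - 2 * a * \<zeta> - 28 * b) * \<Psi> k \<zeta>)) \<and>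
        (\<forall>k. \<forall>\<epsilon>>0.
          ((\<lambda>\<zeta>. three_quarter_power (q k) \<zeta> * exp (4 / 5 * h k \<zeta> ^ 5 - a * h k \<zeta>) * \<Psi> k \<zeta>)
            \<longlongrightarrow> \<i>) (inf at_infinity (principal (sector k \<epsilon>)))) \<and>
        (\<forall>k \<sigma>. stokes_multiplier y \<Phi> k \<sigma> \<longrightarrow>
          (\<forall>\<zeta>. \<Psi> (k - 1) \<zeta> = \<Psi> (k + 1) \<zeta> + \<sigma> * \<Psi> k \<zeta>))))"
proof -
  interpret normalized_lax_family y h q \<Phi>
    using assms by unfold_locales
  show ?thesis
    unfolding Let_def
  proof (rule exI[of _ F], intro conjI allI impI ballI)
    show "F k \<zeta> z = \<Phi> k U \<zeta> z" if "regular_region y U" "z \<in> U" for k U \<zeta> z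
      using that by (rule F_eq)
    show "(\<lambda>z. F k \<zeta> z $ i) meromorphic_on UNIV" for k \<zeta> i
      by (rule F_meromorphic)
    show "pole_of_order 2 (F k) a" if "singular_point (F k) a" for k a
      \<comment> \<open>Away from the poles of y the glued solution is analytic, so a singular point
        must be a pole of y.\<close>
      using that F_regular F_double_pole unfolding singular_point_def by blast
    show "(\<exists>n. pole_of_order n (F k) a) \<longleftrightarrow> is_pole y a" for k a
      using F_double_pole pole_of_order_imp_is_pole by blast
  qed (rule residue_functions)
qed

end
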